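(* Let $n\ge 1$ and $m\ge 2$ be integers, let $0<p_j<\infty$ and $f_j\in H^{p_j}(\mathbf{U}^n)$ for $j=1,2,\dots,m$. Then $$\prod_{j=1}^m|f_j|^{p_j}\in L^1(\mathbf{U}^n,dA_{\mathbf{m}-\mathbf{2}})$$ and $$\int_{\mathbf{U}^n}\left\{\prod_{j=1}^m|f_j(z)|^{p_j}\right\}dA_{\mathbf{m}-\mathbf{2}}(z)\le\prod_{j=1}^m\|f_j\|_{p_j}^{p_j}.$$ Equality holds if and only if either $\prod_{j=1}^m f_j\equiv 0$, or there are a common $w\in\mathbf{U}^n$ and constants $c_j\in\mathbf{C}\setminus\{0\}$ such that for each $j=1,2,\dots,m$ $$f_j(z)=c_j\,K_w(z)^{2/p_j},\qquad z\in\mathbf{U}^n,$$ where $K_w(z)=K(z,w)=\prod_{l=1}^n(1-z_l\overline{w}_l)^{-1}$.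
   Context: $\mathbf{U}$ is the open unit disc in $\mathbf{C}$, $\mathbf{U}^n$ the unit polydisc, $\mathbf{T}^n$ the unit torus, $m_n$ the normalized Haar measure on $\mathbf{T}^n$, $dA$ the area measure on $\mathbf{C}$. For $0<p<\infty$, $H^p(\mathbf{U}^n)$ is the set of analytic functions $f$ on $\mathbf{U}^n$ with $\|f\|_p=\sup_{0\le r<1}\left(\int_{\mathbf{T}^n}|f(r\zeta)|^p\,dm_n(\zeta)\right)^{1/p}<\infty$. For an integer $m\ge 2$, $dA_{m-2}(z)=\frac{m-1}{\pi}(1-|z|^2)^{m-2}\,dA(z)$ is a probability measure on $\mathbf{U}$, and $dA_{\mathbf{m}-\mathbf{2}}$ denotes the product measure $dA_{m-2}\times\dots\times dA_{m-2}$ ($n$ factors) on $\mathbf{U}^n$. The function $K(z,w)$ is the Cauchy–Szegő kernel of the polydisc; $K_w$ is zero-free, and $K_w(z)^{2/p}$ is a holomorphic branch of the power on $\mathbf{U}^n$, e.g. $\prod_{l=1}^n(1-z_l\overline w_l)^{-2/p}$ with principal powers. *)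

theory Defs
  imports "HOL-Analysis.Analysis"
begin

definition polydisc :: "(complex ^ 'n) set" where
  "polydisc = {z. \<forall>l. norm (z $ l) < 1}"

definition torus :: "(complex ^ 'n) set" where
  "torus = {z. \<forall>l. norm (z $ l) = 1}"

text \<open>The library notion \<open>holomorphic_on\<close> covers one variable only. In several variables:
  real Frechet differentiable with complex-linear derivative.\<close>

definition analytic_vec_on :: "(complex ^ 'n \<Rightarrow> complex) \<Rightarrow> (complex ^ 'n) set \<Rightarrow> bool" where
  "analytic_vec_on f S \<longleftrightarrow>
     (\<forall>z\<in>S. \<exists>D. (f has_derivative D) (at z) \<and> (\<forall>c v. D (c *s v) = c * D v))"

text \<open>\<open>PiM\<close> lives on functions, so the product is transported to \<open>complex ^ 'n\<close>.\<close>

definition power_measure :: "complex measure \<Rightarrow> (complex ^ 'n) measure" where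
  "power_measure M = distr (PiM UNIV (\<lambda>_. M)) borel vec_lambda"

definition circle_haar :: "complex measure" where
  "circle_haar = distr (uniform_measure lborel {0..<2 * pi}) borel cis"

definition torus_haar :: "(complex ^ 'n) measure" where
  "torus_haar = power_measure circle_haar"

text \<open>\<open>bergman_disc m\<close> and \<open>bergman_polydisc m\<close> are the measures with subscript \<open>m - 2\<close>, extended
  by zero to the whole space.\<close>

definition bergman_disc :: "nat \<Rightarrow> complex measure" where
  "bergman_disc m = density lborel
     (\<lambda>z. ennreal (indicator (ball 0 1) z * ((real m - 1) / pi * (1 - (norm z)\<^sup>2) ^ (m - 2))))"

definition bergman_polydisc :: "nat \<Rightarrow> (complex ^ 'n) measure" where
  "bergman_polydisc m = power_measure (bergman_disc m)"

text \<open>Elements of the Hardy space are unconstrained outside the polydisc, so all integrals are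
  restricted explicitly to the torus or the polydisc; otherwise measurability could fail.\<close>

definition hardy_mean :: "real \<Rightarrow> (complex ^ 'n \<Rightarrow> complex) \<Rightarrow> real \<Rightarrow> real" where
  "hardy_mean p f r =
     (LINT \<zeta>:torus|torus_haar. norm (f (r *\<^sub>R \<zeta>)) powr p) powr (1 / p)"

text \<open>For analytic \<open>f\<close> and \<open>0 \<le> r < 1\<close> the integrand above is bounded and continuous on the torus,
  so the real-valued integral is the true one, and finiteness of the supremum is boundedness.\<close>

definition hardy_norm :: "real \<Rightarrow> (complex ^ 'n \<Rightarrow> complex) \<Rightarrow> real" where
  "hardy_norm p f = (SUP r\<in>{0..<1}. hardy_mean p f r)"

definition hardy_space :: "real \<Rightarrow> (complex ^ 'n \<Rightarrow> complex) set" where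
  "hardy_space p = {f. analytic_vec_on f polydisc \<and> bdd_above (hardy_mean p f ` {0..<1})}"

definition szego_kernel :: "complex ^ 'n \<Rightarrow> complex ^ 'n \<Rightarrow> complex" where
  "szego_kernel z w = (\<Prod>l\<in>UNIV. inverse (1 - z $ l * cnj (w $ l)))"

text \<open>A holomorphic branch of the \<open>s\<close>-th power of the kernel in its first argument, built from the
  principal powers of the factors. The principal power of the product itself need not be
  continuous.\<close>

definition szego_kernel_powr :: "real \<Rightarrow> complex ^ 'n \<Rightarrow> complex ^ 'n \<Rightarrow> complex" where
  "szego_kernel_powr s z w = (\<Prod>l\<in>UNIV. (1 - z $ l * cnj (w $ l)) powr (- of_real s))"

lemma Re_one_minus_pos:
  assumes "z \<in> polydisc" "w \<in> polydisc"
  shows "0 < Re (1 - z $ l * cnj (w $ l))"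
proof -
  have "norm (z $ l) < 1" "norm (w $ l) < 1"
    using assms by (auto simp: polydisc_def)
  then have "norm (z $ l) * norm (w $ l) < 1 * 1"
    by (intro mult_strict_mono') auto
  then have "norm (z $ l * cnj (w $ l)) < 1"
    by (simp add: norm_mult)
  then have "Re (z $ l * cnj (w $ l)) < 1"
    using complex_Re_le_cmod le_less_trans by blast
  then show ?thesis by simp
qed

lemma szego_kernel_powr_branch:
  fixes w :: "complex ^ 'n"
  assumes w: "w \<in> polydisc"
  shows "\<exists>L. analytic_vec_on L polydisc
    \<and> (\<forall>z\<in>polydisc. exp (L z) = szego_kernel z w)
    \<and> (\<forall>s. \<forall>z\<in>polydisc. szego_kernel_powr s z w = exp (of_real s * L z))"
proof -
  define L :: "complex ^ 'n \<Rightarrow> complex"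
    where "L z = - (\<Sum>l\<in>UNIV. Ln (1 - z $ l * cnj (w $ l)))" for z
  have nz: "1 - z $ l * cnj (w $ l) \<noteq> 0" if "z \<in> polydisc" for z l
    using Re_one_minus_pos[OF that w, of l] by (metis less_irrefl zero_complex.simps(1))
  have np: "1 - z $ l * cnj (w $ l) \<notin> \<real>\<^sub>\<le>\<^sub>0" if "z \<in> polydisc" for z l
    using Re_one_minus_pos[OF that w, of l] by (auto simp: complex_nonpos_Reals_iff)
  have "analytic_vec_on L polydisc"
    unfolding analytic_vec_on_def
  proof
    fix z :: "complex ^ 'n" assume z: "z \<in> polydisc"
    let ?D = "\<lambda>v. - (\<Sum>l\<in>UNIV. inverse (1 - z $ l * cnj (w $ l)) * (- (v $ l * cnj (w $ l))))"
    have 1: "((\<lambda>z. Ln (1 - z $ l * cnj (w $ l))) has_derivative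
        (\<lambda>v. inverse (1 - z $ l * cnj (w $ l)) * (- (v $ l * cnj (w $ l))))) (at z)" for l
    proof -
      have "((\<lambda>z. 1 - z $ l * cnj (w $ l)) has_derivative (\<lambda>v. - (v $ l * cnj (w $ l)))) (at z)"
        by (auto intro!: derivative_eq_intros bounded_linear_imp_has_derivative)
      moreover have "(Ln has_derivative (*) (inverse (1 - z $ l * cnj (w $ l))))
          (at (1 - z $ l * cnj (w $ l)))"
        using has_field_derivative_Ln[OF np[OF z, of l]]
        by (simp add: has_field_derivative_def)
      ultimately show ?thesis
        using has_derivative_compose by fastforce
    qed
    have "(L has_derivative ?D) (at z)"
      unfolding L_def by (intro has_derivative_minus has_derivative_sum 1)
    moreover have "?D (c *s v) = c * ?D v" for c v
      by (simp add: sum_distrib_left algebra_simps)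
    ultimately show "\<exists>D. (L has_derivative D) (at z) \<and> (\<forall>c v. D (c *s v) = c * D v)"
      by blast
  qed
  moreover have "exp (L z) = szego_kernel z w" if "z \<in> polydisc" for z
    using nz[OF that] by (simp add: L_def szego_kernel_def exp_minus exp_sum
        prod_inversef[unfolded o_def, symmetric])
  moreover have "szego_kernel_powr s z w = exp (of_real s * L z)" if "z \<in> polydisc" for s z
  proof -
    have "of_real s * L z = (\<Sum>l\<in>UNIV. - of_real s * Ln (1 - z $ l * cnj (w $ l)))"
      by (simp add: L_def sum_distrib_left sum_negf)
    then show ?thesis
      using nz[OF that] by (simp add: szego_kernel_powr_def powr_def exp_sum)
  qed
  ultimately show ?thesis by blast
qed

end

theory Submission
  imports Defs "HOL-Complex_Analysis.Complex_Analysis" "HOL-Probability.Probability"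
    "HOL-Real_Asymp.Real_Asymp"
begin

text \<open>One variable: dividing out the zeros and taking the power \<open>p / 2\<close> majorizes
  \<open>\<bar>f\<^sub>j\<bar>\<^sup>p\<close> by \<open>\<bar>G\<^sub>j\<bar>\<^sup>2\<close> for a power series \<open>G\<^sub>j\<close> with the same Hardy norm.
  The Bergman norm of the product of the \<open>G\<^sub>j\<close> is a weighted \<open>l\<^sup>2\<close> norm of its coefficients, whose weights count the terms of the
  Cauchy product, so that Cauchy-Schwarz in each coefficient gives the inequality; equality forces
  all coefficient sequences to be geometric with one ratio, which is the conjugate of the pole.

  Several variables: the Hardy norms of the different functions are integrals over independent torus
  variables, so the inequality is a tensor product of one-dimensional ones and may be applied
  one coordinate at a time. In case of equality almost every slice in a coordinate is an equality
  case, hence a kernel with the same pole for all \<open>j\<close>. The pole depends holomorphically on the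
  remaining coordinates. By the tensor product, slices of the \<open>f\<^sub>j\<close> at independent points, hence kernels
  with possibly different poles, enter the inequality. For those it has a gap, controlled by the
  squared distance of the poles. Subharmonicity keeps the integrated gap away from \<open>0\<close> as the
  radius tends to \<open>1\<close> unless the pole is constant.\<close>

text \<open>Integral inequalities are first proved for dilations, which are holomorphic past the
  closed disc and, unless identically zero, have finitely many zeros in the disc; Fatou and monotone
  convergence along radii tending to \<open>1\<close> do the rest. A limit of inequalities loses the
  equality case, and this shapes the proof: Cauchy-Schwarz is kept as an identity with its defect,
  the equality theorem in one variable assumes only bounds at all radii, and the gap between poles
  must be bounded below independently of the radius.

  Index count: one more Hardy factor raises the binomial index by one, since the sum of
  \<open>(i + s) choose s\<close> over \<open>i \<le> k\<close> is
  \<open>(k + Suc s) choose Suc s\<close>. Hence \<open>m\<close> factors belong to weight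
  \<open>m - 2\<close>.

  The gap involves two factors \<open>j1\<close>, \<open>j2\<close> at independent points. With the
  point of \<open>j1\<close> fixed, the rest is a product of functions that are squared moduli of
  holomorphic functions on slices, so its integral is at least the value at the centre. What is left
  is the mean of \<open>|h - h 0|^2\<close> against a positive weight, where \<open>h\<close> is the
  pole. This mean grows with the radius too, and must vanish.\<close>

unbundle no vec_syntax
unbundle fps_syntax

section \<open>Weighted coefficient norms\<close>

text \<open>\<open>wnorm 0\<close> is the squared Hardy norm, and \<open>wnorm s\<close> the squared norm with respect to
  \<open>bergman_disc (s + 1)\<close>, because \<open>z ^ k\<close> has squared norm \<open>1 / ((k + s) choose s)\<close> there.\<close>

definition wnorm :: "nat \<Rightarrow> complex fps \<Rightarrow> ennreal" where
  "wnorm s A = (\<Sum>k. ennreal ((norm (A $ k))\<^sup>2 / real ((k + s) choose s)))"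

lemma ennreal_prod_less_top:
  fixes f :: "'a \<Rightarrow> ennreal"
  assumes "\<And>i. i \<in> I \<Longrightarrow> f i < \<top>"
  shows "(\<Prod>i\<in>I. f i) < \<top>"
  using assms by (induction I rule: infinite_finite_induct) (auto simp: ennreal_mult_less_top)

lemma le_suminf_ennreal:
  fixes f :: "nat \<Rightarrow> ennreal"
  shows "f k \<le> (\<Sum>k. f k)"
  using sum_le_suminf[of f "{k}"] by simp

lemma weighted_variance:
  fixes u :: "'a \<Rightarrow> complex" and c :: "'a \<Rightarrow> real"
  assumes C: "C = sum c S" "C > 0"
  defines "v \<equiv> (\<Sum>i\<in>S. c i *\<^sub>R u i) /\<^sub>R C"
  shows "(norm (\<Sum>i\<in>S. c i *\<^sub>R u i))\<^sup>2 / C + (\<Sum>i\<in>S. c i * (norm (u i - v))\<^sup>2)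
    = (\<Sum>i\<in>S. c i * (norm (u i))\<^sup>2)"
proof -
  have Cv: "(\<Sum>i\<in>S. c i *\<^sub>R u i) = C *\<^sub>R v"
    using C by (simp add: v_def)
  have *: "(norm (u i - v))\<^sup>2 = (norm (u i))\<^sup>2 - 2 * (u i \<bullet> v) + (norm v)\<^sup>2" for i
    unfolding power2_norm_eq_inner inner_diff_left inner_diff_right inner_commute[of v "u i"] by simp
  have "(\<Sum>i\<in>S. c i * (norm (u i - v))\<^sup>2)
      = (\<Sum>i\<in>S. c i * (norm (u i))\<^sup>2 - 2 * ((c i *\<^sub>R u i) \<bullet> v) + c i * (norm v)\<^sup>2)"
    by (intro sum.cong refl) (simp add: * right_diff_distrib distrib_left)
  also have "\<dots> = (\<Sum>i\<in>S. c i * (norm (u i))\<^sup>2) - 2 * ((\<Sum>i\<in>S. c i *\<^sub>R u i) \<bullet> v) + C * (norm v)\<^sup>2"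
    by (simp add: sum.distrib sum_subtractf C(1) inner_sum_left flip: sum_distrib_left sum_distrib_right)
  also have "\<dots> = (\<Sum>i\<in>S. c i * (norm (u i))\<^sup>2) - C * (norm v)\<^sup>2"
    unfolding Cv by (simp add: power2_norm_eq_inner)
  finally show ?thesis
    using C(2) unfolding Cv by (simp add: power_mult_distrib power2_eq_square)
qed

lemma wnorm_real:
  assumes "wnorm s A < \<top>"
  shows "summable (\<lambda>k. (norm (A $ k))\<^sup>2 / real ((k + s) choose s))"
    and "wnorm s A = ennreal (\<Sum>k. (norm (A $ k))\<^sup>2 / real ((k + s) choose s))"
proof -
  show *: "summable (\<lambda>k. (norm (A $ k))\<^sup>2 / real ((k + s) choose s))"
    using assms unfolding wnorm_def by (intro summable_suminf_not_top) auto
  show "wnorm s A = ennreal (\<Sum>k. (norm (A $ k))\<^sup>2 / real ((k + s) choose s))"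
    unfolding wnorm_def by (intro suminf_ennreal2 * ) auto
qed

text \<open>By the hockey-stick identity the weights \<open>(k - i + s) choose s\<close> add up to
  \<open>(k + Suc s) choose Suc s\<close>, the denominator in \<open>wnorm (Suc s)\<close>. The
  coefficient of \<open>A * B\<close> is the weighted sum of the \<open>u k i\<close>, so
  \<open>weighted_variance\<close> applies in each degree, and the right-hand sides form a Cauchy
  product. \<open>D k\<close> is the variance: its sign gives the inequality, its vanishing the
  equality case, and \<open>D 1\<close> the gap between kernels.\<close>

lemma wnorm_mult_defect:
  fixes A B :: "complex fps" and s :: nat
  assumes fin: "wnorm 0 A < \<top>" "wnorm s B < \<top>"
  defines "u \<equiv> (\<lambda>k i. A $ i * B $ (k - i) / of_nat ((k - i + s) choose s))"
  obtains D :: "nat \<Rightarrow> real" where "\<And>k. D k \<ge> 0"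
    "\<And>k. D k = (\<Sum>i\<le>k. real ((k - i + s) choose s) * (norm (u k i - ((A * B) $ k) / of_nat ((k + Suc s) choose Suc s)))\<^sup>2)"
    "wnorm (Suc s) (A * B) + (\<Sum>k. ennreal (D k)) = wnorm 0 A * wnorm s B"
proof -
  define c where "c l = real ((l + s) choose s)" for l
  have cpos: "c l > 0" for l by (simp add: c_def)
  define C where "C k = real ((k + Suc s) choose Suc s)" for k
  have Cpos: "C k > 0" for k unfolding C_def of_nat_0_less_iff by (rule zero_less_binomial) simp
  have Cge: "C k \<ge> 0" and cge: "c k \<ge> 0" for k
    by (simp_all add: C_def c_def)
  have Csum: "C k = (\<Sum>i\<le>k. c (k - i))" for k
  proof -
    have "(\<Sum>i\<le>k. c (k - i)) = (\<Sum>i\<le>k. c i)"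
      by (rule sum.nat_diff_reindex[of _ "Suc k", simplified lessThan_Suc_atMost, simplified])
    also have "\<dots> = C k"
      using choose_rising_sum(1)[of s k] by (simp add: c_def C_def add.commute flip: of_nat_sum)
    finally show ?thesis by simp
  qed
  define D where "D k = (\<Sum>i\<le>k. c (k - i) * (norm (u k i - ((A * B) $ k) / of_real (C k)))\<^sup>2)" for k
  have D0: "D k \<ge> 0" for k
    unfolding D_def by (intro sum_nonneg mult_nonneg_nonneg) (auto simp: cge)
  define p where "p k = (\<Sum>i\<le>k. (norm (A $ i))\<^sup>2 * ((norm (B $ (k - i)))\<^sup>2 / c (k - i)))" for k
  have u: "c (k - i) *\<^sub>R u k i = A $ i * B $ (k - i)" for k i
    using cpos[of "k - i"] by (simp add: u_def scaleR_conv_of_real c_def)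
  have AB: "(A * B) $ k = (\<Sum>i\<le>k. c (k - i) *\<^sub>R u k i)" for k
    unfolding u by (simp add: fps_mult_nth atMost_atLeast0)
  have key: "(norm ((A * B) $ k))\<^sup>2 / C k + D k = p k" for k
  proof -
    have "(norm (\<Sum>i\<le>k. c (k - i) *\<^sub>R u k i))\<^sup>2 / C k
        + (\<Sum>i\<le>k. c (k - i) * (norm (u k i - (\<Sum>i\<le>k. c (k - i) *\<^sub>R u k i) /\<^sub>R C k))\<^sup>2)
        = (\<Sum>i\<le>k. c (k - i) * (norm (u k i))\<^sup>2)"
      by (rule weighted_variance[OF Csum Cpos])
    then have "(norm ((A * B) $ k))\<^sup>2 / C k + D k = (\<Sum>i\<le>k. c (k - i) * (norm (u k i))\<^sup>2)"
      unfolding AB[symmetric] D_def by (simp add: scaleR_conv_of_real divide_inverse mult.commute)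
    moreover have "c (k - i) * (norm (u k i))\<^sup>2 = (norm (A $ i))\<^sup>2 * ((norm (B $ (k - i)))\<^sup>2 / c (k - i))" for i
      using cpos[of "k - i"]
      by (simp add: u_def norm_mult norm_divide power_mult_distrib power_divide c_def[symmetric] power2_eq_square)
    ultimately show ?thesis
      by (simp add: p_def)
  qed
  have sA: "summable (\<lambda>k. (norm (A $ k))\<^sup>2)" and sB: "summable (\<lambda>k. (norm (B $ k))\<^sup>2 / c k)"
    and wA: "wnorm 0 A = ennreal (\<Sum>k. (norm (A $ k))\<^sup>2)"
    and wB: "wnorm s B = ennreal (\<Sum>k. (norm (B $ k))\<^sup>2 / c k)"
    using wnorm_real[OF fin(1)] wnorm_real[OF fin(2)] by (simp_all add: c_def)
  have psum: "p sums ((\<Sum>k. (norm (A $ k))\<^sup>2) * (\<Sum>k. (norm (B $ k))\<^sup>2 / c k))"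
    unfolding p_def by (intro Cauchy_product_sums) (use sA sB cge in auto)
  have p0: "p k \<ge> 0" for k
    unfolding p_def by (intro sum_nonneg mult_nonneg_nonneg divide_nonneg_pos cpos) auto
  have "(\<Sum>k. ennreal (p k)) = ennreal ((\<Sum>k. (norm (A $ k))\<^sup>2) * (\<Sum>k. (norm (B $ k))\<^sup>2 / c k))"
    by (subst suminf_ennreal2[OF p0 sums_summable[OF psum]]) (simp add: sums_unique[OF psum])
  also have "\<dots> = wnorm 0 A * wnorm s B"
    unfolding wA wB by (intro ennreal_mult suminf_nonneg sA sB divide_nonneg_pos cpos) auto
  finally have "wnorm 0 A * wnorm s B = (\<Sum>k. ennreal ((norm ((A * B) $ k))\<^sup>2 / C k) + ennreal (D k))"
    using D0 Cge by (simp add: key[symmetric])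
  also have "\<dots> = wnorm (Suc s) (A * B) + (\<Sum>k. ennreal (D k))"
    unfolding wnorm_def C_def[symmetric] by (intro suminf_add[symmetric]) auto
  finally have tot: "wnorm (Suc s) (A * B) + (\<Sum>k. ennreal (D k)) = wnorm 0 A * wnorm s B"
    by (rule sym)
  show ?thesis
  proof (rule that[of D])
    show "D k \<ge> 0" for k by (rule D0)
    show "D k = (\<Sum>i\<le>k. real ((k - i + s) choose s) * (norm (u k i - ((A * B) $ k) / of_nat ((k + Suc s) choose Suc s)))\<^sup>2)" for k
      unfolding D_def c_def C_def of_real_of_nat_eq by (rule refl)
  qed (rule tot)
qed

lemma wnorm_mult_le:
  assumes "wnorm 0 A < \<top>" "wnorm s B < \<top>"
  shows "wnorm (Suc s) (A * B) \<le> wnorm 0 A * wnorm s B"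
proof -
  obtain D where "wnorm (Suc s) (A * B) + (\<Sum>k. ennreal (D k)) = wnorm 0 A * wnorm s B"
    by (rule wnorm_mult_defect[OF assms])
  note tot = this
  have "wnorm (Suc s) (A * B) \<le> wnorm (Suc s) (A * B) + (\<Sum>k. ennreal (D k))"
    by (rule add_increasing2) simp_all
  also note tot
  finally show ?thesis .
qed

lemma wnorm_prod_le:
  assumes "finite J" "card J = Suc s" "\<And>j. j \<in> J \<Longrightarrow> wnorm 0 (A j) < \<top>"
  shows "wnorm s (\<Prod>j\<in>J. A j) \<le> (\<Prod>j\<in>J. wnorm 0 (A j))"
  using assms
proof (induction s arbitrary: J)
  case 0
  then obtain j where "J = {j}" by (metis One_nat_def card_1_singletonE)
  then show ?case by simp
next
  case (Suc s)
  then obtain j J' where J: "J = insert j J'" "j \<notin> J'" "card J' = Suc s" "finite J'"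
    by (metis card_Suc_eq finite_insert)
  have IH: "wnorm s (prod A J') \<le> (\<Prod>j\<in>J'. wnorm 0 (A j))"
    using Suc J by auto
  also have "\<dots> < \<top>"
    using Suc.prems(3) J(1) by (intro ennreal_prod_less_top) blast
  finally have "wnorm (Suc s) (A j * prod A J') \<le> wnorm 0 (A j) * wnorm s (prod A J')"
    using Suc.prems(3) J by (intro wnorm_mult_le) auto
  also have "\<dots> \<le> wnorm 0 (A j) * (\<Prod>j\<in>J'. wnorm 0 (A j))"
    by (intro mult_left_mono IH) auto
  finally show ?case using J by simp
qed

lemma wnorm_ge_0:
  "ennreal ((norm (A $ 0))\<^sup>2) \<le> wnorm 0 A"
proof -
  have "ennreal ((norm (A $ 0))\<^sup>2) = ennreal ((norm (A $ 0))\<^sup>2 / real ((0 + 0) choose 0))"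
    by simp
  also have "\<dots> \<le> wnorm 0 A"
    unfolding wnorm_def by (rule le_suminf_ennreal)
  finally show ?thesis .
qed

text \<open>In degree \<open>1\<close> with \<open>s = 0\<close> the defect is the variance of two
  numbers of weight \<open>1\<close>, half their squared distance. For two geometric series it
  compares the ratios.\<close>

lemma wnorm_mult_defect1:
  assumes "wnorm 0 A < \<top>" "wnorm 0 B < \<top>"
  shows "wnorm 1 (A * B) + ennreal ((norm (A $ 1 * B $ 0 - A $ 0 * B $ 1))\<^sup>2 / 2) \<le> wnorm 0 A * wnorm 0 B"
proof -
  obtain D where D: "\<And>k. D k \<ge> 0"
    "\<And>k. D k = (\<Sum>i\<le>k. real ((k - i + 0) choose 0) * (norm (A $ i * B $ (k - i) / of_nat ((k - i + 0) choose 0)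
         - ((A * B) $ k) / of_nat ((k + Suc 0) choose Suc 0)))\<^sup>2)"
    "wnorm (Suc 0) (A * B) + (\<Sum>k. ennreal (D k)) = wnorm 0 A * wnorm 0 B"
    by (rule wnorm_mult_defect[OF assms]) blast
  have "D 1 = (norm (A $ 1 * B $ 0 - A $ 0 * B $ 1))\<^sup>2 / 2"
  proof -
    define x where "x = A $ 0 * B $ 1"
    define y where "y = A $ 1 * B $ 0"
    have "D 1 = (norm (x - (x + y) / 2))\<^sup>2 + (norm (y - (x + y) / 2))\<^sup>2"
      by (simp add: D(2) fps_mult_nth_1 x_def y_def)
    moreover have "x - (x + y) / 2 = (x - y) / 2" "y - (x + y) / 2 = (y - x) / 2"
      by (simp_all add: field_simps)
    ultimately have "D 1 = (norm ((x - y) / 2))\<^sup>2 + (norm ((y - x) / 2))\<^sup>2" by simp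
    also have "\<dots> = (norm (y - x))\<^sup>2 / 2"
      by (simp add: norm_divide power_divide norm_minus_commute[of x y])
    finally show ?thesis by (simp add: x_def y_def)
  qed
  moreover have "ennreal (D 1) \<le> (\<Sum>k. ennreal (D k))"
    by (rule le_suminf_ennreal)
  ultimately have "ennreal ((norm (A $ 1 * B $ 0 - A $ 0 * B $ 1))\<^sup>2 / 2) \<le> (\<Sum>k. ennreal (D k))"
    by (simp only:)
  then show ?thesis
    unfolding D(3)[folded One_nat_def, symmetric] by (rule add_left_mono)
qed

text \<open>Equality kills every \<open>D k\<close>, so
  \<open>A $ i * B $ (k - i) / c (k - i)\<close> does not depend on \<open>i \<le> k\<close>. Only
  neighbouring \<open>i\<close> are compared, in degree \<open>Suc i\<close>, so just two
  coefficients of \<open>B\<close> enter; the factor \<open>Suc s\<close> in \<open>q\<close> is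
  \<open>c 1\<close>.\<close>

lemma wnorm_mult_eq_imp_geometric:
  assumes fin: "wnorm 0 A < \<top>" "wnorm s B < \<top>"
    and eq: "wnorm (Suc s) (A * B) = wnorm 0 A * wnorm s B"
    and nz: "A $ 0 \<noteq> 0" "B $ 0 \<noteq> 0"
  defines "q \<equiv> B $ 1 / (of_nat (Suc s) * B $ 0)"
  shows "A $ k = A $ 0 * q ^ k"
proof -
  define c where "c l = (of_nat ((l + s) choose s) :: complex)" for l
  obtain D where D: "\<And>k. D k \<ge> 0"
    "\<And>k. D k = (\<Sum>i\<le>k. real ((k - i + s) choose s) * (norm (A $ i * B $ (k - i) / of_nat ((k - i + s) choose s)
         - ((A * B) $ k) / of_nat ((k + Suc s) choose Suc s)))\<^sup>2)"
    "wnorm (Suc s) (A * B) + (\<Sum>k. ennreal (D k)) = wnorm 0 A * wnorm s B"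
    by (rule wnorm_mult_defect[OF fin]) blast
  have "wnorm 0 A * wnorm s B < \<top>"
    using fin by (simp add: ennreal_mult_less_top)
  then have "(\<Sum>k. ennreal (D k)) = 0"
    using D(3) eq by (metis add.right_neutral ennreal_add_left_cancel less_irrefl infinity_ennreal_def)
  then have "ennreal (D k) = 0" for k
    using le_suminf_ennreal[of "\<lambda>k. ennreal (D k)" k] by simp
  then have D0: "D k = 0" for k
    using D(1)[of k] by (metis ennreal_eq_0_iff order_antisym)
  have E: "A $ i * B $ (k - i) / c (k - i) = ((A * B) $ k) / of_nat ((k + Suc s) choose Suc s)" if "i \<le> k" for i k
  proof -
    have "real ((k - i + s) choose s) * (norm (A $ i * B $ (k - i) / of_nat ((k - i + s) choose s)
         - ((A * B) $ k) / of_nat ((k + Suc s) choose Suc s)))\<^sup>2 = 0"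
      using D0[of k] that unfolding D(2) by (subst (asm) sum_nonneg_eq_0_iff) auto
    then show ?thesis by (simp add: c_def)
  qed
  have step: "A $ Suc i = A $ i * q" for i
  proof -
    have "A $ Suc i * B $ 0 / c 0 = A $ i * B $ 1 / c 1"
      using E[of "Suc i" "Suc i"] E[of i "Suc i"] by (simp add: Suc_diff_le)
    moreover have "c 0 = 1" "c 1 = of_nat (Suc s)" by (simp_all add: c_def)
    ultimately show ?thesis
      using nz by (simp add: q_def field_simps del: of_nat_Suc)
  qed
  show ?thesis
    by (induction k) (simp_all add: step)
qed

text \<open>Each factor is geometric with ratio \<open>q j\<close>, and peeling off the factor \<open>j\<close> first shows that
  \<open>q j\<close> is the mean of the other ratios.\<close>

lemma wnorm_prod_eq_imp_geometric:
  assumes J: "finite J" "card J = Suc s" "s \<ge> 1"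
    and fin: "\<And>j. j \<in> J \<Longrightarrow> wnorm 0 (A j) < \<top>"
    and nz: "\<And>j. j \<in> J \<Longrightarrow> A j $ 0 \<noteq> 0"
    and eq: "(\<Prod>j\<in>J. wnorm 0 (A j)) \<le> wnorm s (\<Prod>j\<in>J. A j)"
  obtains q where "\<And>j k. j \<in> J \<Longrightarrow> A j $ k = A j $ 0 * q ^ k"
proof -
  define r where "r j = A j $ 1 / A j $ 0" for j
  \<comment> \<open>The ratio of coefficient \<open>1\<close> to coefficient \<open>0\<close> is a
    logarithmic derivative at \<open>0\<close>, hence additive over products.\<close>
  have prod1: "prod A S $ 0 = (\<Prod>j\<in>S. A j $ 0) \<and> prod A S $ 1 = (\<Prod>j\<in>S. A j $ 0) * (\<Sum>j\<in>S. r j)"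
    if "finite S" "S \<subseteq> J" for S
    using that
  proof (induction S rule: finite_induct)
    case (insert x F)
    then show ?case
      using nz[of x] by (simp add: fps_mult_nth_1 r_def field_simps)
  qed simp
  have *: "\<exists>q. (\<forall>k. A j $ k = A j $ 0 * q ^ k) \<and> of_nat s * q = (\<Sum>i\<in>J - {j}. r i)" if j: "j \<in> J" for j
  proof -
    define J' where "J' = J - {j}"
    have J': "finite J'" "j \<notin> J'" "J = insert j J'" "card J' = s" "J' \<subseteq> J"
      using J j by (auto simp: J'_def)
    obtain t where t: "s = Suc t" using J(3) by (cases s) auto
    have le: "wnorm t (prod A J') \<le> (\<Prod>i\<in>J'. wnorm 0 (A i))"
      using J' t fin by (intro wnorm_prod_le) auto
    have "(\<Prod>i\<in>J'. wnorm 0 (A i)) < \<top>"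
      using J' fin by (intro ennreal_prod_less_top) blast
    then have fin': "wnorm t (prod A J') < \<top>" using le by (rule le_less_trans[rotated])
    have "wnorm 0 (A j) * wnorm t (prod A J') \<le> wnorm 0 (A j) * (\<Prod>i\<in>J'. wnorm 0 (A i))"
      by (intro mult_left_mono le) auto
    also have "\<dots> \<le> wnorm (Suc t) (A j * prod A J')"
      using eq J' t by simp
    finally have "wnorm (Suc t) (A j * prod A J') = wnorm 0 (A j) * wnorm t (prod A J')"
      using wnorm_mult_le[OF fin[OF j] fin'] by (rule antisym[rotated])
    moreover have "prod A J' $ 0 \<noteq> 0"
      using prod1[OF J'(1,5)] nz J' by auto
    ultimately have "A j $ k = A j $ 0 * (prod A J' $ 1 / (of_nat (Suc t) * prod A J' $ 0)) ^ k" for k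
      by (intro wnorm_mult_eq_imp_geometric fin fin' j nz)
    moreover have "of_nat s * (prod A J' $ 1 / (of_nat (Suc t) * prod A J' $ 0)) = (\<Sum>i\<in>J'. r i)"
      using prod1[OF J'(1,5)] nz J' t \<open>prod A J' $ 0 \<noteq> 0\<close> by (simp add: field_simps del: of_nat_Suc)
    ultimately show ?thesis unfolding J'_def by blast
  qed
  then obtain q where q: "\<And>j k. j \<in> J \<Longrightarrow> A j $ k = A j $ 0 * q j ^ k"
    "\<And>j. j \<in> J \<Longrightarrow> of_nat s * q j = (\<Sum>i\<in>J - {j}. r i)"
    by metis
  have rq: "r j = q j" if "j \<in> J" for j
    using q(1)[OF that, of 1] nz[OF that] by (simp add: r_def)
  \<comment> \<open>Adding \<open>q j = r j\<close> to the mean relation completes the right-hand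
    side to the full sum, which is the same for all \<open>j\<close>.\<close>
  have "of_nat (Suc s) * q j = (\<Sum>i\<in>J. r i)" if "j \<in> J" for j
    using q(2)[OF that] rq[OF that] J that by (simp add: sum.remove[of J j] algebra_simps)
  then have "q j = (\<Sum>i\<in>J. r i) / of_nat (Suc s)" if "j \<in> J" for j
    using that by (metis nonzero_mult_div_cancel_left of_nat_neq_0)
  then show ?thesis using q(1) that by metis
qed

section \<open>Integration on the circle and the disc\<close>

lemma prob_space_circle_haar: "prob_space circle_haar"
  and sets_circle_haar [measurable_cong, simp]: "sets circle_haar = sets borel"
  and space_circle_haar [simp]: "space circle_haar = UNIV"
proof -
  have [measurable]: "cis \<in> borel_measurable borel"
    by (intro borel_measurable_continuous_onI continuous_intros)
  have "prob_space (uniform_measure lborel {0..<2 * pi})"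
    by (intro prob_space_uniform_measure) auto
  then show "prob_space circle_haar"
    unfolding circle_haar_def by (intro prob_space.prob_space_distr) auto
qed (simp_all add: circle_haar_def)

lemma borel_measurable_circle_haar [simp]:
  "f \<in> borel_measurable circle_haar \<longleftrightarrow> f \<in> borel_measurable borel"
  using measurable_cong_sets[OF sets_circle_haar refl] by blast

lemma integral_circle_haar:
  fixes f :: "complex \<Rightarrow> complex"
  assumes "continuous_on UNIV f"
  shows "(LINT \<zeta>|circle_haar. f \<zeta>) = integral {0..2*pi} (\<lambda>t. f (cis t)) / (2*pi)"
proof -
  have [measurable]: "cis \<in> borel_measurable borel" "f \<in> borel_measurable borel"
    by (auto intro!: borel_measurable_continuous_onI continuous_intros assms)
  have c: "continuous_on {0..2*pi} (\<lambda>t. f (cis t))"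
    by (intro continuous_on_compose2[OF assms] continuous_intros) auto
  have "(LINT \<zeta>|circle_haar. f \<zeta>) = (LINT t|uniform_measure lborel {0..<2*pi}. f (cis t))"
    unfolding circle_haar_def by (subst integral_distr) auto
  also have "\<dots> = (LINT t|density lborel (\<lambda>t. ennreal (indicator {0..<2*pi} t / (2*pi))). f (cis t))"
    unfolding uniform_measure_def
    by (rule arg_cong[where f = "\<lambda>M. integral\<^sup>L M _"], rule density_cong)
       (auto simp: ennreal_indicator divide_ennreal[symmetric] split: split_indicator)
  also have "\<dots> = (LINT t|lborel. (indicator {0..<2*pi} t / (2*pi)) *\<^sub>R f (cis t))"
    by (subst integral_density) auto
  also have "\<dots> = (LINT t|lborel. (1/(2*pi)) *\<^sub>R (indicator {0..2*pi} t *\<^sub>R f (cis t)))"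
  proof (rule integral_cong_AE)
    have "AE t in lborel. t \<noteq> 2*pi" by (rule AE_lborel_singleton)
    then show "AE t in lborel. (indicator {0..<2*pi} t / (2*pi)) *\<^sub>R f (cis t)
        = (1/(2*pi)) *\<^sub>R (indicator {0..2*pi} t *\<^sub>R f (cis t))"
      by eventually_elim (auto split: split_indicator)
  qed auto
  also have "\<dots> = (1/(2*pi)) *\<^sub>R (LINT t:{0..2*pi}|lborel. f (cis t))"
    unfolding set_lebesgue_integral_def by (rule integral_scaleR_right)
  also have "(LINT t:{0..2*pi}|lborel. f (cis t)) = integral {0..2*pi} (\<lambda>t. f (cis t))"
    by (intro set_borel_integral_eq_integral(2) borel_integrable_atLeastAtMost' c)
  finally show ?thesis by (simp add: scaleR_conv_of_real)
qed

lemma AE_circle_haar: "AE \<zeta> in circle_haar. norm \<zeta> = 1"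
proof -
  have [measurable]: "cis \<in> borel_measurable borel"
    by (intro borel_measurable_continuous_onI continuous_intros)
  show ?thesis unfolding circle_haar_def by (subst AE_distr_iff) auto
qed

lemma integral_circle_haar_power:
  "(LINT \<zeta>|circle_haar. \<zeta> ^ k * cnj \<zeta> ^ l) = (if k = l then 1 else 0)"
proof -
  have "(LINT \<zeta>|circle_haar. \<zeta> ^ k * cnj \<zeta> ^ l) = integral {0..2*pi} (\<lambda>t. cis t ^ k * cnj (cis t) ^ l) / (2*pi)"
    by (intro integral_circle_haar continuous_intros)
  also have "(\<lambda>t. cis t ^ k * cnj (cis t) ^ l) = (\<lambda>t. cis ((real k - real l) * t))"
    unfolding cis_cnj Complex.DeMoivre cis_mult by (simp add: algebra_simps)
  also have "integral {0..2*pi} \<dots> = (if k = l then 2*pi else 0)"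
  proof (cases "k = l")
    case False
    define n where "n = real k - real l"
    have n: "n \<noteq> 0" using False by (simp add: n_def)
    have "((\<lambda>t. cis (n * t)) has_integral (cis (n * (2*pi)) / (\<i> * n) - cis (n * 0) / (\<i> * n))) {0..2*pi}"
    proof (rule fundamental_theorem_of_calculus)
      fix x
      have "((\<lambda>z. exp (\<i> * (complex_of_real n * z)) / (\<i> * complex_of_real n)) has_field_derivative
          exp (\<i> * (complex_of_real n * complex_of_real x))) (at (complex_of_real x))"
        using n by (auto intro!: derivative_eq_intros simp: mult_ac)
      from has_vector_derivative_real_field[OF this, of "{0..2*pi}"]
      show "((\<lambda>t. cis (n * t) / (\<i> * n)) has_vector_derivative cis (n * x)) (at x within {0..2*pi})"
        by (simp add: cis_conv_exp)
    qed auto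
    moreover have "cis (n * (2*pi)) = 1"
    proof -
      have "n = of_int (int k - int l)" by (simp add: n_def)
      then show ?thesis using cis_multiple_2pi[of n] by (metis Ints_of_int mult.commute)
    qed
    ultimately show ?thesis using False n by (auto simp: n_def[symmetric] intro: integral_unique)
  qed (auto simp: scaleR_conv_of_real)
  finally show ?thesis by simp
qed

lemma parseval_finite:
  fixes b :: "nat \<Rightarrow> complex"
  shows "(\<integral>\<^sup>+\<zeta>. ennreal ((norm (\<Sum>k<N. b k * \<zeta> ^ k))\<^sup>2) \<partial>circle_haar) = ennreal (\<Sum>k<N. (norm (b k))\<^sup>2)"
proof -
  interpret prob_space circle_haar by (rule prob_space_circle_haar)
  have int: "integrable circle_haar (\<lambda>\<zeta>. \<zeta> ^ k * cnj \<zeta> ^ l)" for k l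
    by (rule integrable_const_bound[of _ 1])
       (use AE_circle_haar in \<open>auto elim!: eventually_mono simp: norm_mult norm_power simp del: borel_measurable_times intro!: borel_measurable_continuous_onI continuous_intros\<close>)
  have eq: "complex_of_real ((norm (\<Sum>k<N. b k * \<zeta> ^ k))\<^sup>2) = (\<Sum>k<N. \<Sum>l<N. b k * cnj (b l) * (\<zeta> ^ k * cnj \<zeta> ^ l))" for \<zeta>
    unfolding complex_norm_square by (simp add: sum_product mult_ac)
  have int2: "integrable circle_haar (\<lambda>\<zeta>. complex_of_real ((norm (\<Sum>k<N. b k * \<zeta> ^ k))\<^sup>2))"
    unfolding eq by (intro Bochner_Integration.integrable_sum integrable_mult_right int)
  have "complex_of_real (LINT \<zeta>|circle_haar. (norm (\<Sum>k<N. b k * \<zeta> ^ k))\<^sup>2) = (LINT \<zeta>|circle_haar. complex_of_real ((norm (\<Sum>k<N. b k * \<zeta> ^ k))\<^sup>2))"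
    by (rule integral_complex_of_real[symmetric])
  also have "\<dots> = (\<Sum>k<N. \<Sum>l<N. b k * cnj (b l) * (if k = l then 1 else 0))"
    unfolding eq by (simp add: Bochner_Integration.integral_sum int integral_circle_haar_power)
  also have "\<dots> = (\<Sum>k<N. b k * cnj (b k))"
    by (intro sum.cong refl) (simp add: if_distrib cong: if_cong)
  also have "\<dots> = complex_of_real (\<Sum>k<N. (norm (b k))\<^sup>2)"
    by (simp only: of_real_sum complex_norm_square)
  finally have "(LINT \<zeta>|circle_haar. (norm (\<Sum>k<N. b k * \<zeta> ^ k))\<^sup>2) = (\<Sum>k<N. (norm (b k))\<^sup>2)"
    by (simp only: of_real_eq_iff)
  moreover have "integrable circle_haar (\<lambda>\<zeta>. (norm (\<Sum>k<N. b k * \<zeta> ^ k))\<^sup>2)"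
    using int2 by (simp only: complex_of_real_integrable_eq)
  ultimately show ?thesis
    by (subst nn_integral_eq_integral) auto
qed

text \<open>Absolute summability dominates all partial sums on the circle by one constant, so the
  finite case passes to the limit.\<close>

lemma parseval:
  fixes b :: "nat \<Rightarrow> complex"
  assumes b: "summable (\<lambda>k. norm (b k))"
  shows "(\<integral>\<^sup>+\<zeta>. ennreal ((norm (\<Sum>k. b k * \<zeta> ^ k))\<^sup>2) \<partial>circle_haar) = (\<Sum>k. ennreal ((norm (b k))\<^sup>2))"
proof -
  interpret prob_space circle_haar by (rule prob_space_circle_haar)
  define B where "B = (\<Sum>k. norm (b k))"
  have bound: "norm (\<Sum>k<N. b k * \<zeta> ^ k) \<le> B" if "norm \<zeta> = 1" for \<zeta> N
  proof -
    have "norm (\<Sum>k<N. b k * \<zeta> ^ k) \<le> (\<Sum>k<N. norm (b k))"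
      using that by (intro sum_norm_le) (simp add: norm_mult norm_power)
    also have "\<dots> \<le> B" unfolding B_def by (intro sum_le_suminf b) auto
    finally show ?thesis .
  qed
  have lim: "(\<lambda>N. \<Sum>k<N. b k * \<zeta> ^ k) \<longlonglongrightarrow> (\<Sum>k. b k * \<zeta> ^ k)" if "norm \<zeta> = 1" for \<zeta>
    by (rule summable_LIMSEQ, rule summable_norm_cancel) (use that b in \<open>simp add: norm_mult norm_power\<close>)
  have "(\<lambda>N. \<integral>\<^sup>+\<zeta>. ennreal ((norm (\<Sum>k<N. b k * \<zeta> ^ k))\<^sup>2) \<partial>circle_haar)
      \<longlonglongrightarrow> (\<integral>\<^sup>+\<zeta>. ennreal ((norm (\<Sum>k. b k * \<zeta> ^ k))\<^sup>2) \<partial>circle_haar)"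
  proof (rule nn_integral_dominated_convergence[where w = "\<lambda>_. ennreal (B\<^sup>2)"])
    show "AE \<zeta> in circle_haar. ennreal ((norm (\<Sum>k<N. b k * \<zeta> ^ k))\<^sup>2) \<le> ennreal (B\<^sup>2)" for N
      using AE_circle_haar by eventually_elim (intro ennreal_leI power_mono bound norm_ge_zero)
    show "AE \<zeta> in circle_haar. (\<lambda>N. ennreal ((norm (\<Sum>k<N. b k * \<zeta> ^ k))\<^sup>2)) \<longlonglongrightarrow> ennreal ((norm (\<Sum>k. b k * \<zeta> ^ k))\<^sup>2)"
      using AE_circle_haar by eventually_elim (intro tendsto_intros lim)
    show "(\<integral>\<^sup>+\<zeta>. ennreal (B\<^sup>2) \<partial>circle_haar) < \<infinity>"
      by (simp add: emeasure_space_1[simplified])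
  qed (auto intro!: borel_measurable_suminf)
  moreover have "(\<lambda>N. \<integral>\<^sup>+\<zeta>. ennreal ((norm (\<Sum>k<N. b k * \<zeta> ^ k))\<^sup>2) \<partial>circle_haar)
      \<longlonglongrightarrow> (\<Sum>k. ennreal ((norm (b k))\<^sup>2))"
    unfolding parseval_finite by (simp add: summable_LIMSEQ flip: sum_ennreal)
  ultimately show ?thesis by (rule LIMSEQ_unique)
qed

lemma parseval_fps:
  assumes A: "fps_conv_radius A \<ge> 1" and z: "norm z < 1"
  shows "(\<integral>\<^sup>+\<zeta>. ennreal ((norm (eval_fps A (z * \<zeta>)))\<^sup>2) \<partial>circle_haar)
    = (\<Sum>k. ennreal ((norm (A $ k))\<^sup>2 * norm z ^ (2 * k)))"
proof -
  have "summable (\<lambda>k. norm (A $ k * z ^ k))"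
  proof (rule abs_summable_in_conv_radius)
    show "ereal (norm z) < conv_radius (fps_nth A)"
      using z A less_le_trans[of "ereal (norm z)" 1] by (simp add: fps_conv_radius_def)
  qed
  from parseval[OF this] show ?thesis
    by (simp add: eval_fps_def norm_mult norm_power power_mult_distrib mult.assoc power_even_eq)
qed

section \<open>Rotation invariance of area measure\<close>

lemma borel_measurable_Complex [measurable]:
  assumes [measurable]: "f \<in> borel_measurable M" "g \<in> borel_measurable M"
  shows "(\<lambda>x. Complex (f x) (g x)) \<in> borel_measurable M"
  unfolding Complex_eq by measurable

lemma lborel_complex:
  "(lborel :: complex measure) = distr (lborel \<Otimes>\<^sub>M lborel) borel (\<lambda>(x, y). Complex x y)"
proof (rule lborel_eqI)
  have [measurable]: "(\<lambda>(x, y). Complex x y) \<in> borel_measurable (lborel \<Otimes>\<^sub>M lborel)"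
    unfolding split_beta' by measurable
  fix l u :: complex
  assume le: "\<And>b. b \<in> Basis \<Longrightarrow> l \<bullet> b \<le> u \<bullet> b"
  have le': "Re l \<le> Re u" "Im l \<le> Im u"
    using le[of 1] le[of \<i>] by (auto simp: Basis_complex_def inner_complex_def)
  have "(\<lambda>(x, y). Complex x y) -` box l u \<inter> space (lborel \<Otimes>\<^sub>M lborel) = {Re l<..<Re u} \<times> {Im l<..<Im u}"
    by (auto simp: box_def Basis_complex_def space_pair_measure)
  then have "emeasure (distr (lborel \<Otimes>\<^sub>M lborel) borel (\<lambda>(x, y). Complex x y)) (box l u)
      = emeasure (lborel \<Otimes>\<^sub>M lborel) ({Re l<..<Re u} \<times> {Im l<..<Im u})"
    by (subst emeasure_distr) auto
  also have "\<dots> = ennreal (Re u - Re l) * ennreal (Im u - Im l)"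
    using le' by (subst lborel.emeasure_pair_measure_Times) auto
  also have "\<dots> = (\<Prod>b\<in>Basis. (u - l) \<bullet> b)"
    using le' by (simp add: Basis_complex_def inner_complex_def ennreal_mult[symmetric])
  finally show "emeasure (distr (lborel \<Otimes>\<^sub>M lborel) borel (\<lambda>(x, y). Complex x y)) (box l u)
      = (\<Prod>b\<in>Basis. (u - l) \<bullet> b)" .
qed simp

lemma nn_integral_lborel_complex:
  assumes [measurable]: "f \<in> borel_measurable borel"
  shows "(\<integral>\<^sup>+z. f z \<partial>(lborel :: complex measure)) = (\<integral>\<^sup>+y. \<integral>\<^sup>+x. f (Complex x y) \<partial>lborel \<partial>lborel)"
    and "(\<integral>\<^sup>+z. f z \<partial>(lborel :: complex measure)) = (\<integral>\<^sup>+x. \<integral>\<^sup>+y. f (Complex x y) \<partial>lborel \<partial>lborel)"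
proof -
  have [measurable]: "(\<lambda>(x, y). Complex x y) \<in> borel_measurable (lborel \<Otimes>\<^sub>M lborel)"
    unfolding split_beta' by measurable
  have [measurable]: "case_prod (\<lambda>x y. f (Complex x y)) \<in> borel_measurable (lborel \<Otimes>\<^sub>M lborel)"
    using measurable_compose[OF \<open>(\<lambda>(x, y). Complex x y) \<in> borel_measurable (lborel \<Otimes>\<^sub>M lborel)\<close> assms]
    by (simp add: split_beta')
  have eq: "(\<integral>\<^sup>+z. f z \<partial>(lborel :: complex measure)) = (\<integral>\<^sup>+(x, y). f (Complex x y) \<partial>(lborel \<Otimes>\<^sub>M lborel))"
    by (subst lborel_complex, subst nn_integral_distr) (auto simp: split_beta')
  show "(\<integral>\<^sup>+z. f z \<partial>(lborel :: complex measure)) = (\<integral>\<^sup>+y. \<integral>\<^sup>+x. f (Complex x y) \<partial>lborel \<partial>lborel)"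
    unfolding eq by (subst lborel_pair.nn_integral_snd[symmetric]) auto
  show "(\<integral>\<^sup>+z. f z \<partial>(lborel :: complex measure)) = (\<integral>\<^sup>+x. \<integral>\<^sup>+y. f (Complex x y) \<partial>lborel \<partial>lborel)"
    unfolding eq by (subst lborel.nn_integral_fst[symmetric]) auto
qed

text \<open>On each line in the direction of the shear the map is a translation, by an amount that
  depends only on the line; Fubini does the rest.\<close>

lemma nn_integral_shear:
  assumes [measurable]: "f \<in> borel_measurable borel"
  shows "(\<integral>\<^sup>+z. f (Complex (Re z + a * Im z) (Im z)) \<partial>lborel) = (\<integral>\<^sup>+z. f z \<partial>lborel)"
    and "(\<integral>\<^sup>+z. f (Complex (Re z) (Im z + a * Re z)) \<partial>lborel) = (\<integral>\<^sup>+z. f z \<partial>lborel)"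
proof -
  have trans: "(\<integral>\<^sup>+x. g (x + t) \<partial>lborel) = (\<integral>\<^sup>+x. g x \<partial>lborel)"
    if [measurable]: "g \<in> borel_measurable borel" for g :: "real \<Rightarrow> ennreal" and t
    by (subst nn_integral_real_affine[of g 1 t]) (auto simp: add.commute)
  show "(\<integral>\<^sup>+z. f (Complex (Re z + a * Im z) (Im z)) \<partial>lborel) = (\<integral>\<^sup>+z. f z \<partial>lborel)"
    using trans[of "\<lambda>x. f (Complex x _)"] by (simp add: nn_integral_lborel_complex(1))
  show "(\<integral>\<^sup>+z. f (Complex (Re z) (Im z + a * Re z)) \<partial>lborel) = (\<integral>\<^sup>+z. f z \<partial>lborel)"
    using trans[of "\<lambda>y. f (Complex _ y)"] by (simp add: nn_integral_lborel_complex(2))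
qed

text \<open>A rotation with \<open>Im w \<noteq> 0\<close> is a product of three shears, and \<open>\<plusminus>1\<close> are
  products of two such rotations.\<close>

lemma nn_integral_rotate:
  fixes f :: "complex \<Rightarrow> ennreal"
  assumes [measurable]: "f \<in> borel_measurable borel" and w: "norm w = 1"
  shows "(\<integral>\<^sup>+z. f (w * z) \<partial>lborel) = (\<integral>\<^sup>+z. f z \<partial>lborel)"
proof -
  have *: "(\<integral>\<^sup>+z. f (w * z) \<partial>lborel) = (\<integral>\<^sup>+z. f z \<partial>lborel)"
    if [measurable]: "f \<in> borel_measurable borel" and w: "norm w = 1" "Im w \<noteq> 0"
    for f :: "complex \<Rightarrow> ennreal" and w
  proof -
    \<comment> \<open>For \<open>w = cis t\<close> this is \<open>- tan (t / 2)\<close>, the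
      parameter of the two outer shears; the middle one has parameter \<open>sin t\<close>.\<close>
    define a where "a = (Re w - 1) / Im w"
    define S where "S a z = Complex (Re z + a * Im z) (Im z)" for a z
    define T where "T a z = Complex (Re z) (Im z + a * Re z)" for a z
    have [measurable]: "S a \<in> borel_measurable borel" "T a \<in> borel_measurable borel" for a
      unfolding S_def T_def by measurable
    have c: "(Re w)\<^sup>2 + (Im w)\<^sup>2 = 1" using w by (simp add: norm_complex_def)
    have 1: "1 + a * Im w = Re w" using w by (simp add: a_def)
    have 2: "a + a * Re w = - Im w"
    proof -
      have "(a + a * Re w) * Im w = (a * Im w) * (1 + Re w)"
        by (simp add: algebra_simps)
      also have "a * Im w = Re w - 1" using w by (simp add: a_def)
      also have "(Re w - 1) * (1 + Re w) = - Im w * Im w" using c by (simp add: algebra_simps power2_eq_square)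
      finally show ?thesis using mult_right_cancel[OF w(2)] by blast
    qed
    have "S a (T (Im w) (S a z)) = w * z" for z
    proof (rule complex_eqI)
      show "Im (S a (T (Im w) (S a z))) = Im (w * z)"
        using arg_cong[OF 1, of "\<lambda>x. x * Im z"] by (simp add: S_def T_def algebra_simps)
      have "Re (S a (T (Im w) (S a z))) = (1 + a * Im w) * Re z + (a + a * (1 + a * Im w)) * Im z"
        by (simp add: S_def T_def algebra_simps)
      then show "Re (S a (T (Im w) (S a z))) = Re (w * z)"
        unfolding 1 2 by simp
    qed
    then have "(\<integral>\<^sup>+z. f (w * z) \<partial>lborel) = (\<integral>\<^sup>+z. f (S a (T (Im w) (S a z))) \<partial>lborel)"
      by simp
    also have "\<dots> = (\<integral>\<^sup>+z. f (S a (T (Im w) z)) \<partial>lborel)"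
      using nn_integral_shear(1)[of "\<lambda>z. f (S a (T (Im w) z))" a] by (simp add: S_def[of a, symmetric])
    also have "\<dots> = (\<integral>\<^sup>+z. f (S a z) \<partial>lborel)"
      using nn_integral_shear(2)[of "\<lambda>z. f (S a z)" "Im w"] by (simp add: T_def[of "Im w", symmetric])
    also have "\<dots> = (\<integral>\<^sup>+z. f z \<partial>lborel)"
      unfolding S_def by (rule nn_integral_shear(1)) simp
    finally show ?thesis .
  qed
  show ?thesis
  proof (cases "Im w = 0")
    case True
    have nw: "Im (w * \<i>) \<noteq> 0" using True w by (auto simp: norm_complex_def)
    have "(w * \<i>) * (- \<i> * z) = w * z" for z by (simp add: complex_eq_iff)
    then have "(\<integral>\<^sup>+z. f (w * z) \<partial>lborel) = (\<integral>\<^sup>+z. f ((w * \<i>) * (- \<i> * z)) \<partial>lborel)"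
      by simp
    also have "\<dots> = (\<integral>\<^sup>+z. f ((w * \<i>) * z) \<partial>lborel)"
      by (rule *[of "\<lambda>z. f ((w * \<i>) * z)"]) auto
    also have "\<dots> = (\<integral>\<^sup>+z. f z \<partial>lborel)"
      by (rule *) (use w nw in \<open>auto simp: norm_mult\<close>)
    finally show ?thesis .
  qed (use * w in auto)
qed

section \<open>Bergman measures on the disc: radial moments and coefficient norms\<close>

lemma sets_bergman_disc [measurable_cong, simp]: "sets (bergman_disc m) = sets borel"
  and space_bergman_disc [simp]: "space (bergman_disc m) = UNIV"
  by (simp_all add: bergman_disc_def)

lemma borel_measurable_bergman_disc [simp]:
  "f \<in> borel_measurable (bergman_disc m) \<longleftrightarrow> f \<in> borel_measurable borel"
  using measurable_cong_sets[OF sets_bergman_disc refl] by blast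

lemma borel_measurable_bergman_density [measurable]:
  "(\<lambda>z::complex. ennreal (indicator (ball 0 1) z * ((real m - 1) / pi * (1 - (norm z)\<^sup>2) ^ (m - 2))))
     \<in> borel_measurable borel"
proof -
  have [measurable]: "ball (0::complex) 1 \<in> sets borel" by simp
  show ?thesis by measurable
qed

lemma nn_integral_bergman_disc:
  assumes [measurable]: "f \<in> borel_measurable borel"
  shows "(\<integral>\<^sup>+z. f z \<partial>bergman_disc m) = (\<integral>\<^sup>+z. ennreal (indicator (ball 0 1) z *
     ((real m - 1) / pi * (1 - (norm z)\<^sup>2) ^ (m - 2))) * f z \<partial>lborel)"
  unfolding bergman_disc_def by (rule nn_integral_density) measurable

lemma AE_bergman_disc: "AE z in bergman_disc m. norm z < 1"
  unfolding bergman_disc_def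
  by (subst AE_density, measurable) (auto split: split_indicator)

lemma nn_integral_bergman_disc_rotate:
  assumes [measurable]: "f \<in> borel_measurable borel" and w: "norm w = 1"
  shows "(\<integral>\<^sup>+z. f (w * z) \<partial>bergman_disc m) = (\<integral>\<^sup>+z. f z \<partial>bergman_disc m)"
proof -
  let ?d = "\<lambda>z::complex. ennreal (indicator (ball 0 1) z * ((real m - 1) / pi * (1 - (norm z)\<^sup>2) ^ (m - 2)))"
  have "(\<integral>\<^sup>+z. f (w * z) \<partial>bergman_disc m) = (\<integral>\<^sup>+z. ?d (w * z) * f (w * z) \<partial>lborel)"
    using w by (subst nn_integral_bergman_disc) (auto simp: norm_mult indicator_def)
  also have "\<dots> = (\<integral>\<^sup>+z. ?d z * f z \<partial>lborel)"
    by (rule nn_integral_rotate[of "\<lambda>z. ?d z * f z", OF _ w]) measurable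
  also have "\<dots> = (\<integral>\<^sup>+z. f z \<partial>bergman_disc m)"
    by (subst nn_integral_bergman_disc) auto
  finally show ?thesis .
qed

lemma emeasure_ball_complex: "r \<ge> 0 \<Longrightarrow> emeasure lborel (ball (0::complex) r) = ennreal (pi * r\<^sup>2)"
  and emeasure_cball_complex: "r \<ge> 0 \<Longrightarrow> emeasure lborel (cball (0::complex) r) = ennreal (pi * r\<^sup>2)"
  using unit_ball_vol_2 by (simp_all add: emeasure_ball emeasure_cball)

text \<open>Takes the place of polar coordinates: the substitution
  \<open>t = (norm z)\<^sup>2\<close> turns area on the disc into \<open>pi\<close> times length.
  The two measures are compared on half-lines, where only areas of discs occur.\<close>

lemma distr_norm_square:
  "distr (density lborel (\<lambda>z::complex. indicator (ball 0 1) z)) borel (\<lambda>z. (norm z)\<^sup>2)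
    = density lborel (\<lambda>t. ennreal pi * indicator {0..<1} t)" (is "?M = ?N")
proof (rule measure_eqI_lessThan)
  fix x :: real
  have M: "emeasure ?M {x<..} = emeasure lborel {z::complex. norm z < 1 \<and> (norm z)\<^sup>2 > x}"
  proof -
    have "emeasure ?M {x<..} = emeasure (density lborel (\<lambda>z::complex. indicator (ball 0 1) z)) {z. (norm z)\<^sup>2 > x}"
      by (subst emeasure_distr) (auto simp: vimage_def)
    also have "\<dots> = (\<integral>\<^sup>+z. indicator (ball 0 1) z * indicator {z. (norm z)\<^sup>2 > x} z \<partial>(lborel :: complex measure))"
      by (subst emeasure_density) (auto intro!: borel_measurable_indicator)
    also have "\<dots> = (\<integral>\<^sup>+z. indicator {z. norm z < 1 \<and> (norm z)\<^sup>2 > x} z \<partial>(lborel :: complex measure))"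
      by (intro nn_integral_cong) (auto split: split_indicator)
    also have "\<dots> = emeasure lborel {z::complex. norm z < 1 \<and> (norm z)\<^sup>2 > x}"
      by (rule nn_integral_indicator) measurable
    finally show ?thesis .
  qed
  have N: "emeasure ?N {x<..} = ennreal pi * emeasure lborel ({0..<1} \<inter> {x<..})"
  proof -
    have "emeasure ?N {x<..} = (\<integral>\<^sup>+t. ennreal pi * indicator ({0..<1} \<inter> {x<..}) t \<partial>lborel)"
      by (subst emeasure_density) (auto intro!: nn_integral_cong split: split_indicator)
    then show ?thesis by (simp add: nn_integral_cmult)
  qed
  consider "x < 0" | "0 \<le> x" "x < 1" | "1 \<le> x" by linarith
  then have "emeasure ?M {x<..} = emeasure ?N {x<..} \<and> emeasure ?M {x<..} < \<infinity>"
  proof cases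
    case 1
    have "{z::complex. norm z < 1 \<and> (norm z)\<^sup>2 > x} = ball 0 1"
      using 1 by (auto intro: less_le_trans)
    moreover have "{0..<1} \<inter> {x<..} = {0..<1}" using 1 by auto
    ultimately show ?thesis unfolding M N by (simp add: emeasure_ball_complex ennreal_mult_less_top)
  next
    case 2
    have "{z::complex. norm z < 1 \<and> (norm z)\<^sup>2 > x} = ball 0 1 - cball 0 (sqrt x)"
    proof -
      have *: "x < (norm z)\<^sup>2 \<longleftrightarrow> sqrt x < norm z" for z :: complex
        by (metis real_sqrt_less_iff real_sqrt_abs abs_norm_cancel)
      show ?thesis unfolding * by (auto simp: not_le)
    qed
    moreover have "emeasure lborel (ball 0 1 - cball (0::complex) (sqrt x)) = ennreal (pi * 1\<^sup>2) - ennreal (pi * (sqrt x)\<^sup>2)"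
    proof -
      have "sqrt x < 1" using 2 by simp
      then have "cball 0 (sqrt x) \<subseteq> ball (0::complex) 1" by (simp add: cball_subset_ball_iff)
      then show ?thesis
        using 2 by (subst emeasure_Diff) (simp_all add: emeasure_ball_complex emeasure_cball_complex)
    qed
    moreover have "ennreal (pi * 1\<^sup>2) - ennreal (pi * (sqrt x)\<^sup>2) = ennreal pi * ennreal (1 - x)"
      using 2 by (simp add: ennreal_minus ennreal_mult[symmetric] right_diff_distrib)
    moreover have "{0..<1} \<inter> {x<..} = {x<..<1}" using 2 by auto
    ultimately show ?thesis unfolding M N using 2 by (simp add: ennreal_mult_less_top)
  next
    case 3
    have e1: "{z::complex. norm z < 1 \<and> (norm z)\<^sup>2 > x} = {}"
    proof -
      have "\<not> (norm z)\<^sup>2 > x" if "norm z < 1" for z :: complex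
        using power_le_one[of "norm z" 2] that 3 by simp
      then show ?thesis by blast
    qed
    have e2: "{0..<1} \<inter> {x<..} = {}" using 3 by auto
    show ?thesis unfolding M N e1 e2 by simp
  qed
  then show "emeasure ?M {x<..} = emeasure ?N {x<..}" "emeasure ?M {x<..} < \<infinity>" by auto
qed auto

text \<open>After \<open>t = (norm z)\<^sup>2\<close> the moment is the Beta integral
  \<open>(m - 1) * Beta (k + 1) (m - 1)\<close>, a reciprocal binomial. The weights in
  \<open>wnorm\<close> come from here.\<close>

lemma nn_integral_bergman_disc_radial:
  assumes m: "m \<ge> 2"
  shows "(\<integral>\<^sup>+z. ennreal (norm z ^ (2 * k)) \<partial>bergman_disc m) = ennreal (1 / real ((k + (m - 1)) choose (m - 1)))"
proof -
  define h where "h t = (real m - 1) * (1 - t) ^ (m - 2) * t ^ k" for t :: real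
  have [measurable]: "h \<in> borel_measurable borel" unfolding h_def by measurable
  have "(\<integral>\<^sup>+z. ennreal (norm z ^ (2 * k)) \<partial>bergman_disc m)
      = (\<integral>\<^sup>+z. indicator (ball 0 1) z * (ennreal (1/pi) * ennreal (h ((norm z)\<^sup>2))) \<partial>(lborel :: complex measure))"
  proof (subst nn_integral_bergman_disc, simp, intro nn_integral_cong)
    fix z :: complex
    show "ennreal (indicator (ball 0 1) z * ((real m - 1) / pi * (1 - (norm z)\<^sup>2) ^ (m - 2))) * ennreal (norm z ^ (2 * k))
      = indicator (ball 0 1) z * (ennreal (1/pi) * ennreal (h ((norm z)\<^sup>2)))"
    proof (cases "norm z < 1")
      case True
      then have "0 \<le> 1 - (norm z)\<^sup>2" by (simp add: power_le_one)
      moreover have "0 \<le> real m - 1" using m by simp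
      moreover have "norm z ^ (2 * k) = ((norm z)\<^sup>2) ^ k" by (rule power_mult)
      ultimately show ?thesis
        using True by (simp add: h_def ennreal_mult[symmetric] mult_ac)
    qed simp
  qed
  also have "\<dots> = (\<integral>\<^sup>+z. ennreal (1/pi) * ennreal (h ((norm z)\<^sup>2)) \<partial>(density lborel (\<lambda>z::complex. indicator (ball 0 1) z)))"
    by (subst nn_integral_density) (auto intro!: borel_measurable_indicator)
  also have "\<dots> = (\<integral>\<^sup>+t. ennreal (1/pi) * ennreal (h t) \<partial>distr (density lborel (\<lambda>z::complex. indicator (ball 0 1) z)) borel (\<lambda>z. (norm z)\<^sup>2))"
    by (subst nn_integral_distr) auto
  also have "\<dots> = (\<integral>\<^sup>+t. ennreal pi * indicator {0..<1} t * (ennreal (1/pi) * ennreal (h t)) \<partial>lborel)"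
    unfolding distr_norm_square by (subst nn_integral_density) auto
  also have "\<dots> = (\<integral>\<^sup>+t. ennreal (h t) * indicator {0..1} t \<partial>lborel)"
  proof (rule nn_integral_cong_AE)
    have "AE t in lborel. t \<noteq> (1::real)" by (rule AE_lborel_singleton)
    then show "AE t in lborel. ennreal pi * indicator {0..<1} t * (ennreal (1/pi) * ennreal (h t)) = ennreal (h t) * indicator {0..1} t"
      by eventually_elim (auto split: split_indicator simp: ennreal_mult'[symmetric] mult.assoc[symmetric])
  qed
  also have "\<dots> = ennreal ((real m - 1) * Beta (real k + 1) (real m - 1))"
  proof (rule nn_integral_has_integral_lebesgue')
    show "0 \<le> h t" if "t \<in> {0..1}" for t
      using that m by (simp add: h_def)
    have i1: "((\<lambda>t. (real m - 1) * (t powr ((real k + 1) - 1) * (1 - t) powr ((real m - 1) - 1))) has_integral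
       (real m - 1) * Beta (real k + 1) (real m - 1)) {0..1}"
      using m by (intro has_integral_mult_right has_integral_Beta_real) auto
    \<comment> \<open>The endpoints are left out because \<open>0 powr 0 = 0\<close> while
      \<open>0 ^ 0 = 1\<close>.\<close>
    have i2: "h t = (real m - 1) * (t powr ((real k + 1) - 1) * (1 - t) powr ((real m - 1) - 1))"
      if "t \<in> {0..1} - {0, 1}" for t
    proof -
      have "t powr ((real k + 1) - 1) = t ^ k" using that by (simp add: powr_realpow)
      moreover have "(1 - t) powr ((real m - 1) - 1) = (1 - t) ^ (m - 2)"
        using that m powr_realpow[of "1 - t" "m - 2"] by (simp add: of_nat_diff)
      ultimately show ?thesis by (simp add: h_def mult_ac)
    qed
    show "(h has_integral (real m - 1) * Beta (real k + 1) (real m - 1)) {0..1}"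
      by (rule has_integral_spike_finite[where S = "{0, 1}", OF _ i2 i1]) simp_all
  qed
  also have "(real m - 1) * Beta (real k + 1) (real m - 1) = 1 / real ((k + (m - 1)) choose (m - 1))"
  proof -
    obtain s where s: "m = Suc (Suc s)" using m by (metis Suc_le_D numeral_2_eq_2 Suc_le_mono)
    have "Beta (real k + 1) (real m - 1) = fact k * fact s / fact (k + s + 1)"
      using Gamma_fact[of k, where ?'a = real] Gamma_fact[of s, where ?'a = real] Gamma_fact[of "k + s + 1", where ?'a = real]
      by (simp add: Beta_def s add_ac)
    moreover have "real ((k + Suc s) choose Suc s) = fact (k + Suc s) / (fact (Suc s) * fact k)"
      by (subst binomial_fact) auto
    ultimately show ?thesis by (simp add: s)
  qed
  finally show ?thesis .
qed

lemma prob_space_bergman_disc: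
  assumes "m \<ge> 2" shows "prob_space (bergman_disc m)"
proof
  have "emeasure (bergman_disc m) (space (bergman_disc m)) = (\<integral>\<^sup>+z. ennreal (norm z ^ (2 * 0)) \<partial>bergman_disc m)"
    by simp
  also have "\<dots> = 1" unfolding nn_integral_bergman_disc_radial[OF assms] by simp
  finally show "emeasure (bergman_disc m) (space (bergman_disc m)) = 1" .
qed

text \<open>The measure is rotation invariant, so the integrand may be averaged over circles;
  Parseval removes the cross terms and the radial moments remain.\<close>

lemma nn_integral_bergman_disc_fps:
  assumes m: "m \<ge> 2" and A: "fps_conv_radius A \<ge> 1"
  shows "(\<integral>\<^sup>+z. ennreal ((norm (eval_fps A z))\<^sup>2) * indicator (ball 0 1) z \<partial>bergman_disc m) = wnorm (m - 1) A"
proof -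
  interpret S: prob_space circle_haar by (rule prob_space_circle_haar)
  interpret B: prob_space "bergman_disc m" by (rule prob_space_bergman_disc[OF m])
  interpret pair_sigma_finite "bergman_disc m" circle_haar ..
  define F where "F z = ennreal ((norm (eval_fps A z))\<^sup>2) * indicator (ball 0 1) z" for z
  have cont: "continuous_on (ball 0 1) (eval_fps A)"
  proof (rule continuous_on_subset[OF continuous_on_eval_fps])
    show "ball (0::complex) 1 \<subseteq> eball 0 (fps_conv_radius A)"
    proof
      fix x :: complex assume "x \<in> ball 0 1"
      then have "ereal (norm x) < 1" by (simp add: one_ereal_def)
      also note A
      finally show "x \<in> eball 0 (fps_conv_radius A)" by (simp add: in_eball_iff)
    qed
  qed
  have "(\<lambda>z. indicator (ball 0 1) z *\<^sub>R (norm (eval_fps A z))\<^sup>2) \<in> borel_measurable borel"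
    by (intro borel_measurable_continuous_on_indicator continuous_intros cont) auto
  then have "(\<lambda>z. ennreal (indicator (ball 0 1) z *\<^sub>R (norm (eval_fps A z))\<^sup>2)) \<in> borel_measurable borel"
    by measurable
  also have "(\<lambda>z. ennreal (indicator (ball 0 1) z *\<^sub>R (norm (eval_fps A z))\<^sup>2)) = F"
    by (auto simp: F_def split: split_indicator)
  finally have F[measurable]: "F \<in> borel_measurable borel" .
  \<comment> \<open>A constant integrated over the probability measure \<open>circle_haar\<close>;
    each value of it is then rewritten by a rotation.\<close>
  have "(\<integral>\<^sup>+z. F z \<partial>bergman_disc m) = (\<integral>\<^sup>+\<zeta>. \<integral>\<^sup>+z. F z \<partial>bergman_disc m \<partial>circle_haar)"
    by (simp add: S.emeasure_space_1[simplified])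
  also have "\<dots> = (\<integral>\<^sup>+\<zeta>. \<integral>\<^sup>+z. F (z * \<zeta>) \<partial>bergman_disc m \<partial>circle_haar)"
  proof (rule nn_integral_cong_AE)
    show "AE \<zeta> in circle_haar. (\<integral>\<^sup>+z. F z \<partial>bergman_disc m) = (\<integral>\<^sup>+z. F (z * \<zeta>) \<partial>bergman_disc m)"
      using AE_circle_haar
    proof eventually_elim
      case (elim \<zeta>)
      then show ?case using nn_integral_bergman_disc_rotate[OF F, of \<zeta> m] by (simp add: mult.commute)
    qed
  qed
  also have "\<dots> = (\<integral>\<^sup>+z. \<integral>\<^sup>+\<zeta>. F (z * \<zeta>) \<partial>circle_haar \<partial>bergman_disc m)"
    by (rule Fubini') measurable
  also have "\<dots> = (\<integral>\<^sup>+z. (\<Sum>k. ennreal ((norm (A $ k))\<^sup>2) * ennreal (norm z ^ (2 * k))) \<partial>bergman_disc m)"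
  proof (rule nn_integral_cong_AE)
    show "AE z in bergman_disc m. (\<integral>\<^sup>+\<zeta>. F (z * \<zeta>) \<partial>circle_haar) = (\<Sum>k. ennreal ((norm (A $ k))\<^sup>2) * ennreal (norm z ^ (2 * k)))"
      using AE_bergman_disc
    proof eventually_elim
      case (elim z)
      have "(\<integral>\<^sup>+\<zeta>. F (z * \<zeta>) \<partial>circle_haar) = (\<integral>\<^sup>+\<zeta>. ennreal ((norm (eval_fps A (z * \<zeta>)))\<^sup>2) \<partial>circle_haar)"
        by (rule nn_integral_cong_AE) (use AE_circle_haar elim in \<open>auto elim!: eventually_mono simp: F_def norm_mult\<close>)
      also have "\<dots> = (\<Sum>k. ennreal ((norm (A $ k))\<^sup>2) * ennreal (norm z ^ (2 * k)))"
        unfolding parseval_fps[OF A elim] by (simp add: ennreal_mult)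
      finally show ?case .
    qed
  qed
  also have "\<dots> = (\<Sum>k. ennreal ((norm (A $ k))\<^sup>2) * (\<integral>\<^sup>+z. ennreal (norm z ^ (2 * k)) \<partial>bergman_disc m))"
    by (subst nn_integral_suminf) (auto simp: nn_integral_cmult)
  also have "\<dots> = wnorm (m - 1) A"
    unfolding wnorm_def nn_integral_bergman_disc_radial[OF m] by (simp flip: ennreal_mult)
  finally show ?thesis unfolding F_def .
qed

section \<open>Zero-free majorants\<close>

text \<open>The local factor near \<open>a\<close> and the quotient \<open>f z / (z - a) ^ n\<close>
  away from \<open>a\<close> agree where both are defined, so they glue to a factor on all of
  \<open>S\<close>.\<close>

lemma holomorphic_factor_zero_global:
  assumes hol: "f holomorphic_on S" and S: "open S" "connected S" and a: "a \<in> S" "f a = 0"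
    and nc: "\<not> f constant_on S"
  obtains g n where "0 < (n::nat)" "g holomorphic_on S" "g a \<noteq> 0" "\<And>z. z \<in> S \<Longrightarrow> f z = (z - a) ^ n * g z"
proof -
  obtain h r n where n: "0 < n" "0 < r" "ball a r \<subseteq> S" "h holomorphic_on ball a r"
    "\<And>w. w \<in> ball a r \<Longrightarrow> f w = (w - a) ^ n * h w" "\<And>w. w \<in> ball a r \<Longrightarrow> h w \<noteq> 0"
    using holomorphic_factor_zero_nonconstant[OF hol S a nc] by metis
  define g where "g z = (if z \<in> ball a r then h z else f z / (z - a) ^ n)" for z
  have g2: "g z = f z / (z - a) ^ n" if "z \<noteq> a" for z
    using n(5)[of z] that by (auto simp: g_def)
  have "g holomorphic_on ball a r"
    using n(4) by (rule holomorphic_transform) (simp add: g_def)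
  moreover have "g holomorphic_on (S - {a})"
  proof (rule holomorphic_transform)
    show "(\<lambda>z. f z / (z - a) ^ n) holomorphic_on (S - {a})"
      by (intro holomorphic_intros holomorphic_on_subset[OF hol]) auto
  qed (simp add: g2)
  ultimately have "g holomorphic_on (ball a r \<union> (S - {a}))"
    using S by (intro holomorphic_on_Un) auto
  moreover have "ball a r \<union> (S - {a}) = S" using n a by auto
  ultimately have "g holomorphic_on S" by simp
  moreover have "g a \<noteq> 0" using n by (simp add: g_def)
  moreover have "f z = (z - a) ^ n * g z" if "z \<in> S" for z
    using a(2) n(1) by (cases "z = a") (auto simp: g2)
  ultimately show ?thesis using that n(1) by blast
qed

text \<open>The identity \<open>eq\<close> in the proof says that the Blaschke factor of
  \<open>a\<close> has modulus \<open>1\<close> on the circle and at most \<open>1\<close>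
  inside.\<close>

lemma norm_blaschke:
  assumes "norm a < 1"
  shows "norm z = 1 \<Longrightarrow> norm (1 - cnj a * z) = norm (z - a)"
    and "norm z < 1 \<Longrightarrow> norm (z - a) \<le> norm (1 - cnj a * z)"
proof -
  have eq: "(norm (1 - cnj a * z))\<^sup>2 - (norm (z - a))\<^sup>2 = (1 - (norm a)\<^sup>2) * (1 - (norm z)\<^sup>2)"
    unfolding cmod_power2 by (simp add: algebra_simps power2_eq_square)
  show "norm (1 - cnj a * z) = norm (z - a)" if "norm z = 1"
  proof -
    have "(norm (1 - cnj a * z))\<^sup>2 = (norm (z - a))\<^sup>2" using eq that by simp
    then show ?thesis by (simp add: power2_eq_iff_nonneg)
  qed
  show "norm (z - a) \<le> norm (1 - cnj a * z)" if "norm z < 1"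
  proof (rule power2_le_imp_le)
    have "0 \<le> (1 - (norm a)\<^sup>2) * (1 - (norm z)\<^sup>2)"
      using that assms by (intro mult_nonneg_nonneg) (auto simp: power_le_one)
    then show "(norm (z - a))\<^sup>2 \<le> (norm (1 - cnj a * z))\<^sup>2" using eq by linarith
  qed auto
qed

text \<open>Division by a finite Blaschke product, one zero at a time.\<close>

lemma zero_free_dominant_aux:
  assumes "finite {z \<in> ball 0 1. f z = 0}"
    and "f holomorphic_on ball 0 R" "R > 1" "\<exists>z\<in>ball 0 1. f z \<noteq> 0"
  shows "\<exists>g. g holomorphic_on ball 0 R \<and> (\<forall>z. norm z < 1 \<longrightarrow> g z \<noteq> 0 \<and> norm (f z) \<le> norm (g z))
      \<and> (\<forall>z. norm z = 1 \<longrightarrow> norm (g z) = norm (f z))"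
  using assms
proof (induction "card {z \<in> ball 0 1. f z = 0}" arbitrary: f rule: less_induct)
    case less
    let ?Z = "\<lambda>f. {z \<in> ball 0 1. f z = (0::complex)}"
    note R = less.prems(3)
    show ?case
    proof (cases "?Z f = {}")
      case True
      then show ?thesis using less.prems by (intro exI[of _ f]) auto
    next
      case False
      then obtain a where a: "norm a < 1" "f a = 0" by auto
      have "\<not> f constant_on ball 0 R"
      proof
        assume "f constant_on ball 0 R"
        then obtain c where c: "\<And>z. z \<in> ball 0 R \<Longrightarrow> f z = c" by (auto simp: constant_on_def)
        moreover have "a \<in> ball 0 R" using a R by auto
        ultimately have "c = 0" using a by auto
        then show False using less.prems c R by force
      qed
      obtain g n where g: "0 < (n::nat)" "g holomorphic_on ball 0 R" "g a \<noteq> 0"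
        "\<And>z. z \<in> ball 0 R \<Longrightarrow> f z = (z - a) ^ n * g z"
        by (rule holomorphic_factor_zero_global[OF less.prems(2) open_ball connected_ball _ a(2) \<open>\<not> f constant_on ball 0 R\<close>])
          (use a R in auto)
      \<comment> \<open>Replacing \<open>(z - a) ^ n\<close> by \<open>(1 - cnj a * z) ^ n\<close>
        removes the zero \<open>a\<close> with its full multiplicity, adds no zero in the disc,
        keeps the modulus on the circle and does not decrease it inside.\<close>
      define h where "h z = (1 - cnj a * z) ^ n * g z" for z
      have nz1: "1 - cnj a * z \<noteq> 0" if "norm z < 1" for z
      proof
        assume "1 - cnj a * z = 0"
        then have "norm a * norm z = 1" by (metis complex_mod_cnj eq_iff_diff_eq_0 norm_mult norm_one)
        moreover have "norm a * norm z < 1 * 1"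
          using a that by (intro mult_strict_mono') auto
        ultimately show False by simp
      qed
      have "?Z h \<subseteq> ?Z f - {a}"
        using nz1 g(3) g(4) R by (auto simp: h_def)
      moreover have "a \<in> ?Z f" using a by auto
      ultimately have sub: "?Z h \<subset> ?Z f" by auto
      have "\<exists>k. k holomorphic_on ball 0 R \<and> (\<forall>z. norm z < 1 \<longrightarrow> k z \<noteq> 0 \<and> norm (h z) \<le> norm (k z))
        \<and> (\<forall>z. norm z = 1 \<longrightarrow> norm (k z) = norm (h z))"
      proof (rule less.hyps)
        show "card (?Z h) < card (?Z f)" by (rule psubset_card_mono[OF less.prems(1) sub])
        show "finite (?Z h)" using sub less.prems(1) by (meson finite_subset psubset_imp_subset)
        show "h holomorphic_on ball 0 R" unfolding h_def by (intro holomorphic_intros g)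
        obtain z where z: "norm z < 1" "f z \<noteq> 0" using less.prems(4) by auto
        then have "h z \<noteq> 0" using nz1[OF z(1)] g(4)[of z] R by (auto simp: h_def)
        then show "\<exists>z\<in>ball 0 1. h z \<noteq> 0" using z by auto
      qed fact
      then obtain k where k: "k holomorphic_on ball 0 R" "\<And>z. norm z < 1 \<Longrightarrow> k z \<noteq> 0"
        "\<And>z. norm z < 1 \<Longrightarrow> norm (h z) \<le> norm (k z)" "\<And>z. norm z = 1 \<Longrightarrow> norm (k z) = norm (h z)"
        by auto
      have "norm (f z) \<le> norm (k z)" if "norm z < 1" for z
      proof -
        have "norm (f z) \<le> norm (h z)"
          using g(4)[of z] that R norm_blaschke(2)[OF a(1) that]
          by (auto simp: h_def norm_mult norm_power intro!: mult_right_mono power_mono)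
        then show ?thesis using k(3)[OF that] by linarith
      qed
      moreover have "norm (k z) = norm (f z)" if "norm z = 1" for z
        using g(4)[of z] that R norm_blaschke(1)[OF a(1) that] k(4)[OF that]
        by (simp add: h_def norm_mult norm_power)
      ultimately show ?thesis using k by blast
    qed
  qed

text \<open>\<open>R > 1\<close> puts the closed disc inside the domain, so compactness leaves only
  finitely many zeros to divide out. Zeros on the circle itself stay.\<close>

lemma zero_free_dominant:
  assumes hol: "f holomorphic_on ball 0 R" and R: "R > 1" and nz: "\<exists>z\<in>ball 0 1. f z \<noteq> 0"
  obtains g where "g holomorphic_on ball 0 R" "\<And>z. norm z < 1 \<Longrightarrow> g z \<noteq> 0"
    "\<And>z. norm z < 1 \<Longrightarrow> norm (f z) \<le> norm (g z)" "\<And>z. norm z = 1 \<Longrightarrow> norm (g z) = norm (f z)"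
proof -
  let ?Z = "\<lambda>f. {z \<in> ball 0 1. f z = (0::complex)}"
  have "finite (?Z f)"
  proof (cases "f constant_on ball 0 R")
    case True
    then have "?Z f = {}" using nz R by (force simp: constant_on_def)
    then show ?thesis by (simp only: finite.emptyI)
  next
    case False
    have "finite {z \<in> cball 0 1. f z = 0}"
      by (rule holomorphic_compact_finite_zeros[OF hol]) (use R False in auto)
    then show ?thesis by (rule rev_finite_subset) auto
  qed
  from zero_free_dominant_aux[OF this hol R nz] show ?thesis using that by blast
qed

section \<open>Means over circles and their limits and monotonicity in the radius\<close>

definition circle_mean :: "real \<Rightarrow> (complex \<Rightarrow> complex) \<Rightarrow> ennreal" where
  "circle_mean p f = (\<integral>\<^sup>+\<zeta>. ennreal (norm (f \<zeta>) powr p) * indicator (sphere 0 1) \<zeta> \<partial>circle_haar)"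

lemma indicator_ennreal_measurable:
  fixes h :: "'a::topological_space \<Rightarrow> real"
  assumes "continuous_on S h" "S \<in> sets borel"
  shows "(\<lambda>x. ennreal (h x) * indicator S x) \<in> borel_measurable borel"
proof -
  have "(\<lambda>x. indicator S x *\<^sub>R h x) \<in> borel_measurable borel"
    using assms by (rule borel_measurable_continuous_on_indicator[rotated])
  then have "(\<lambda>x. ennreal (indicator S x *\<^sub>R h x)) \<in> borel_measurable borel" by measurable
  also have "(\<lambda>x. ennreal (indicator S x *\<^sub>R h x)) = (\<lambda>x. ennreal (h x) * indicator S x)"
    by (auto split: split_indicator)
  finally show ?thesis .
qed

lemma continuous_on_norm_powr:
  fixes f :: "'a::topological_space \<Rightarrow> 'b::real_normed_vector"
  assumes "continuous_on S f" "p > 0"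
  shows "continuous_on S (\<lambda>x. norm (f x) powr p)"
  using assms by (intro continuous_on_powr' continuous_intros) auto

text \<open>The reason for the indicator in \<open>circle_mean\<close>: continuity on the circle
  alone makes the integrand Borel, whatever \<open>f\<close> does elsewhere.\<close>

lemma circle_mean_measurable:
  fixes f :: "complex \<Rightarrow> complex"
  assumes "continuous_on (sphere 0 1) f" "p > 0"
  shows "(\<lambda>\<zeta>. ennreal (norm (f \<zeta>) powr p) * indicator (sphere 0 1) \<zeta>) \<in> borel_measurable borel"
  using assms by (intro indicator_ennreal_measurable continuous_on_norm_powr borel_closed closed_sphere) auto

lemma circle_mean_cong:
  "(\<And>z. norm z = 1 \<Longrightarrow> norm (f z) = norm (g z)) \<Longrightarrow> circle_mean p f = circle_mean p g"
  unfolding circle_mean_def by (intro nn_integral_cong) (auto split: split_indicator)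

lemma circle_mean_le:
  assumes "\<And>z. norm z = 1 \<Longrightarrow> norm (f z) powr p \<le> B" "B \<ge> 0"
  shows "circle_mean p f \<le> ennreal B"
proof -
  interpret prob_space circle_haar by (rule prob_space_circle_haar)
  have "circle_mean p f \<le> (\<integral>\<^sup>+\<zeta>. ennreal B \<partial>circle_haar)"
    unfolding circle_mean_def by (intro nn_integral_mono) (auto split: split_indicator intro!: ennreal_leI assms)
  also have "\<dots> = ennreal B" by (simp add: emeasure_space_1[simplified])
  finally show ?thesis .
qed

lemma circle_mean_finite:
  assumes "continuous_on (sphere 0 1) f" "p > 0"
  shows "circle_mean p f < \<top>"
proof -
  have "compact ((\<lambda>z. norm (f z) powr p) ` sphere 0 1)"
    by (intro compact_continuous_image continuous_on_norm_powr assms) auto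
  then obtain B where B: "\<forall>z\<in>sphere 0 1. norm (f z) powr p \<le> B"
    by (auto dest!: compact_imp_bounded simp: bounded_iff)
  have "circle_mean p f \<le> ennreal (max 0 B)" by (rule circle_mean_le) (use B in \<open>auto intro: max.coboundedI2\<close>)
  then show ?thesis by (rule le_less_trans) auto
qed

text \<open>The shift by \<open>2\<close> keeps all radii strictly between \<open>0\<close> and
  \<open>1\<close>. A sequence of radii suits Fatou and monotone convergence.\<close>

definition radius_seq :: "nat \<Rightarrow> real" where "radius_seq n = 1 - 1 / (real n + 2)"

lemma radius_seq: "0 < radius_seq n" "radius_seq n < 1" "radius_seq \<longlonglongrightarrow> 1" "m \<le> n \<Longrightarrow> radius_seq m \<le> radius_seq n"
proof -
  show "0 < radius_seq n" "radius_seq n < 1" by (auto simp: radius_seq_def field_simps)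
  show "radius_seq \<longlonglongrightarrow> 1" unfolding radius_seq_def by real_asymp
  show "radius_seq m \<le> radius_seq n" if "m \<le> n" using that by (simp add: radius_seq_def frac_le)
qed

lemma circle_mean_eval_fps:
  assumes A: "fps_conv_radius A \<ge> 1" and r: "0 \<le> r" "r < 1"
  shows "circle_mean 2 (\<lambda>\<zeta>. eval_fps A (of_real r * \<zeta>)) = (\<Sum>k. ennreal ((norm (A $ k))\<^sup>2 * r ^ (2 * k)))"
proof -
  have nr: "norm (of_real r :: complex) = r" "norm (of_real r :: complex) < 1"
    using r by simp_all
  have "circle_mean 2 (\<lambda>\<zeta>. eval_fps A (of_real r * \<zeta>))
      = (\<integral>\<^sup>+\<zeta>. ennreal ((norm (eval_fps A (of_real r * \<zeta>)))\<^sup>2) \<partial>circle_haar)"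
    unfolding circle_mean_def
    by (rule nn_integral_cong_AE, rule eventually_mono[OF AE_circle_haar]) simp
  also have "\<dots> = (\<Sum>k. ennreal ((norm (A $ k))\<^sup>2 * r ^ (2 * k)))"
    using parseval_fps[OF A nr(2)] unfolding nr(1) .
  finally show ?thesis .
qed

text \<open>Every partial sum of the coefficient norm is a limit of partial sums at smaller radii,
  so bounds on interior circles suffice and no boundary function of \<open>A\<close> enters.\<close>

lemma wnorm_le_lim:
  assumes A: "fps_conv_radius A \<ge> 1"
    and le: "\<And>n. circle_mean 2 (\<lambda>\<zeta>. eval_fps A (of_real (radius_seq n) * \<zeta>)) \<le> I n" and I: "I \<longlonglongrightarrow> L"
  shows "wnorm 0 A \<le> L"
proof -
  have "(\<Sum>k<N. ennreal ((norm (A $ k))\<^sup>2)) \<le> L" for N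
  proof (rule LIMSEQ_le[OF _ I])
    have "(\<lambda>n. \<Sum>k<N. ennreal ((norm (A $ k))\<^sup>2 * radius_seq n ^ (2 * k))) \<longlonglongrightarrow> (\<Sum>k<N. ennreal ((norm (A $ k))\<^sup>2 * 1 ^ (2 * k)))"
      by (intro tendsto_intros radius_seq(3))
    then show "(\<lambda>n. \<Sum>k<N. ennreal ((norm (A $ k))\<^sup>2 * radius_seq n ^ (2 * k))) \<longlonglongrightarrow> (\<Sum>k<N. ennreal ((norm (A $ k))\<^sup>2))"
      by simp
    show "\<exists>n0. \<forall>n\<ge>n0. (\<Sum>k<N. ennreal ((norm (A $ k))\<^sup>2 * radius_seq n ^ (2 * k))) \<le> I n"
    proof (intro exI[of _ 0] allI impI)
      fix n
      have "(\<Sum>k<N. ennreal ((norm (A $ k))\<^sup>2 * radius_seq n ^ (2 * k))) \<le> (\<Sum>k. ennreal ((norm (A $ k))\<^sup>2 * radius_seq n ^ (2 * k)))"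
        by (rule sum_le_suminf) auto
      also have "\<dots> = circle_mean 2 (\<lambda>\<zeta>. eval_fps A (of_real (radius_seq n) * \<zeta>))"
        using radius_seq(1,2)[of n] by (intro circle_mean_eval_fps[symmetric] A) auto
      also note le[of n]
      finally show "(\<Sum>k<N. ennreal ((norm (A $ k))\<^sup>2 * radius_seq n ^ (2 * k))) \<le> I n" .
    qed
  qed
  then show ?thesis
    unfolding wnorm_def by (simp add: suminf_le_const)
qed

lemma holomorphic_fps:
  assumes "g holomorphic_on ball 0 1"
  shows "fps_conv_radius (fps_expansion g 0) \<ge> 1"
    and "norm z < 1 \<Longrightarrow> eval_fps (fps_expansion g 0) z = g z"
proof -
  have "ereal 1 = 1" by simp
  have g: "g holomorphic_on eball 0 (ereal 1)" by (rule holomorphic_on_subset[OF assms]) (auto simp: in_eball_iff)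
  show "fps_conv_radius (fps_expansion g 0) \<ge> 1"
    using conv_radius_fps_expansion[OF g] by (simp add: one_ereal_def)
  show "eval_fps (fps_expansion g 0) z = g z" if "norm z < 1"
    using eval_fps_expansion'[OF g, of z] that by simp
qed

lemma circle_mean_lim:
  assumes g: "continuous_on (cball 0 1) g" and p: "p > 0"
  shows "(\<lambda>n. circle_mean p (\<lambda>\<zeta>. g (of_real (radius_seq n) * \<zeta>))) \<longlonglongrightarrow> circle_mean p g"
proof -
  interpret prob_space circle_haar by (rule prob_space_circle_haar)
  have "compact ((\<lambda>z. norm (g z) powr p) ` cball 0 1)"
    by (intro compact_continuous_image continuous_on_norm_powr assms) auto
  then obtain B where B: "\<forall>z\<in>cball 0 1. norm (g z) powr p \<le> B"
    by (auto dest!: compact_imp_bounded simp: bounded_iff)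
  have r1: "norm (of_real (radius_seq n) * \<zeta>) \<le> 1" if "norm \<zeta> \<le> 1" for n and \<zeta> :: complex
    using radius_seq(1,2)[of n] that by (auto simp: norm_mult intro: mult_le_one)
  show ?thesis
    unfolding circle_mean_def
  proof (rule nn_integral_dominated_convergence[where w = "\<lambda>_. ennreal B"])
    show "(\<lambda>\<zeta>. ennreal (norm (g (of_real (radius_seq n) * \<zeta>)) powr p) * indicator (sphere 0 1) \<zeta>) \<in> borel_measurable circle_haar" for n
      unfolding borel_measurable_circle_haar using r1
      by (intro circle_mean_measurable[OF _ p] continuous_on_compose2[OF g] continuous_intros) auto
    show "(\<lambda>\<zeta>. ennreal (norm (g \<zeta>) powr p) * indicator (sphere 0 1) \<zeta>) \<in> borel_measurable circle_haar"
      unfolding borel_measurable_circle_haar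
      by (intro circle_mean_measurable[OF _ p] continuous_on_subset[OF g]) auto
    show "AE \<zeta> in circle_haar. ennreal (norm (g (of_real (radius_seq n) * \<zeta>)) powr p) * indicator (sphere 0 1) \<zeta> \<le> ennreal B" for n
      by (intro AE_I2) (auto split: split_indicator intro!: ennreal_leI B[rule_format] r1)
    show "(\<integral>\<^sup>+ \<zeta>. ennreal B \<partial>circle_haar) < \<infinity>" by (simp add: emeasure_space_1[simplified])
    show "AE \<zeta> in circle_haar. (\<lambda>n. ennreal (norm (g (of_real (radius_seq n) * \<zeta>)) powr p) * indicator (sphere 0 1) \<zeta>)
        \<longlonglongrightarrow> ennreal (norm (g \<zeta>) powr p) * indicator (sphere 0 1) \<zeta>"
      using AE_circle_haar
    proof eventually_elim
      case (elim \<zeta>)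
      have l: "(\<lambda>n. of_real (radius_seq n) * \<zeta>) \<longlonglongrightarrow> \<zeta>"
        using tendsto_mult[OF tendsto_of_real[OF radius_seq(3)] tendsto_const[of \<zeta>]] by simp
      have "(\<lambda>n. norm (g (of_real (radius_seq n) * \<zeta>)) powr p) \<longlonglongrightarrow> norm (g \<zeta>) powr p"
        by (rule continuous_on_tendsto_compose[OF continuous_on_norm_powr[OF g p] l])
           (use elim r1 in auto)
      then show ?case using elim by (simp add: tendsto_ennrealI)
    qed
    show "(\<lambda>_. ennreal B) \<in> borel_measurable circle_haar" by simp
  qed
qed

text \<open>\<open>G\<close> is \<open>g\<close> to the power \<open>p / 2\<close>, by way of a
  logarithm of the zero-free \<open>g\<close>. Since \<open>g\<close> may vanish on the circle,
  \<open>G\<close> lives on the open disc only, and its norm is bounded through interior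
  circles.\<close>

lemma fps_dominant:
  assumes hol: "f holomorphic_on ball 0 R" and R: "R > 1" and nz: "\<exists>z\<in>ball 0 1. f z \<noteq> 0" and p: "p > 0"
  obtains A where "fps_conv_radius A \<ge> 1" "\<And>z. norm z < 1 \<Longrightarrow> eval_fps A z \<noteq> 0"
    "\<And>z. norm z < 1 \<Longrightarrow> norm (f z) powr p \<le> (norm (eval_fps A z))\<^sup>2"
    "wnorm 0 A \<le> circle_mean p f"
proof -
  obtain g where g: "g holomorphic_on ball 0 R" "\<And>z. norm z < 1 \<Longrightarrow> g z \<noteq> 0"
    "\<And>z. norm z < 1 \<Longrightarrow> norm (f z) \<le> norm (g z)" "\<And>z. norm z = 1 \<Longrightarrow> norm (g z) = norm (f z)"
    using zero_free_dominant[OF hol R nz] by metis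
  have g1: "g holomorphic_on ball 0 1" by (rule holomorphic_on_subset[OF g(1)]) (use R in auto)
  obtain L where L: "L holomorphic_on ball 0 1" "\<And>z. z \<in> ball 0 1 \<Longrightarrow> g z = exp (L z)"
    using contractible_imp_holomorphic_log[OF g1 convex_imp_contractible[OF convex_ball]] g(2) by auto
  define G where "G z = exp (of_real (p / 2) * L z)" for z
  have G: "G holomorphic_on ball 0 1" unfolding G_def by (intro holomorphic_intros L)
  have nG: "(norm (G z))\<^sup>2 = norm (g z) powr p" if "norm z < 1" for z
    using that L(2)[of z] by (simp add: G_def powr_def exp_double[symmetric] flip: exp_of_nat_mult)
  define A where "A = fps_expansion G 0"
  have A: "fps_conv_radius A \<ge> 1" "\<And>z. norm z < 1 \<Longrightarrow> eval_fps A z = G z"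
    unfolding A_def by (auto intro: holomorphic_fps[OF G])
  have "wnorm 0 A \<le> circle_mean p g"
  proof (rule wnorm_le_lim[OF A(1)])
    show "(\<lambda>n. circle_mean p (\<lambda>\<zeta>. g (of_real (radius_seq n) * \<zeta>))) \<longlonglongrightarrow> circle_mean p g"
      using R by (intro circle_mean_lim p holomorphic_on_imp_continuous_on holomorphic_on_subset[OF g(1)]) auto
    show "circle_mean 2 (\<lambda>\<zeta>. eval_fps A (of_real (radius_seq n) * \<zeta>)) \<le> circle_mean p (\<lambda>\<zeta>. g (of_real (radius_seq n) * \<zeta>))" for n
      unfolding circle_mean_def
      using radius_seq(1,2)[of n] by (intro nn_integral_mono) (auto split: split_indicator simp: A(2) nG norm_mult)
  qed
  also have "circle_mean p g = circle_mean p f" by (rule circle_mean_cong) (rule g(4))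
  finally have "wnorm 0 A \<le> circle_mean p f" .
  moreover have "norm (f z) powr p \<le> (norm (eval_fps A z))\<^sup>2" if "norm z < 1" for z
    using g(3)[OF that] p by (simp add: A(2) that nG powr_mono2)
  ultimately show ?thesis using that[of A] A by (auto simp: G_def)
qed

text \<open>Scaling moves the larger circle to radius \<open>1\<close>. The norm of the majorant is
  at most the mean of \<open>f\<close> there; on the smaller circle the majorant dominates
  \<open>f\<close>, and its own means increase with the radius because each term of the Parseval sum
  does.\<close>

lemma circle_mean_mono_radius:
  assumes hol: "f holomorphic_on ball 0 1" and p: "p > 0" and r: "0 \<le> r" "r \<le> s" "s < 1"
  shows "circle_mean p (\<lambda>\<zeta>. f (of_real r * \<zeta>)) \<le> circle_mean p (\<lambda>\<zeta>. f (of_real s * \<zeta>))"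
proof (cases "r = s")
  case False
  then have s: "r < s" "0 < s" using r by auto
  define g where "g z = f (of_real s * z)" for z
  have g: "g holomorphic_on ball 0 (1 / s)"
    unfolding g_def
    by (rule holomorphic_on_compose_gen[OF _ hol, unfolded o_def]) (use s in \<open>auto intro!: holomorphic_intros simp: norm_mult field_simps\<close>)
  have fg: "f (of_real r * \<zeta>) = g (of_real (r / s) * \<zeta>)" for \<zeta>
    using s by (simp add: g_def)
  have rs: "norm (of_real (r / s) * \<zeta>) < 1" if "norm \<zeta> = 1" for \<zeta> :: complex
    using s r that by (simp add: norm_mult norm_divide)
  show ?thesis
  proof (cases "\<exists>z\<in>ball 0 1. g z \<noteq> 0")
    case True
    have "1 / s > 1" using s r by simp
    obtain A where A: "fps_conv_radius A \<ge> 1" 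
      "\<And>z. norm z < 1 \<Longrightarrow> norm (g z) powr p \<le> (norm (eval_fps A z))\<^sup>2"
      "wnorm 0 A \<le> circle_mean p g"
      using fps_dominant[OF g \<open>1 / s > 1\<close> True p] by metis
    have "circle_mean p (\<lambda>\<zeta>. f (of_real r * \<zeta>)) \<le> circle_mean 2 (\<lambda>\<zeta>. eval_fps A (of_real (r / s) * \<zeta>))"
      unfolding circle_mean_def fg by (intro nn_integral_mono) (auto split: split_indicator intro!: ennreal_leI A(2) rs[simplified])
    also have "\<dots> = (\<Sum>k. ennreal ((norm (A $ k))\<^sup>2 * (r / s) ^ (2 * k)))"
      by (rule circle_mean_eval_fps[OF A(1)]) (use s r in auto)
    also have "\<dots> \<le> (\<Sum>k. ennreal ((norm (A $ k))\<^sup>2))"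
      using s r by (intro suminf_le ennreal_leI mult_right_le_one_le power_le_one) auto
    also have "\<dots> = wnorm 0 A" by (simp add: wnorm_def)
    also note A(3)
    also have "circle_mean p g = circle_mean p (\<lambda>\<zeta>. f (of_real s * \<zeta>))"
      by (rule circle_mean_cong) (simp add: g_def)
    finally show ?thesis .
  next
    case False
    then have "f (of_real r * \<zeta>) = 0" if "norm \<zeta> = 1" for \<zeta>
      unfolding fg using rs[OF that] by auto
    then have "circle_mean p (\<lambda>\<zeta>. f (of_real r * \<zeta>)) = circle_mean p (\<lambda>_. 0)"
      by (intro circle_mean_cong) simp
    also have "\<dots> = 0" by (simp add: circle_mean_def)
    finally show ?thesis by simp
  qed
qed simp

section \<open>The inequality in one variable\<close>

lemma eval_fps_prod:
  assumes "\<And>j. j \<in> J \<Longrightarrow> fps_conv_radius (A j) \<ge> 1"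
  shows "fps_conv_radius (\<Prod>j\<in>J. A j) \<ge> 1"
    and "norm z < 1 \<Longrightarrow> eval_fps (\<Prod>j\<in>J. A j) z = (\<Prod>j\<in>J. eval_fps (A j) (z::complex))"
proof -
  have lt: "ereal (norm z) < fps_conv_radius B" if "fps_conv_radius B \<ge> 1" "norm z < 1" for B :: "complex fps"
  proof -
    have "ereal (norm z) < 1" using that by (simp add: one_ereal_def)
    from this that(1) show ?thesis by (rule less_le_trans)
  qed
  have *: "fps_conv_radius (\<Prod>j\<in>J. A j) \<ge> 1 \<and> (norm z < 1 \<longrightarrow> eval_fps (\<Prod>j\<in>J. A j) z = (\<Prod>j\<in>J. eval_fps (A j) z))"
    using assms
  proof (induction J rule: infinite_finite_induct)
    case (insert j F)
    have 1: "fps_conv_radius (A j) \<ge> 1" "fps_conv_radius (\<Prod>j\<in>F. A j) \<ge> 1" using insert by auto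
    have "1 \<le> min (fps_conv_radius (A j)) (fps_conv_radius (\<Prod>j\<in>F. A j))" using 1 by simp
    also have "\<dots> \<le> fps_conv_radius (A j * (\<Prod>j\<in>F. A j))" by (rule fps_conv_radius_mult)
    finally show ?case
      using insert 1 by (simp add: eval_fps_mult lt)
  qed auto
  then show "fps_conv_radius (\<Prod>j\<in>J. A j) \<ge> 1" by simp
  show "norm z < 1 \<Longrightarrow> eval_fps (\<Prod>j\<in>J. A j) z = (\<Prod>j\<in>J. eval_fps (A j) z)" using * by simp
qed

text \<open>The index fits: a product of \<open>card J\<close> series is measured by
  \<open>wnorm (card J - 1)\<close>, the squared norm for \<open>bergman_disc (card J)\<close>. The
  majorants come from \<open>fps_dominant\<close>, which is where \<open>R > 1\<close>
  enters.\<close>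

lemma disc_product_inequality:
  assumes J: "finite J" "card J \<ge> 2" and p: "\<And>j. j \<in> J \<Longrightarrow> p j > 0"
    and hol: "\<And>j. j \<in> J \<Longrightarrow> f j holomorphic_on ball 0 R" and R: "R > 1"
  shows "(\<integral>\<^sup>+z. ennreal (\<Prod>j\<in>J. norm (f j z) powr p j) * indicator (ball 0 1) z \<partial>bergman_disc (card J))
    \<le> (\<Prod>j\<in>J. circle_mean (p j) (f j))"
proof (cases "\<forall>j\<in>J. \<exists>z\<in>ball 0 1. f j z \<noteq> 0")
  case True
  have "\<forall>j\<in>J. \<exists>A. fps_conv_radius A \<ge> 1 \<and> 
    (\<forall>z. norm z < 1 \<longrightarrow> norm (f j z) powr p j \<le> (norm (eval_fps A z))\<^sup>2) \<and> wnorm 0 A \<le> circle_mean (p j) (f j)"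
  proof
    fix j assume j: "j \<in> J"
    show "\<exists>A. fps_conv_radius A \<ge> 1 \<and> 
      (\<forall>z. norm z < 1 \<longrightarrow> norm (f j z) powr p j \<le> (norm (eval_fps A z))\<^sup>2) \<and> wnorm 0 A \<le> circle_mean (p j) (f j)"
      by (rule fps_dominant[OF hol[OF j] R _ p[OF j]]) (use True j in auto)
  qed
  then obtain A where A: "\<And>j. j \<in> J \<Longrightarrow> fps_conv_radius (A j) \<ge> 1"
    "\<And>j z. j \<in> J \<Longrightarrow> norm z < 1 \<Longrightarrow> norm (f j z) powr p j \<le> (norm (eval_fps (A j) z))\<^sup>2"
    "\<And>j. j \<in> J \<Longrightarrow> wnorm 0 (A j) \<le> circle_mean (p j) (f j)"
    by metis
  have fin: "wnorm 0 (A j) < \<top>" if "j \<in> J" for j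
  proof -
    have "circle_mean (p j) (f j) < \<top>"
      using that R by (intro circle_mean_finite p holomorphic_on_imp_continuous_on holomorphic_on_subset[OF hol]) auto
    then show ?thesis using A(3)[OF that] by (rule le_less_trans[rotated])
  qed
  obtain s where s: "card J = Suc s" using J(2) by (cases "card J") auto
  have "(\<integral>\<^sup>+z. ennreal (\<Prod>j\<in>J. norm (f j z) powr p j) * indicator (ball 0 1) z \<partial>bergman_disc (card J))
      \<le> (\<integral>\<^sup>+z. ennreal ((norm (eval_fps (\<Prod>j\<in>J. A j) z))\<^sup>2) * indicator (ball 0 1) z \<partial>bergman_disc (card J))"
  proof (rule nn_integral_mono)
    fix z :: complex
    show "ennreal (\<Prod>j\<in>J. norm (f j z) powr p j) * indicator (ball 0 1) z
       \<le> ennreal ((norm (eval_fps (\<Prod>j\<in>J. A j) z))\<^sup>2) * indicator (ball 0 1) z"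
    proof (cases "norm z < 1")
      case True
      have "(\<Prod>j\<in>J. norm (f j z) powr p j) \<le> (\<Prod>j\<in>J. (norm (eval_fps (A j) z))\<^sup>2)"
        using True by (intro prod_mono) (auto intro: A(2))
      also have "\<dots> = (norm (eval_fps (\<Prod>j\<in>J. A j) z))\<^sup>2"
        using True by (simp add: eval_fps_prod(2)[OF A(1)] prod_norm flip: prod_power_distrib)
      finally show ?thesis using True by (simp add: ennreal_leI)
    qed simp
  qed
  also have "\<dots> = wnorm (card J - 1) (\<Prod>j\<in>J. A j)"
    by (intro nn_integral_bergman_disc_fps J(2) eval_fps_prod(1) A(1))
  also have "\<dots> \<le> (\<Prod>j\<in>J. wnorm 0 (A j))"
    using s by (simp add: wnorm_prod_le[OF J(1) s fin])
  also have "\<dots> \<le> (\<Prod>j\<in>J. circle_mean (p j) (f j))"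
    by (intro prod_mono_ennreal A(3))
  finally show ?thesis .
next
  case False
  then obtain j where j: "j \<in> J" "\<And>z. z \<in> ball 0 1 \<Longrightarrow> f j z = 0" by auto
  have eq0: "ennreal (\<Prod>j\<in>J. norm (f j z) powr p j) * indicator (ball 0 1) z = 0" for z
  proof (cases "norm z < 1")
    case True
    have "(\<Prod>j\<in>J. norm (f j z) powr p j) = 0"
      by (rule prod_zero[OF J(1)]) (use j True in \<open>auto intro!: bexI[of _ j]\<close>)
    then show ?thesis by simp
  qed simp
  show ?thesis unfolding eq0 by simp
qed

section \<open>The equality case in one variable\<close>

lemma norm_eval_fps_le:
  assumes A: "fps_conv_radius A \<ge> 1" and C: "wnorm 0 A \<le> ennreal C" "C \<ge> 0" and z: "norm z \<le> s" "s < 1"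
  shows "norm (eval_fps A z) \<le> sqrt C / (1 - s)"
proof -
  have s: "0 \<le> s" using z norm_ge_zero order_trans by blast
  have c: "norm (A $ k) \<le> sqrt C" for k
  proof -
    have "ennreal ((norm (A $ k))\<^sup>2) \<le> (\<Sum>k. ennreal ((norm (A $ k))\<^sup>2))" by (rule le_suminf_ennreal)
    also have "\<dots> = wnorm 0 A" by (simp add: wnorm_def)
    also note C(1)
    finally have "(norm (A $ k))\<^sup>2 \<le> C" using C(2) by simp
    then show ?thesis by (rule real_le_rsqrt)
  qed
  have sm: "summable (\<lambda>k. sqrt C * s ^ k)" using s z by (intro summable_mult summable_geometric) auto
  have le: "norm (A $ k * z ^ k) \<le> sqrt C * s ^ k" for k
    unfolding norm_mult norm_power using c z s by (intro mult_mono power_mono) (auto simp: C(2))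
  have "norm (eval_fps A z) \<le> (\<Sum>k. sqrt C * s ^ k)"
    unfolding eval_fps_def by (rule norm_suminf_le[OF le sm])
  also have "\<dots> = sqrt C / (1 - s)"
    using s z by (subst suminf_mult) (auto simp: suminf_geometric)
  finally show ?thesis .
qed

text \<open>On the open disc \<open>f\<close> may have infinitely many zeros, so a finite Blaschke
  product is not enough. The majorants of the dilations \<open>f (t n * z)\<close> share the bound
  \<open>C\<close> and hence form a normal family; Hurwitz keeps a limit zero-free, and Fatou keeps
  its norm below \<open>C\<close>.\<close>

lemma fps_dominant_bounded_means:
  assumes hol: "f holomorphic_on ball 0 1" and p: "p > 0" and z0: "norm z0 < 1" "f z0 \<noteq> 0"
    and C: "\<And>n. circle_mean p (\<lambda>\<zeta>. f (of_real (radius_seq n) * \<zeta>)) \<le> ennreal C" "C \<ge> 0"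
  obtains A where "fps_conv_radius A \<ge> 1" "\<And>z. norm z < 1 \<Longrightarrow> eval_fps A z \<noteq> 0"
    "\<And>z. norm z < 1 \<Longrightarrow> norm (f z) powr p \<le> (norm (eval_fps A z))\<^sup>2"
    "wnorm 0 A \<le> ennreal C"
proof -
  obtain n0 where n0: "norm z0 < radius_seq n0"
    using order_tendstoD(1)[OF radius_seq(3) z0(1)] by (auto simp: eventually_sequentially)
  \<comment> \<open>Starting at \<open>n0\<close> puts \<open>z0 / t n\<close> into the disc, so no
    dilation vanishes identically.\<close>
  define t where "t n = radius_seq (n + n0)" for n
  have t: "0 < t n" "t n < 1" "norm z0 < t n" for n
    using radius_seq(1,2)[of "n + n0"] radius_seq(4)[of n0 "n + n0"] n0 by (auto simp: t_def)
  have tlim: "t \<longlonglongrightarrow> 1" unfolding t_def using radius_seq(3) by (rule LIMSEQ_ignore_initial_segment)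
  have "\<exists>A. fps_conv_radius A \<ge> 1 \<and> (\<forall>z. norm z < 1 \<longrightarrow> eval_fps A z \<noteq> 0) \<and> 
      (\<forall>z. norm z < 1 \<longrightarrow> norm (f (of_real (t n) * z)) powr p \<le> (norm (eval_fps A z))\<^sup>2) \<and> wnorm 0 A \<le> ennreal C" for n
  proof -
    have "(\<lambda>z. f (of_real (t n) * z)) holomorphic_on ball 0 (1 / t n)"
      by (rule holomorphic_on_compose_gen[OF _ hol, unfolded o_def])
         (use t in \<open>auto intro!: holomorphic_intros simp: norm_mult field_simps abs_of_pos[OF t(1)]\<close>)
    moreover have "1 / t n > 1" using t by simp
    moreover have "\<exists>z\<in>ball 0 1. f (of_real (t n) * z) \<noteq> 0"
      using z0 t[of n] by (intro bexI[of _ "z0 / of_real (t n)"]) (auto simp: norm_divide)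
    ultimately obtain A where A: "fps_conv_radius A \<ge> 1" "\<And>z. norm z < 1 \<Longrightarrow> eval_fps A z \<noteq> 0"
      "\<And>z. norm z < 1 \<Longrightarrow> norm (f (of_real (t n) * z)) powr p \<le> (norm (eval_fps A z))\<^sup>2"
      "wnorm 0 A \<le> circle_mean p (\<lambda>z. f (of_real (t n) * z))"
      using fps_dominant[of "\<lambda>z. f (of_real (t n) * z)" "1 / t n" p] p by metis
    then show ?thesis using C(1)[of "n + n0"] by (intro exI[of _ A]) (auto simp: t_def intro: order_trans)
  qed
  then obtain A where A: "\<And>n. fps_conv_radius (A n) \<ge> 1" "\<And>n z. norm z < 1 \<Longrightarrow> eval_fps (A n) z \<noteq> 0"
    "\<And>n z. norm z < 1 \<Longrightarrow> norm (f (of_real (t n) * z)) powr p \<le> (norm (eval_fps (A n) z))\<^sup>2"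
    "\<And>n. wnorm 0 (A n) \<le> ennreal C"
    by metis
  have holA: "eval_fps (A n) holomorphic_on ball 0 1" for n
  proof (rule holomorphic_on_eval_fps)
    show "ball (0::complex) 1 \<subseteq> eball 0 (fps_conv_radius (A n))"
    proof
      fix x :: complex assume "x \<in> ball 0 1"
      then have "ereal (norm x) < 1" by (simp add: one_ereal_def)
      also note A(1)[of n]
      finally show "x \<in> eball 0 (fps_conv_radius (A n))" by (simp add: in_eball_iff)
    qed
  qed
  obtain g r where g: "g holomorphic_on ball 0 1" "strict_mono (r :: nat \<Rightarrow> nat)"
    "\<And>x. x \<in> ball 0 1 \<Longrightarrow> (\<lambda>n. eval_fps (A (r n)) x) \<longlonglongrightarrow> g x"
    "\<And>K. compact K \<Longrightarrow> K \<subseteq> ball 0 1 \<Longrightarrow> uniform_limit K ((\<lambda>n. eval_fps (A n)) \<circ> r) g sequentially"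
  proof (rule Montel[of "ball 0 1" "range (\<lambda>n. eval_fps (A n))" "\<lambda>n. eval_fps (A n)"])
    \<comment> \<open>\<open>K\<close> lies in a closed disc of radius \<open>norm z1 < 1\<close>,
      on which \<open>norm_eval_fps_le\<close> bounds all majorants in terms of
      \<open>C\<close>.\<close>
    fix K :: "complex set" assume K: "compact K" "K \<subseteq> ball 0 1"
    show "\<exists>B. \<forall>h\<in>range (\<lambda>n. eval_fps (A n)). \<forall>z\<in>K. norm (h z) \<le> B"
    proof (cases "K = {}")
      case False
      obtain z1 where z1: "z1 \<in> K" "\<And>z. z \<in> K \<Longrightarrow> norm z \<le> norm z1"
        using continuous_attains_sup[OF K(1) False, of norm] by (auto intro: continuous_intros)
      have "norm z1 < 1" using z1 K by auto
      then show ?thesis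
        using norm_eval_fps_le[OF A(1) A(4) C(2) z1(2)] by blast
    qed auto
  qed (use holA in auto)
  have lim_r: "(\<lambda>n. t (r n)) \<longlonglongrightarrow> 1"
    using LIMSEQ_subseq_LIMSEQ[OF tlim g(2)] by (simp add: o_def)
  have dom: "norm (f z) powr p \<le> (norm (g z))\<^sup>2" if z: "norm z < 1" for z
  proof (rule LIMSEQ_le)
    have "(\<lambda>n. of_real (t (r n)) * z) \<longlonglongrightarrow> z"
      using tendsto_mult[OF tendsto_of_real[OF lim_r] tendsto_const[of z]] by simp
    then show "(\<lambda>n. norm (f (of_real (t (r n)) * z)) powr p) \<longlonglongrightarrow> norm (f z) powr p"
    proof (rule continuous_on_tendsto_compose[OF continuous_on_norm_powr[OF holomorphic_on_imp_continuous_on[OF hol] p]])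
      show "\<forall>\<^sub>F n in sequentially. of_real (t (r n)) * z \<in> ball 0 1"
      proof (rule always_eventually, rule allI)
        fix n
        have "t (r n) * norm z \<le> 1 * norm z" using t[of "r n"] by (intro mult_right_mono) auto
        then show "of_real (t (r n)) * z \<in> ball 0 1" using z t[of "r n"] by (simp add: norm_mult)
      qed
    qed (use z in auto)
    show "(\<lambda>n. (norm (eval_fps (A (r n)) z))\<^sup>2) \<longlonglongrightarrow> (norm (g z))\<^sup>2"
      using z by (intro tendsto_intros g(3)) auto
    show "\<exists>N. \<forall>n\<ge>N. norm (f (of_real (t (r n)) * z)) powr p \<le> (norm (eval_fps (A (r n)) z))\<^sup>2"
      using A(3)[OF z] by auto
  qed
  \<comment> \<open>Hurwitz covers nonconstant limits; a constant limit is nonzero because the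
    domination holds at \<open>z0\<close>.\<close>
  have "g z0 \<noteq> 0" using dom[OF z0(1)] z0(2) by auto
  have gnz: "g z \<noteq> 0" if z: "norm z < 1" for z
  proof (cases "g constant_on ball 0 1")
    case True
    then show ?thesis using \<open>g z0 \<noteq> 0\<close> z z0 by (auto simp: constant_on_def)
  next
    case False
    show ?thesis
      by (rule Hurwitz_no_zeros[of "ball 0 1" "(\<lambda>n. eval_fps (A n)) \<circ> r" g])
         (use g False z A(2) holA in \<open>auto simp: o_def\<close>)
  qed
  define B where "B = fps_expansion g 0"
  have B: "fps_conv_radius B \<ge> 1" "\<And>z. norm z < 1 \<Longrightarrow> eval_fps B z = g z"
    unfolding B_def by (auto intro: holomorphic_fps[OF g(1)])
  have "wnorm 0 B \<le> ennreal C"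
  proof (rule wnorm_le_lim[OF B(1)])
    fix n
    have rn: "norm (of_real (radius_seq n) * \<zeta>) < 1" if "norm \<zeta> = 1" for \<zeta> :: complex
      using radius_seq(1,2)[of n] that by (simp add: norm_mult)
    \<comment> \<open>On a fixed interior circle the majorants converge pointwise, so Fatou bounds
      the mean of the limit by theirs.\<close>
    have "circle_mean 2 (\<lambda>\<zeta>. eval_fps B (of_real (radius_seq n) * \<zeta>))
      = (\<integral>\<^sup>+\<zeta>. liminf (\<lambda>k. ennreal (norm (eval_fps (A (r k)) (of_real (radius_seq n) * \<zeta>)) powr 2) * indicator (sphere 0 1) \<zeta>) \<partial>circle_haar)"
      unfolding circle_mean_def
    proof (rule nn_integral_cong)
      fix \<zeta> :: complex
      show "ennreal (norm (eval_fps B (of_real (radius_seq n) * \<zeta>)) powr 2) * indicator (sphere 0 1) \<zeta>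
        = liminf (\<lambda>k. ennreal (norm (eval_fps (A (r k)) (of_real (radius_seq n) * \<zeta>)) powr 2) * indicator (sphere 0 1) \<zeta>)"
      proof (cases "norm \<zeta> = 1")
        case True
        have l: "(\<lambda>k. ennreal ((norm (eval_fps (A (r k)) (of_real (radius_seq n) * \<zeta>)))\<^sup>2)) \<longlonglongrightarrow> ennreal ((norm (g (of_real (radius_seq n) * \<zeta>)))\<^sup>2)"
          using rn[OF True] by (intro tendsto_intros g(3)) auto
        then show ?thesis
          using True rn[OF True] lim_imp_Liminf[OF trivial_limit_sequentially l] by (simp add: B(2))
      qed (simp add: Liminf_const)
    qed
    also have "\<dots> \<le> liminf (\<lambda>k. circle_mean 2 (\<lambda>\<zeta>. eval_fps (A (r k)) (of_real (radius_seq n) * \<zeta>)))"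
      unfolding circle_mean_def
    proof (rule nn_integral_liminf)
      fix k
      show "(\<lambda>\<zeta>. ennreal (norm (eval_fps (A (r k)) (of_real (radius_seq n) * \<zeta>)) powr 2) * indicator (sphere 0 1) \<zeta>) \<in> borel_measurable circle_haar"
        unfolding borel_measurable_circle_haar
        by (intro circle_mean_measurable continuous_on_compose2[OF holomorphic_on_imp_continuous_on[OF holA]] continuous_intros)
           (auto intro: rn)
    qed
    also have "\<dots> \<le> ennreal C"
    proof (rule Liminf_le)
      show "\<forall>\<^sub>F k in sequentially. circle_mean 2 (\<lambda>\<zeta>. eval_fps (A (r k)) (of_real (radius_seq n) * \<zeta>)) \<le> ennreal C"
      proof (rule always_eventually, rule allI)
        fix k
        have "circle_mean 2 (\<lambda>\<zeta>. eval_fps (A (r k)) (of_real (radius_seq n) * \<zeta>)) = (\<Sum>i. ennreal ((norm (A (r k) $ i))\<^sup>2 * radius_seq n ^ (2 * i)))"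
          by (rule circle_mean_eval_fps[OF A(1)]) (use radius_seq(1,2)[of n] in auto)
        also have "\<dots> \<le> (\<Sum>i. ennreal ((norm (A (r k) $ i))\<^sup>2))"
          using radius_seq(1,2)[of n] by (intro suminf_le ennreal_leI mult_right_le_one_le power_le_one) auto
        also have "\<dots> = wnorm 0 (A (r k))" by (simp add: wnorm_def)
        also note A(4)
        finally show "circle_mean 2 (\<lambda>\<zeta>. eval_fps (A (r k)) (of_real (radius_seq n) * \<zeta>)) \<le> ennreal C" .
      qed
    qed simp
    finally show "circle_mean 2 (\<lambda>\<zeta>. eval_fps B (of_real (radius_seq n) * \<zeta>)) \<le> ennreal C" .
  qed simp
  then show ?thesis using that[of B] B gnz dom by simp
qed

text \<open>The density is positive throughout the disc. Applied to the set where two continuous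
  functions differ, this turns equality almost everywhere into equality.\<close>

lemma open_subset_AE_bergman_disc:
  assumes m: "m \<ge> 2" and S: "open S" "S \<subseteq> ball 0 1" and AE: "AE z in bergman_disc m. z \<notin> S"
  shows "S = {}"
proof (rule ccontr)
  assume "S \<noteq> {}"
  have "AE z in lborel. 0 < ennreal (indicator (ball 0 1) z * ((real m - 1) / pi * (1 - (norm z)\<^sup>2) ^ (m - 2))) \<longrightarrow> z \<notin> S"
    using AE unfolding bergman_disc_def by (subst (asm) AE_density) measurable
  then have "AE z in lborel. z \<notin> S"
  proof eventually_elim
    case (elim z)
    show ?case
    proof
      assume z: "z \<in> S"
      then have "norm z < 1" using S by auto
      then have "(norm z)\<^sup>2 < 1" by (simp add: power_less_one_iff abs_square_less_1)
      then have "0 < (real m - 1) / pi * (1 - (norm z)\<^sup>2) ^ (m - 2)"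
        using m by (intro mult_pos_pos divide_pos_pos zero_less_power) auto
      then show False using elim z \<open>norm z < 1\<close> by simp
    qed
  qed
  then have "S \<in> null_sets lborel"
    using S by (subst AE_iff_null_sets) auto
  then have "negligible S"
    by (rule negligible_iff_null_sets[THEN iffD2, OF null_sets_completionI])
  then show False using open_not_negligible[OF S(1) \<open>S \<noteq> {}\<close>] by simp
qed

lemma tendsto_prod_ennreal:
  fixes f :: "'a \<Rightarrow> nat \<Rightarrow> ennreal"
  assumes "\<And>j. j \<in> J \<Longrightarrow> f j \<longlonglongrightarrow> L j" "\<And>j. j \<in> J \<Longrightarrow> L j < \<top>"
  shows "(\<lambda>n. \<Prod>j\<in>J. f j n) \<longlonglongrightarrow> (\<Prod>j\<in>J. L j)"
  using assms
proof (induction J rule: infinite_finite_induct)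
  case (insert j F)
  have "(\<Prod>j\<in>F. L j) < \<top>" using insert by (intro ennreal_prod_less_top) auto
  moreover have "L j < \<top>" using insert by simp
  ultimately have "\<not> (L j = 0 \<and> (\<Prod>j\<in>F. L j) = \<infinity> \<or> L j = \<infinity> \<and> (\<Prod>j\<in>F. L j) = 0)"
    by (auto simp: infinity_ennreal_def)
  then show ?case using insert by (simp add: tendsto_mult_ennreal)
qed auto

lemma prod_eq_imp_eq:
  fixes x y :: "'a \<Rightarrow> real"
  assumes J: "finite J" "j \<in> J" and le: "\<And>i. i \<in> J \<Longrightarrow> 0 \<le> x i \<and> x i \<le> y i \<and> 0 < y i"
    and eq: "(\<Prod>i\<in>J. x i) = (\<Prod>i\<in>J. y i)"
  shows "x j = y j"
proof (rule ccontr)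
  assume "x j \<noteq> y j"
  then have lt: "x j < y j" using le[OF J(2)] by linarith
  have pos: "0 < (\<Prod>i\<in>J - {j}. y i)" using le by (intro prod_pos) auto
  have "(\<Prod>i\<in>J. x i) = x j * (\<Prod>i\<in>J - {j}. x i)" using J by (simp add: prod.remove)
  also have "\<dots> \<le> x j * (\<Prod>i\<in>J - {j}. y i)"
    using le J by (intro mult_left_mono prod_mono) auto
  also have "\<dots> < y j * (\<Prod>i\<in>J - {j}. y i)" using lt pos by (rule mult_strict_right_mono)
  also have "\<dots> = (\<Prod>i\<in>J. y i)" using J by (simp add: prod.remove)
  finally show False using eq by simp
qed

lemma norm_const_imp_const:
  assumes "f holomorphic_on ball 0 1" "\<And>z. norm z < 1 \<Longrightarrow> norm (f z) = c" "norm z < 1"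
  shows "f z = f 0"
proof -
  have "f constant_on ball 0 1"
    by (rule maximum_modulus_principle[OF assms(1), of "ball 0 1" 0]) (use assms(2) in auto)
  then show ?thesis using assms(3) unfolding constant_on_def by force
qed

text \<open>The constant coefficient of a zero-free majorant is nonzero, and its square bounds the
  mean from below, even if \<open>f 0 = 0\<close>.\<close>

lemma circle_mean_pos:
  assumes hol: "f holomorphic_on ball 0 1" and p: "p > 0" and r: "0 < r" "r < 1"
    and z0: "norm z0 < r" "f z0 \<noteq> 0"
  shows "0 < circle_mean p (\<lambda>\<zeta>. f (of_real r * \<zeta>))"
proof -
  have "(\<lambda>z. f (of_real r * z)) holomorphic_on ball 0 (1 / r)"
    by (rule holomorphic_on_compose_gen[OF _ hol, unfolded o_def])
       (use r in \<open>auto intro!: holomorphic_intros simp: norm_mult field_simps\<close>)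
  moreover have "1 / r > 1" using r by simp
  moreover have "\<exists>z\<in>ball 0 1. f (of_real r * z) \<noteq> 0"
    using z0 r by (intro bexI[of _ "z0 / of_real r"]) (auto simp: norm_divide)
  ultimately obtain A where A: "fps_conv_radius A \<ge> 1" "\<And>z. norm z < 1 \<Longrightarrow> eval_fps A z \<noteq> 0"
    "wnorm 0 A \<le> circle_mean p (\<lambda>z. f (of_real r * z))"
    using fps_dominant[of "\<lambda>z. f (of_real r * z)" "1 / r" p] p by metis
  have "A $ 0 \<noteq> 0" using A(2)[of 0] by (simp add: eval_fps_at_0)
  then have "0 < ennreal ((norm (A $ 0))\<^sup>2)" by simp
  also have "\<dots> \<le> wnorm 0 A" by (rule wnorm_ge_0)
  also note A(3)
  finally show ?thesis .
qed

text \<open>Square summability of a nonzero geometric sequence forces the ratio into the open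
  disc.\<close>

lemma geometric_fps:
  assumes A: "fps_conv_radius A \<ge> 1" and geo: "\<And>k. A $ k = A $ 0 * q ^ k" and nz: "A $ 0 \<noteq> 0"
    and fin: "wnorm 0 A < \<top>"
  shows "norm q < 1" and "norm z < 1 \<Longrightarrow> eval_fps A z = A $ 0 / (1 - q * z)"
proof -
  have "summable (\<lambda>k. (norm (A $ k))\<^sup>2)"
    using wnorm_real(1)[OF fin] by simp
  then have "summable (\<lambda>k. (norm (A $ 0))\<^sup>2 * ((norm q)\<^sup>2) ^ k)"
    by (subst (asm) geo) (simp add: norm_mult norm_power power_mult_distrib flip: power_mult add: mult.commute)
  then have "summable (\<lambda>k. ((norm q)\<^sup>2) ^ k)"
    using nz by simp
  then have "(norm q)\<^sup>2 < 1" by simp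
  then show q: "norm q < 1" by (simp add: abs_square_less_1)
  show "eval_fps A z = A $ 0 / (1 - q * z)" if z: "norm z < 1"
  proof -
    have "norm (q * z) < 1"
      using q z mult_strict_mono'[of "norm q" 1 "norm z" 1] by (simp add: norm_mult)
    have "eval_fps A z = (\<Sum>k. A $ 0 * (q * z) ^ k)"
      unfolding eval_fps_def by (subst geo) (simp add: power_mult_distrib mult.assoc)
    also have "\<dots> = A $ 0 / (1 - q * z)"
      using \<open>norm (q * z) < 1\<close> by (subst suminf_mult) (auto simp: suminf_geometric)
    finally show ?thesis .
  qed
qed

text \<open>The integral \<open>I\<close>, the norm of the product of the majorants, the product of
  their norms and the product of the limits \<open>C j\<close> bound one another cyclically, so all
  are equal. Equality of the norms makes the majorants geometric with one ratio; equality of the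
  integrals makes \<open>norm (f j z) powr p j\<close> equal to its majorant. The hypothesis
  \<open>le\<close> is imposed at each radius because this is what slices provide.\<close>

theorem disc_product_equality:
  assumes J: "finite J" "card J \<ge> 2" and p: "\<And>j. j \<in> J \<Longrightarrow> p j > 0"
    and hol: "\<And>j. j \<in> J \<Longrightarrow> f j holomorphic_on ball 0 1"
    and nz: "\<And>j. j \<in> J \<Longrightarrow> \<exists>z\<in>ball 0 1. f j z \<noteq> 0"
  defines "I \<equiv> (\<integral>\<^sup>+z. ennreal (\<Prod>j\<in>J. norm (f j z) powr p j) * indicator (ball 0 1) z \<partial>bergman_disc (card J))"
  assumes fin: "I < \<top>"
    and le: "\<And>n. (\<Prod>j\<in>J. circle_mean (p j) (\<lambda>\<zeta>. f j (of_real (radius_seq n) * \<zeta>))) \<le> I"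
  obtains q where "norm q < 1"
    "\<And>j z. j \<in> J \<Longrightarrow> norm z < 1 \<Longrightarrow> f j z = f j 0 * (1 - q * z) powr (- of_real (2 / p j))"
proof -
  define c where "c j n = circle_mean (p j) (\<lambda>\<zeta>. f j (of_real (radius_seq n) * \<zeta>))" for j n
  have mono: "c j m \<le> c j n" if "j \<in> J" "m \<le> n" for j m n
    unfolding c_def using radius_seq(1,2)[of n] radius_seq(1,2)[of m] radius_seq(4)[OF that(2)] that
    by (intro circle_mean_mono_radius hol p) auto
  have cfin: "c j n < \<top>" if "j \<in> J" for j n
    unfolding c_def using radius_seq(1,2)[of n]
    by (intro circle_mean_finite p[OF that] continuous_on_compose2[OF holomorphic_on_imp_continuous_on[OF hol[OF that]]] continuous_intros)
       (auto simp: norm_mult)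
  obtain z0 where z0: "\<And>j. j \<in> J \<Longrightarrow> norm (z0 j) < 1 \<and> f j (z0 j) \<noteq> 0"
    using nz by (metis mem_ball_0)
  have "\<forall>j\<in>J. \<forall>\<^sub>F n in sequentially. norm (z0 j) < radius_seq n"
    using order_tendstoD(1)[OF radius_seq(3)] z0 by auto
  then have "\<forall>\<^sub>F n in sequentially. \<forall>j\<in>J. norm (z0 j) < radius_seq n"
    using J(1) by (simp add: eventually_ball_finite_distrib)
  then obtain n0 where n0: "\<And>j. j \<in> J \<Longrightarrow> norm (z0 j) < radius_seq n0"
    by (auto simp: eventually_sequentially)
  have pos: "0 < c j n0" if "j \<in> J" for j
    unfolding c_def using radius_seq(1,2)[of n0] n0[OF that] z0[OF that]
    by (intro circle_mean_pos[OF hol[OF that] p[OF that] _ _ n0[OF that]]) auto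
  define C where "C j = (SUP n. c j n)" for j
  have lim: "c j \<longlonglongrightarrow> C j" if "j \<in> J" for j
    unfolding C_def by (rule LIMSEQ_SUP) (auto simp: incseq_def mono[OF that])
  have Cfin: "C j < \<top>" if j: "j \<in> J" for j
  proof -
    \<comment> \<open>The other means at index \<open>n0\<close> are positive and finite, so
      dividing by their product bounds the mean of \<open>j\<close> alone by \<open>I / k\<close>,
      at every radius.\<close>
    define k where "k = (\<Prod>i\<in>J - {j}. c i n0)"
    have "c i n0 \<noteq> 0" if "i \<in> J" for i using pos[OF that] by simp
    then have k: "k \<noteq> 0" unfolding k_def using J(1) by simp
    have k': "k < \<top>" unfolding k_def by (intro ennreal_prod_less_top cfin) auto
    have "c j n \<le> I / k" for n
    proof -
      have "c j n \<le> c j (max n n0)" using j by (intro mono) auto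
      also have "\<dots> \<le> I / k"
      proof -
        have "c j (max n n0) * k \<le> c j (max n n0) * (\<Prod>i\<in>J - {j}. c i (max n n0))"
          unfolding k_def by (intro mult_left_mono prod_mono_ennreal mono) auto
        also have "\<dots> = (\<Prod>i\<in>J. c i (max n n0))" using J(1) j by (simp add: prod.remove)
        also have "\<dots> \<le> I" unfolding c_def by (rule le)
        finally have "c j (max n n0) * k / k \<le> I / k" by (rule divide_right_mono_ennreal)
        moreover have "c j (max n n0) * k / k = c j (max n n0)"
          using k k' by (simp add: ennreal_times_divide[symmetric] ennreal_divide_self less_top)
        ultimately show ?thesis by simp
      qed
      finally show ?thesis .
    qed
    then have "C j \<le> I / k" unfolding C_def by (intro SUP_least)
    also have "\<dots> < \<top>" using fin k k' by (simp add: ennreal_divide_eq_top_iff less_top[symmetric])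
    finally show ?thesis .
  qed
  have prodC: "(\<Prod>j\<in>J. C j) \<le> I"
    by (rule LIMSEQ_le_const2[OF tendsto_prod_ennreal[OF lim Cfin]]) (use le in \<open>auto simp: c_def\<close>)
  have "\<forall>j\<in>J. \<exists>A. fps_conv_radius A \<ge> 1 \<and> (\<forall>z. norm z < 1 \<longrightarrow> eval_fps A z \<noteq> 0) \<and>
    (\<forall>z. norm z < 1 \<longrightarrow> norm (f j z) powr p j \<le> (norm (eval_fps A z))\<^sup>2) \<and> wnorm 0 A \<le> C j"
  proof
    fix j assume j: "j \<in> J"
    obtain K where K: "C j = ennreal K" "K \<ge> 0" using Cfin[OF j] by (cases "C j") auto
    have "circle_mean (p j) (\<lambda>\<zeta>. f j (of_real (radius_seq n) * \<zeta>)) \<le> ennreal K" for n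
      unfolding K(1)[symmetric] C_def c_def by (rule SUP_upper2[of n]) auto
    then obtain A where "fps_conv_radius A \<ge> 1" "\<And>z. norm z < 1 \<Longrightarrow> eval_fps A z \<noteq> 0"
      "\<And>z. norm z < 1 \<Longrightarrow> norm (f j z) powr p j \<le> (norm (eval_fps A z))\<^sup>2"
      "wnorm 0 A \<le> ennreal K"
      using fps_dominant_bounded_means[OF hol[OF j] p[OF j], of "z0 j" K] z0[OF j] K(2) by metis
    then show "\<exists>A. fps_conv_radius A \<ge> 1 \<and> (\<forall>z. norm z < 1 \<longrightarrow> eval_fps A z \<noteq> 0) \<and>
      (\<forall>z. norm z < 1 \<longrightarrow> norm (f j z) powr p j \<le> (norm (eval_fps A z))\<^sup>2) \<and> wnorm 0 A \<le> C j"
      using K by auto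
  qed
  then obtain A where A: "\<And>j. j \<in> J \<Longrightarrow> fps_conv_radius (A j) \<ge> 1"
    "\<And>j z. j \<in> J \<Longrightarrow> norm z < 1 \<Longrightarrow> eval_fps (A j) z \<noteq> 0"
    "\<And>j z. j \<in> J \<Longrightarrow> norm z < 1 \<Longrightarrow> norm (f j z) powr p j \<le> (norm (eval_fps (A j) z))\<^sup>2"
    "\<And>j. j \<in> J \<Longrightarrow> wnorm 0 (A j) \<le> C j"
    by metis
  have Afin: "wnorm 0 (A j) < \<top>" if "j \<in> J" for j
    using A(4)[OF that] Cfin[OF that] by (rule le_less_trans)
  have A0: "A j $ 0 \<noteq> 0" if "j \<in> J" for j
    using A(2)[OF that, of 0] by (simp add: eval_fps_at_0)
  obtain s where s: "card J = Suc s" "s \<ge> 1" using J(2) by (cases "card J") auto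
  define u where "u z = (\<Prod>j\<in>J. norm (f j z) powr p j)" for z
  define v where "v z = (norm (eval_fps (\<Prod>j\<in>J. A j) z))\<^sup>2" for z
  have v: "v z = (\<Prod>j\<in>J. (norm (eval_fps (A j) z))\<^sup>2)" if "norm z < 1" for z
    using that by (simp add: v_def eval_fps_prod(2)[OF A(1)] prod_norm flip: prod_power_distrib)
  have uv: "u z \<le> v z" if "norm z < 1" for z
    unfolding u_def v[OF that] using that by (intro prod_mono) (auto intro: A(3))
  let ?M = "bergman_disc (card J)"
  have Iv: "(\<integral>\<^sup>+z. ennreal (v z) * indicator (ball 0 1) z \<partial>?M) = wnorm s (\<Prod>j\<in>J. A j)"
    unfolding v_def using nn_integral_bergman_disc_fps[OF J(2) eval_fps_prod(1)[of J A, OF A(1)]] s by simp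
  have Iu: "I = (\<integral>\<^sup>+z. ennreal (u z) * indicator (ball 0 1) z \<partial>?M)"
    by (simp add: I_def u_def)
  have w0: "I \<le> wnorm s (\<Prod>j\<in>J. A j)"
    unfolding Iv[symmetric] Iu by (intro nn_integral_mono) (auto split: split_indicator intro: ennreal_leI uv)
  have w1: "wnorm s (\<Prod>j\<in>J. A j) \<le> (\<Prod>j\<in>J. wnorm 0 (A j))"
    by (rule wnorm_prod_le[OF J(1) s(1) Afin])
  have w2: "(\<Prod>j\<in>J. wnorm 0 (A j)) \<le> I"
    using prod_mono_ennreal[of J "\<lambda>j. wnorm 0 (A j)" C, OF A(4)] prodC by (rule order_trans)
  have w3: "wnorm s (\<Prod>j\<in>J. A j) \<le> I" using w1 w2 by (rule order_trans)
  have w4: "(\<Prod>j\<in>J. wnorm 0 (A j)) \<le> wnorm s (\<Prod>j\<in>J. A j)" using w2 w0 by (rule order_trans)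
  obtain q where q: "\<And>j k. j \<in> J \<Longrightarrow> A j $ k = A j $ 0 * q ^ k"
  proof (rule wnorm_prod_eq_imp_geometric[OF J(1) s Afin A0 w4])
    fix q assume "\<And>j k. j \<in> J \<Longrightarrow> A j $ k = A j $ 0 * q ^ k"
    then show thesis by (rule that)
  qed
  obtain j0 where j0: "j0 \<in> J" using J(2) by (metis card.empty ex_in_conv not_numeral_le_zero)
  have q1: "norm q < 1" by (rule geometric_fps(1)[OF A(1) q A0 Afin]) (use j0 in auto)
  have ev: "eval_fps (A j) z = A j $ 0 / (1 - q * z)" if "j \<in> J" "norm z < 1" for j z
    by (rule geometric_fps(2)[OF A(1) q A0 Afin]) (use that in auto)
  have contu: "continuous_on (ball 0 1) u"
    unfolding u_def by (intro continuous_on_prod continuous_on_norm_powr p holomorphic_on_imp_continuous_on hol)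
  have "continuous_on (ball 0 1) (\<lambda>z. \<Prod>j\<in>J. (norm (A j $ 0 / (1 - q * z)))\<^sup>2)"
  proof (intro continuous_intros ballI)
    fix z :: complex assume "z \<in> ball 0 1"
    then have "norm (q * z) < 1" using q1 mult_strict_mono'[of "norm q" 1 "norm z" 1] by (simp add: norm_mult)
    then show "1 - q * z \<noteq> 0" by auto
  qed
  moreover have "(\<Prod>j\<in>J. (norm (A j $ 0 / (1 - q * z)))\<^sup>2) = v z" if "z \<in> ball 0 1" for z
    unfolding v[OF that[unfolded mem_ball_0]] by (rule prod.cong) (use that in \<open>simp_all add: ev\<close>)
  ultimately have contv: "continuous_on (ball 0 1) v"
    by (rule continuous_on_eq)
  have mu: "(\<lambda>z. ennreal (u z) * indicator (ball 0 1) z) \<in> borel_measurable ?M"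
    "(\<lambda>z. ennreal (v z) * indicator (ball 0 1) z) \<in> borel_measurable ?M"
    using contu contv by (auto intro!: indicator_ennreal_measurable)
  have "AE z in ?M. ennreal (u z) * indicator (ball 0 1) z = ennreal (v z) * indicator (ball 0 1) z"
  proof -
    have "(\<integral>\<^sup>+z. (ennreal (v z) * indicator (ball 0 1) z - ennreal (u z) * indicator (ball 0 1) z) \<partial>?M)
      = (\<integral>\<^sup>+z. ennreal (v z) * indicator (ball 0 1) z \<partial>?M) - (\<integral>\<^sup>+z. ennreal (u z) * indicator (ball 0 1) z \<partial>?M)"
      using fin by (intro nn_integral_diff mu)
        (auto simp: Iu less_top[symmetric] split: split_indicator intro!: AE_I2 ennreal_leI uv)
    also have "\<dots> = 0"
      unfolding Iv Iu[symmetric] by (rule diff_eq_0_ennreal[OF le_less_trans[OF w3 fin] w3])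
    finally have "AE z in ?M. ennreal (v z) * indicator (ball 0 1) z - ennreal (u z) * indicator (ball 0 1) z = 0"
      using mu by (subst (asm) nn_integral_0_iff_AE) auto
    then show ?thesis
      by eventually_elim
        (auto split: split_indicator simp: diff_eq_0_iff_ennreal u_def prod_nonneg intro!: antisym ennreal_leI uv[unfolded u_def])
  qed
  then have "AE z in ?M. z \<notin> {z \<in> ball 0 1. u z < v z}"
    by eventually_elim (auto simp: u_def v_def prod_nonneg)
  moreover have "open {z \<in> ball 0 1. u z < v z}"
    using continuous_on_open_vimage[of "ball 0 1" "\<lambda>z. v z - u z"] contu contv
      open_Collect_less_Int continuous_open_preimage[of "ball 0 1" "\<lambda>z. v z - u z" "{0<..}"]
    by (auto simp: continuous_on_diff vimage_def Int_def)
  ultimately have "{z \<in> ball 0 1. u z < v z} = {}"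
    by (intro open_subset_AE_bergman_disc[OF J(2)]) auto
  then have uv_eq: "u z = v z" if "norm z < 1" for z
    using uv[OF that] that by force
  \<comment> \<open>Two equal products with one dominating the other factor by factor, and positive
    majorants, have equal factors.\<close>
  have fj: "norm (f j z) powr p j = (norm (A j $ 0 / (1 - q * z)))\<^sup>2" if "j \<in> J" "norm z < 1" for j z
    unfolding ev[OF that, symmetric]
    by (rule prod_eq_imp_eq[OF J(1) that(1), where x = "\<lambda>j. norm (f j z) powr p j"])
       (use uv_eq[OF that(2)] that A(2,3) v[OF that(2)] in \<open>auto simp: u_def\<close>)
  show ?thesis
  proof (rule that[OF q1])
    fix j and z :: complex assume j: "j \<in> J" and z: "norm z < 1"
    \<comment> \<open>Multiplying by \<open>P\<close> turns the known modulus of \<open>f j\<close>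
      into a constant; the maximum principle then makes the product itself constant.\<close>
    define P where "P z = (1 - q * z) powr (of_real (2 / p j))" for z
    have qz: "norm (q * z) < 1" if "norm z < 1" for z
      using that q1 mult_strict_mono'[of "norm q" 1 "norm z" 1] by (simp add: norm_mult)
    have nz1: "1 - q * z \<noteq> 0" if "norm z < 1" for z using qz[OF that] by auto
    have holP: "(\<lambda>z. f j z * P z) holomorphic_on ball 0 1"
      unfolding P_def
    proof (intro holomorphic_intros hol[OF j])
      fix z :: complex assume "z \<in> ball 0 1"
      then have "0 < Re (1 - q * z)" using qz[of z] complex_Re_le_cmod[of "q * z"] by auto
      then show "1 - q * z \<notin> \<real>\<^sub>\<le>\<^sub>0" by (auto simp: complex_nonpos_Reals_iff)
    qed
    have "norm (f j z * P z) = norm (A j $ 0) powr (2 / p j)" if z: "norm z < 1" for z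
    proof -
      have "norm (f j z) = (norm (f j z) powr p j) powr (1 / p j)"
        using p[OF j] by (simp add: powr_powr)
      also have "\<dots> = (norm (A j $ 0) / norm (1 - q * z)) powr (2 / p j)"
        unfolding fj[OF j z] using nz1[OF z] A0[OF j]
        by (simp add: norm_divide powr_powr flip: powr_numeral)
      finally show ?thesis
        using nz1[OF z] by (simp add: norm_mult P_def norm_powr_real_powr' powr_divide)
    qed
    from norm_const_imp_const[OF holP this z]
    have "f j z * P z = f j 0" by (simp add: P_def)
    then show "f j z = f j 0 * (1 - q * z) powr (- of_real (2 / p j))"
      using nz1[OF z] by (simp add: P_def powr_minus field_simps)
  qed
qed

section \<open>Kernels in one variable\<close>

definition geom_fps :: "complex \<Rightarrow> complex fps" where
  "geom_fps q = Abs_fps (\<lambda>k. q ^ k)"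

lemma geom_fps_nth [simp]: "geom_fps q $ k = q ^ k"
  by (simp add: geom_fps_def)

lemma eval_geom_fps: "norm (q * z) < 1 \<Longrightarrow> eval_fps (geom_fps q) z = 1 / (1 - q * z)"
  unfolding eval_fps_def by (simp add: power_mult_distrib[symmetric] suminf_geometric)

lemma conv_radius_geom_fps:
  assumes "norm q < 1" shows "fps_conv_radius (geom_fps q) \<ge> 1"
proof -
  have "summable (\<lambda>k. geom_fps q $ k * 1 ^ k)" using assms by (simp add: summable_geometric)
  from conv_radius_geI[OF this] show ?thesis by (simp add: fps_conv_radius_def one_ereal_def)
qed

lemma wnorm_geom_fps_finite:
  assumes "norm q < 1" shows "wnorm 0 (geom_fps q) < \<top>"
proof -
  have "summable (\<lambda>k. ((norm q)\<^sup>2) ^ k)"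
    using assms by (intro summable_geometric) (simp add: abs_square_less_1)
  then have "summable (\<lambda>k. (norm (geom_fps q $ k))\<^sup>2)"
    by (simp add: norm_power flip: power_mult add: mult.commute)
  then have "(\<Sum>k. ennreal ((norm (geom_fps q $ k))\<^sup>2)) = ennreal (\<Sum>k. (norm (geom_fps q $ k))\<^sup>2)"
    by (intro suminf_ennreal2) auto
  moreover have "wnorm 0 (geom_fps q) = (\<Sum>k. ennreal ((norm (geom_fps q $ k))\<^sup>2))"
    unfolding wnorm_def by (intro suminf_cong) simp
  ultimately show ?thesis by (simp only: ennreal_less_top)
qed

lemma wnorm_geom_fps_mono:
  assumes "norm q \<le> norm q'" shows "wnorm 0 (geom_fps q) \<le> wnorm 0 (geom_fps q')"
  unfolding wnorm_def
  using assms by (intro suminf_le ennreal_leI divide_right_mono power_mono) (auto simp: norm_power intro: power_mono)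

lemma nn_integral_circle_kernel:
  assumes "norm q < 1"
  shows "(\<integral>\<^sup>+\<zeta>. ennreal (1 / (norm (1 - q * \<zeta>))\<^sup>2) * indicator (sphere 0 1) \<zeta> \<partial>circle_haar) = wnorm 0 (geom_fps q)"
proof -
  have "(\<integral>\<^sup>+\<zeta>. ennreal (1 / (norm (1 - q * \<zeta>))\<^sup>2) * indicator (sphere 0 1) \<zeta> \<partial>circle_haar)
    = (\<integral>\<^sup>+\<zeta>. ennreal ((norm (\<Sum>k. q ^ k * \<zeta> ^ k))\<^sup>2) \<partial>circle_haar)"
  proof (rule nn_integral_cong_AE, rule eventually_mono[OF AE_circle_haar])
    fix \<zeta> :: complex assume z: "norm \<zeta> = 1"
    then have "norm (q * \<zeta>) < 1" using assms by (simp add: norm_mult)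
    then have "(\<Sum>k. q ^ k * \<zeta> ^ k) = 1 / (1 - q * \<zeta>)"
      using eval_geom_fps[of q \<zeta>] by (simp add: eval_fps_def)
    then show "ennreal (1 / (norm (1 - q * \<zeta>))\<^sup>2) * indicator (sphere 0 1) \<zeta> = ennreal ((norm (\<Sum>k. q ^ k * \<zeta> ^ k))\<^sup>2)"
      using z by (simp add: norm_divide power_divide)
  qed
  also have "\<dots> = (\<Sum>k. ennreal ((norm (q ^ k))\<^sup>2))"
    using assms by (intro parseval) (simp add: norm_power summable_geometric)
  also have "\<dots> = wnorm 0 (geom_fps q)"
    unfolding wnorm_def by (intro suminf_cong) simp
  finally show ?thesis .
qed

text \<open>For powers of one geometric series every quotient in the defect equals
  \<open>q ^ k\<close>, so all variances vanish: kernels attain equality at every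
  multiplication.\<close>

lemma wnorm_geom_power:
  assumes q: "norm q < 1"
  shows "(geom_fps q ^ Suc s) $ k = of_nat ((k + s) choose s) * q ^ k"
    and "wnorm s (geom_fps q ^ Suc s) = wnorm 0 (geom_fps q) ^ Suc s"
proof -
  have coeff: "(geom_fps q ^ Suc s) $ k = of_nat ((k + s) choose s) * q ^ k" for s k
  proof (induction s arbitrary: k)
    case (Suc s)
    have "(geom_fps q ^ Suc (Suc s)) $ k = (\<Sum>i\<le>k. q ^ i * (of_nat ((k - i + s) choose s) * q ^ (k - i)))"
      by (subst power_Suc, subst fps_mult_nth) (simp only: Suc.IH geom_fps_nth atMost_atLeast0)
    also have "\<dots> = (\<Sum>i\<le>k. of_nat ((k - i + s) choose s)) * q ^ k"
      unfolding sum_distrib_right by (intro sum.cong refl) (simp flip: power_add)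
    also have "(\<Sum>i\<le>k. of_nat ((k - i + s) choose s)) = (\<Sum>i\<le>k. (of_nat ((i + s) choose s) :: complex))"
      by (rule sum.nat_diff_reindex[of _ "Suc k", simplified lessThan_Suc_atMost, simplified])
    also have "\<dots> = of_nat ((k + Suc s) choose Suc s)"
      using choose_rising_sum(1)[of s k] by (simp add: add.commute flip: of_nat_sum)
    finally show ?case .
  qed simp
  show "(geom_fps q ^ Suc s) $ k = of_nat ((k + s) choose s) * q ^ k" by (rule coeff)
  have f0: "wnorm 0 (geom_fps q) < \<top>" by (rule wnorm_geom_fps_finite[OF q])
  show "wnorm s (geom_fps q ^ Suc s) = wnorm 0 (geom_fps q) ^ Suc s"
  proof (induction s)
    case (Suc s)
    let ?A = "geom_fps q" and ?B = "geom_fps q ^ Suc s"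
    have fB: "wnorm s ?B < \<top>" 
      using ennreal_prod_less_top[of "{..<Suc s}" "\<lambda>_. wnorm 0 (geom_fps q)"] f0 by (simp add: Suc.IH del: power_Suc)
    obtain D where D: "\<And>k. D k \<ge> 0"
      "\<And>k. D k = (\<Sum>i\<le>k. real ((k - i + s) choose s) * (norm (?A $ i * ?B $ (k - i) / of_nat ((k - i + s) choose s)
         - ((?A * ?B) $ k) / of_nat ((k + Suc s) choose Suc s)))\<^sup>2)"
      "wnorm (Suc s) (?A * ?B) + (\<Sum>k. ennreal (D k)) = wnorm 0 ?A * wnorm s ?B"
      by (rule wnorm_mult_defect[OF f0 fB]) blast
    have "D k = 0" for k
    proof -
      have e1: "(?A * ?B) $ k / of_nat ((k + Suc s) choose Suc s) = q ^ k"
      proof -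
        have "(?A * ?B) $ k = of_nat ((k + Suc s) choose Suc s) * q ^ k"
          using coeff[of "Suc s" k] by (simp only: power_Suc)
        moreover have "(of_nat ((k + Suc s) choose Suc s) :: complex) \<noteq> 0"
          unfolding of_nat_eq_0_iff using zero_less_binomial[of "Suc s" "k + Suc s"] by simp
        ultimately show ?thesis by (metis nonzero_mult_div_cancel_left)
      qed
      have e2: "?A $ i * ?B $ (k - i) / of_nat ((k - i + s) choose s) = q ^ k" if "i \<le> k" for i
      proof -
        have "(of_nat ((k - i + s) choose s) :: complex) \<noteq> 0"
          unfolding of_nat_eq_0_iff using zero_less_binomial[of s "k - i + s"] by simp
        then show ?thesis using that unfolding coeff by (simp flip: power_add)
      qed
      show ?thesis
        unfolding D(2) e1
      proof (rule sum.neutral, rule ballI)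
        fix i assume "i \<in> {..k}"
        then have "i \<le> k" by simp
        show "real ((k - i + s) choose s) * (norm (?A $ i * ?B $ (k - i) / of_nat ((k - i + s) choose s) - q ^ k))\<^sup>2 = 0"
          unfolding e2[OF \<open>i \<le> k\<close>] by simp
      qed
    qed
    then have "wnorm (Suc s) (?A * ?B) = wnorm 0 ?A * wnorm s ?B" using D(3) by simp
    then show ?case unfolding Suc.IH by simp
  qed simp
qed

lemma nn_integral_disc_kernel:
  assumes m: "m \<ge> 2" and q: "norm q < 1"
  shows "(\<integral>\<^sup>+z. ennreal ((1 / (norm (1 - q * z))\<^sup>2) ^ m) * indicator (ball 0 1) z \<partial>bergman_disc m) = wnorm 0 (geom_fps q) ^ m"
proof -
  have ms: "m = Suc (m - 1)" using m by simp
  have *: "fps_conv_radius (geom_fps q ^ m) \<ge> 1"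
    "norm z < 1 \<Longrightarrow> eval_fps (geom_fps q ^ m) z = (1 / (1 - q * z)) ^ m" for z
  proof -
    have "(\<Prod>j<m. geom_fps q) = geom_fps q ^ m" by simp
    then show "fps_conv_radius (geom_fps q ^ m) \<ge> 1"
      using eval_fps_prod(1)[of "{..<m}" "\<lambda>_. geom_fps q"] conv_radius_geom_fps[OF q] by simp
    assume z: "norm z < 1"
    then have "norm (q * z) < 1" using q mult_strict_mono'[of "norm q" 1 "norm z" 1] by (simp add: norm_mult)
    then show "eval_fps (geom_fps q ^ m) z = (1 / (1 - q * z)) ^ m"
      using eval_fps_prod(2)[of "{..<m}" "\<lambda>_. geom_fps q" z] conv_radius_geom_fps[OF q] z
      by (simp add: eval_geom_fps)
  qed
  have "(\<integral>\<^sup>+z. ennreal ((1 / (norm (1 - q * z))\<^sup>2) ^ m) * indicator (ball 0 1) z \<partial>bergman_disc m)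
    = (\<integral>\<^sup>+z. ennreal ((norm (eval_fps (geom_fps q ^ m) z))\<^sup>2) * indicator (ball 0 1) z \<partial>bergman_disc m)"
  proof (rule nn_integral_cong)
    fix z :: complex
    show "ennreal ((1 / (norm (1 - q * z))\<^sup>2) ^ m) * indicator (ball 0 1) z
       = ennreal ((norm (eval_fps (geom_fps q ^ m) z))\<^sup>2) * indicator (ball 0 1) z"
    proof (cases "norm z < 1")
      case True
      have "(norm (eval_fps (geom_fps q ^ m) z))\<^sup>2 = (1 / (norm (1 - q * z))\<^sup>2) ^ m"
        unfolding *(2)[OF True] norm_power norm_divide norm_one power_divide power_one
        by (simp add: power_mult[symmetric] mult.commute)
      then show ?thesis by simp
    qed simp
  qed
  also have "\<dots> = wnorm (m - 1) (geom_fps q ^ m)"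
    by (intro nn_integral_bergman_disc_fps m *(1))
  also have "\<dots> = wnorm 0 (geom_fps q) ^ m"
    using wnorm_geom_power(2)[OF q, of "m - 1"] ms by simp
  finally show ?thesis .
qed

text \<open>Unlike in \<open>wnorm_prod_le\<close>, the last factor keeps its own norm. With
  \<open>B\<close> the product of two kernels, the gap gained there survives, multiplied by the
  remaining norms.\<close>

lemma wnorm_prod_mult_le:
  assumes "finite K" "\<And>j. j \<in> K \<Longrightarrow> wnorm 0 (A j) < \<top>" "wnorm s B < \<top>"
  shows "wnorm (card K + s) ((\<Prod>j\<in>K. A j) * B) \<le> (\<Prod>j\<in>K. wnorm 0 (A j)) * wnorm s B"
  using assms(1,2)
proof (induction K rule: finite_induct)
  case (insert j F)
  have IH: "wnorm (card F + s) ((\<Prod>j\<in>F. A j) * B) \<le> (\<Prod>j\<in>F. wnorm 0 (A j)) * wnorm s B"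
    using insert by simp
  also have "\<dots> < \<top>"
    using insert.prems assms(3) by (auto intro!: ennreal_prod_less_top simp: ennreal_mult_less_top)
  finally have fin: "wnorm (card F + s) ((\<Prod>j\<in>F. A j) * B) < \<top>" .
  have "wnorm (Suc (card F + s)) (A j * ((\<Prod>j\<in>F. A j) * B)) \<le> wnorm 0 (A j) * wnorm (card F + s) ((\<Prod>j\<in>F. A j) * B)"
    using insert.prems by (intro wnorm_mult_le fin) auto
  also have "\<dots> \<le> wnorm 0 (A j) * ((\<Prod>j\<in>F. wnorm 0 (A j)) * wnorm s B)"
    by (intro mult_left_mono IH) auto
  finally show ?case using insert by (simp add: mult.assoc)
qed simp

text \<open>The gap on the left rules out poles that vary from slice to slice.\<close>

lemma kernel_defect:
  assumes J: "finite J" and j12: "j1 \<in> J" "j2 \<in> J" "j1 \<noteq> j2"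
    and q: "\<And>j. j \<in> J \<Longrightarrow> norm (q j) < 1" and b: "\<And>j. j \<in> J \<Longrightarrow> 0 \<le> b j"
  shows "(\<integral>\<^sup>+z. ennreal (\<Prod>j\<in>J. b j / (norm (1 - q j * z))\<^sup>2) * indicator (ball 0 1) z \<partial>bergman_disc (card J))
      + ennreal ((norm (q j1 - q j2))\<^sup>2 / 2 * (\<Prod>j\<in>J. b j))
    \<le> (\<Prod>j\<in>J. \<integral>\<^sup>+\<zeta>. ennreal (b j / (norm (1 - q j * \<zeta>))\<^sup>2) * indicator (sphere 0 1) \<zeta> \<partial>circle_haar)"
proof -
  define A where "A j = fps_const (complex_of_real (sqrt (b j))) * geom_fps (q j)" for j
  have m2: "card J \<ge> 2"
    using card_mono[OF J, of "{j1, j2}"] j12 by simp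
  have nthA: "A j $ k = of_real (sqrt (b j)) * q j ^ k" for j k by (simp add: A_def)
  have wA: "wnorm 0 (A j) = ennreal (b j) * wnorm 0 (geom_fps (q j))" if "j \<in> J" for j
  proof -
    have "wnorm 0 (A j) = (\<Sum>k. ennreal (b j) * ennreal ((norm (geom_fps (q j) $ k))\<^sup>2 / real ((k + 0) choose 0)))"
      unfolding wnorm_def using b[OF that]
      by (intro suminf_cong) (simp add: nthA norm_mult power_mult_distrib ennreal_mult'[symmetric])
    then show ?thesis unfolding wnorm_def by simp
  qed
  have fA: "wnorm 0 (A j) < \<top>" if "j \<in> J" for j
    unfolding wA[OF that] using wnorm_geom_fps_finite[OF q[OF that]] by (simp add: ennreal_mult_less_top)
  have cA: "fps_conv_radius (A j) \<ge> 1" if "j \<in> J" for j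
  proof -
    have "1 \<le> min (fps_conv_radius (fps_const (complex_of_real (sqrt (b j))))) (fps_conv_radius (geom_fps (q j)))"
      using conv_radius_geom_fps[OF q[OF that]] by simp
    also have "\<dots> \<le> fps_conv_radius (A j)" unfolding A_def by (rule fps_conv_radius_mult)
    finally show ?thesis .
  qed
  have eA: "eval_fps (A j) z = of_real (sqrt (b j)) / (1 - q j * z)" if "j \<in> J" "norm z < 1" for j z
  proof -
    have nqz: "norm (q j * z) < 1" using q[OF that(1)] that(2) mult_strict_mono'[of "norm (q j)" 1 "norm z" 1] by (simp add: norm_mult)
    have "ereal (norm z) < 1" using that by (simp add: one_ereal_def)
    then have "ereal (norm z) < fps_conv_radius (geom_fps (q j))"
      using conv_radius_geom_fps[OF q[OF that(1)]] by (rule less_le_trans)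
    then have "eval_fps (A j) z = of_real (sqrt (b j)) * eval_fps (geom_fps (q j)) z"
      unfolding A_def by (subst eval_fps_mult) auto
    then show ?thesis using nqz by (simp add: eval_geom_fps)
  qed
  have disc: "(\<integral>\<^sup>+z. ennreal (\<Prod>j\<in>J. b j / (norm (1 - q j * z))\<^sup>2) * indicator (ball 0 1) z \<partial>bergman_disc (card J))
    = wnorm (card J - 1) (\<Prod>j\<in>J. A j)"
  proof -
    have "(\<integral>\<^sup>+z. ennreal (\<Prod>j\<in>J. b j / (norm (1 - q j * z))\<^sup>2) * indicator (ball 0 1) z \<partial>bergman_disc (card J))
      = (\<integral>\<^sup>+z. ennreal ((norm (eval_fps (\<Prod>j\<in>J. A j) z))\<^sup>2) * indicator (ball 0 1) z \<partial>bergman_disc (card J))"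
    proof (rule nn_integral_cong)
      fix z :: complex
      show "ennreal (\<Prod>j\<in>J. b j / (norm (1 - q j * z))\<^sup>2) * indicator (ball 0 1) z
        = ennreal ((norm (eval_fps (\<Prod>j\<in>J. A j) z))\<^sup>2) * indicator (ball 0 1) z"
      proof (cases "norm z < 1")
        case True
        have "(norm (eval_fps (\<Prod>j\<in>J. A j) z))\<^sup>2 = (\<Prod>j\<in>J. (norm (eval_fps (A j) z))\<^sup>2)"
          using True by (simp add: eval_fps_prod(2)[OF cA] prod_norm flip: prod_power_distrib)
        also have "\<dots> = (\<Prod>j\<in>J. b j / (norm (1 - q j * z))\<^sup>2)"
          using True b by (intro prod.cong refl) (simp add: eA norm_divide power_divide)
        finally show ?thesis by simp
      qed simp
    qed
    also have "\<dots> = wnorm (card J - 1) (\<Prod>j\<in>J. A j)"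
      by (intro nn_integral_bergman_disc_fps m2 eval_fps_prod(1) cA)
    finally show ?thesis .
  qed
  have circ: "(\<integral>\<^sup>+\<zeta>. ennreal (b j / (norm (1 - q j * \<zeta>))\<^sup>2) * indicator (sphere 0 1) \<zeta> \<partial>circle_haar) = wnorm 0 (A j)"
    if "j \<in> J" for j
  proof -
    have "(\<integral>\<^sup>+\<zeta>. ennreal (b j / (norm (1 - q j * \<zeta>))\<^sup>2) * indicator (sphere 0 1) \<zeta> \<partial>circle_haar)
      = (\<integral>\<^sup>+\<zeta>. ennreal (b j) * (ennreal (1 / (norm (1 - q j * \<zeta>))\<^sup>2) * indicator (sphere 0 1) \<zeta>) \<partial>circle_haar)"
      using b[OF that] by (intro nn_integral_cong) (auto split: split_indicator simp: ennreal_mult'[symmetric])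
    also have "\<dots> = ennreal (b j) * wnorm 0 (geom_fps (q j))"
    proof (subst nn_integral_cmult)
      have [measurable]: "sphere (0::complex) 1 \<in> sets borel" by (intro borel_closed closed_sphere)
      show "(\<lambda>\<zeta>. ennreal (1 / (norm (1 - q j * \<zeta>))\<^sup>2) * indicator (sphere 0 1) \<zeta>) \<in> borel_measurable circle_haar"
        unfolding borel_measurable_circle_haar by measurable
    qed (simp add: nn_integral_circle_kernel[OF q[OF that]])
    finally show ?thesis by (simp add: wA[OF that])
  qed
  \<comment> \<open>The pair \<open>j1\<close>, \<open>j2\<close> is multiplied first, where the
    defect is explicit; the factors in \<open>K\<close> come afterwards.\<close>
  define K where "K = J - {j1, j2}"
  have K: "finite K" "K \<subseteq> J" "j1 \<notin> insert j2 K" "j2 \<notin> K" "J = insert j1 (insert j2 K)"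
    using J j12 by (auto simp: K_def)
  have cK: "card J - 1 = card K + 1" using K by simp
  let ?X = "\<Prod>j\<in>K. wnorm 0 (A j)"
  let ?d = "(norm (A j1 $ 1 * A j2 $ 0 - A j1 $ 0 * A j2 $ 1))\<^sup>2 / 2"
  have f1: "wnorm 1 (A j1 * A j2) < \<top>"
  proof -
    have "wnorm (Suc 0) (A j1 * A j2) \<le> wnorm 0 (A j1) * wnorm 0 (A j2)"
      by (intro wnorm_mult_le fA j12)
    also have "\<dots> < \<top>" using fA[OF j12(1)] fA[OF j12(2)] by (simp add: ennreal_mult_less_top)
    finally show ?thesis by simp
  qed
  have "wnorm (card J - 1) (\<Prod>j\<in>J. A j) = wnorm (card K + 1) ((\<Prod>j\<in>K. A j) * (A j1 * A j2))"
  proof -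
    have "(\<Prod>j\<in>J. A j) = A j1 * (A j2 * (\<Prod>j\<in>K. A j))" using K by simp
    then show ?thesis unfolding cK by (simp only: mult_ac)
  qed
  also have "\<dots> \<le> ?X * wnorm 1 (A j1 * A j2)"
    using K fA by (intro wnorm_prod_mult_le f1) auto
  finally have le1: "wnorm (card J - 1) (\<Prod>j\<in>J. A j) \<le> ?X * wnorm 1 (A j1 * A j2)" .
  \<comment> \<open>The norm of each remaining factor is at least \<open>b j\<close>, the square of
    its constant coefficient, which leaves the gap in the form claimed.\<close>
  have le2: "ennreal ((norm (q j1 - q j2))\<^sup>2 / 2 * (\<Prod>j\<in>J. b j)) \<le> ?X * ennreal ?d"
  proof -
    have "?d = b j1 * b j2 * (norm (q j1 - q j2))\<^sup>2 / 2"
    proof -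
      have "A j1 $ 1 * A j2 $ 0 - A j1 $ 0 * A j2 $ 1 = of_real (sqrt (b j1)) * of_real (sqrt (b j2)) * (q j1 - q j2)"
        by (simp add: nthA algebra_simps)
      then show ?thesis using b j12 by (simp add: norm_mult power_mult_distrib)
    qed
    then have "(norm (q j1 - q j2))\<^sup>2 / 2 * (\<Prod>j\<in>J. b j) = (\<Prod>j\<in>K. b j) * ?d"
      using K by simp
    also have "ennreal \<dots> = (\<Prod>j\<in>K. ennreal (b j)) * ennreal ?d"
      using K b by (subst ennreal_mult) (auto intro!: prod_nonneg simp: prod_ennreal)
    also have "\<dots> \<le> ?X * ennreal ?d"
    proof (intro mult_right_mono prod_mono_ennreal)
      fix j assume "j \<in> K"
      then have "j \<in> J" using K by auto
      then have "ennreal (b j) = ennreal ((norm (A j $ 0))\<^sup>2)" using b by (simp add: nthA)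
      also have "\<dots> \<le> wnorm 0 (A j)" by (rule wnorm_ge_0)
      finally show "ennreal (b j) \<le> wnorm 0 (A j)" .
    qed auto
    finally show ?thesis .
  qed
  have "wnorm (card J - 1) (\<Prod>j\<in>J. A j) + ennreal ((norm (q j1 - q j2))\<^sup>2 / 2 * (\<Prod>j\<in>J. b j))
     \<le> ?X * (wnorm 1 (A j1 * A j2) + ennreal ?d)"
    unfolding distrib_left by (intro add_mono le1 le2)
  also have "\<dots> \<le> ?X * (wnorm 0 (A j1) * wnorm 0 (A j2))"
    by (intro mult_left_mono wnorm_mult_defect1 fA j12) auto
  also have "\<dots> = (\<Prod>j\<in>J. wnorm 0 (A j))" using K by (simp add: mult_ac)
  also have "\<dots> = (\<Prod>j\<in>J. \<integral>\<^sup>+\<zeta>. ennreal (b j / (norm (1 - q j * \<zeta>))\<^sup>2) * indicator (sphere 0 1) \<zeta> \<partial>circle_haar)"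
    by (intro prod.cong refl) (simp add: circ)
  finally show ?thesis unfolding disc .
qed

section \<open>Product measures and tensorization\<close>

abbreviation borel_prod :: "('n::finite \<Rightarrow> complex) measure" where
  "borel_prod \<equiv> PiM UNIV (\<lambda>_. borel)"

lemma sets_borel_prod: "sets (borel_prod :: ('n::finite \<Rightarrow> complex) measure) = sets borel"
  by (rule sets_PiM_equal_borel)

lemma measurable_override_on [measurable]:
  "(\<lambda>y. override_on x y K) \<in> measurable borel_prod (borel_prod :: ('n::finite \<Rightarrow> complex) measure)"
proof (rule measurable_abs_UNIV)
  show "(\<lambda>y. override_on x y K n) \<in> borel_measurable borel_prod" for n
    by (cases "n \<in> K") simp_all
qed

lemma measurable_fun_upd_pair [measurable (raw)]:
  assumes [measurable]: "f \<in> measurable N borel_prod" "g \<in> borel_measurable N"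
  shows "(\<lambda>x. (f x)(i := g x)) \<in> measurable N (borel_prod :: ('n::finite \<Rightarrow> complex) measure)"
proof (rule measurable_abs_UNIV)
  have "(\<lambda>x. f x n) \<in> borel_measurable N" for n
    by (rule measurable_compose[OF assms(1) measurable_component_singleton]) simp
  then show "(\<lambda>x. ((f x)(i := g x)) n) \<in> borel_measurable N" for n
    by (cases "n = i") simp_all
qed

text \<open>Common setting for \<open>circle_haar\<close> and \<open>bergman_disc m\<close>. With
  the Borel sets fixed, measurability over \<open>borel_prod\<close> serves both product measures at
  once.\<close>

locale borel_prob = prob_space \<nu> for \<nu> :: "complex measure" +
  assumes sets_nu: "sets \<nu> = sets borel"
begin

lemma space_nu: "space \<nu> = UNIV"
  using sets_eq_imp_space_eq[OF sets_nu] by simp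

lemma sets_power: "sets (PiM UNIV (\<lambda>_::'n::finite. \<nu>)) = sets borel_prod"
  by (intro sets_PiM_cong refl sets_nu)

lemma measurable_power [simp]:
  "measurable (PiM UNIV (\<lambda>_::'n::finite. \<nu>)) N = measurable borel_prod N"
  "measurable N (PiM UNIV (\<lambda>_::'n::finite. \<nu>)) = measurable N borel_prod"
  "measurable \<nu> N' = measurable borel N'"
  by (intro measurable_cong_sets sets_power refl sets_nu)+

lemma space_power: "space (PiM UNIV (\<lambda>_::'n::finite. \<nu>)) = UNIV"
  by (simp add: space_PiM space_nu)

lemma product_sigma_finite_nu: "product_sigma_finite (\<lambda>_. \<nu>)"
  by (intro product_sigma_finite.intro prob_space_imp_sigma_finite prob_space_axioms)

lemma prob_space_power: "prob_space (PiM UNIV (\<lambda>_::'n::finite. \<nu>))"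
  by (intro prob_space_PiM prob_space_axioms)

text \<open>Resampling coordinate \<open>i\<close> from an independent copy does not change a
  product of probability measures. In this form Fubini in one coordinate needs no splitting of the
  index type.\<close>

lemma distr_fun_upd:
  "distr (PiM UNIV (\<lambda>_::'n::finite. \<nu>) \<Otimes>\<^sub>M \<nu>) (PiM UNIV (\<lambda>_. \<nu>)) (\<lambda>(y, t). y(i := t)) = PiM UNIV (\<lambda>_. \<nu>)"
  (is "?D = ?P")
proof -
  interpret product_sigma_finite "\<lambda>_::'n. \<nu>" by (rule product_sigma_finite_nu)
  interpret P: prob_space "PiM UNIV (\<lambda>_::'n. \<nu>)" by (rule prob_space_power)
  have m: "(\<lambda>(y, t). y(i := t)) \<in> measurable (PiM UNIV (\<lambda>_::'n. \<nu>) \<Otimes>\<^sub>M \<nu>) (PiM UNIV (\<lambda>_. \<nu>))"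
  proof -
    have "(\<lambda>(y, t). y(i := t)) \<in> measurable (borel_prod \<Otimes>\<^sub>M borel) (borel_prod :: ('n \<Rightarrow> complex) measure)"
      unfolding split_beta' by measurable
    moreover have "sets (PiM UNIV (\<lambda>_::'n. \<nu>) \<Otimes>\<^sub>M \<nu>) = sets (borel_prod \<Otimes>\<^sub>M borel)"
      by (intro sets_pair_measure_cong sets_power sets_nu)
    ultimately show ?thesis using measurable_cong_sets[OF _ sets_power] by blast
  qed
  show ?thesis
  proof (rule PiM_eqI)
    fix A :: "'n \<Rightarrow> complex set" assume A: "\<And>i. i \<in> UNIV \<Longrightarrow> A i \<in> sets \<nu>"
    define A' where "A' = A(i := UNIV)"
    have A': "A' j \<in> sets \<nu>" for j using A by (auto simp: A'_def sets_nu)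
    have "(\<lambda>(y, t). y(i := t)) -` Pi\<^sub>E UNIV A \<inter> space (PiM UNIV (\<lambda>_::'n. \<nu>) \<Otimes>\<^sub>M \<nu>) = Pi\<^sub>E UNIV A' \<times> A i"
      by (auto simp: A'_def space_pair_measure space_power space_nu PiE_iff split: if_splits)
    then have "emeasure ?D (Pi\<^sub>E UNIV A) = emeasure (PiM UNIV (\<lambda>_::'n. \<nu>) \<Otimes>\<^sub>M \<nu>) (Pi\<^sub>E UNIV A' \<times> A i)"
      using A by (subst emeasure_distr[OF m]) (auto intro!: sets_PiM_I_finite)
    also have "\<dots> = emeasure (PiM UNIV (\<lambda>_::'n. \<nu>)) (Pi\<^sub>E UNIV A') * emeasure \<nu> (A i)"
      using A A' by (intro emeasure_pair_measure_Times) (auto intro!: sets_PiM_I_finite)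
    also have "\<dots> = (\<Prod>j\<in>UNIV. emeasure \<nu> (A' j)) * emeasure \<nu> (A i)"
      using A' by (simp add: emeasure_PiM)
    also have "(\<Prod>j\<in>UNIV. emeasure \<nu> (A' j)) = (\<Prod>j\<in>UNIV - {i}. emeasure \<nu> (A j))"
      by (subst prod.remove[of _ i]) (auto simp: A'_def emeasure_space_1[unfolded space_nu] intro!: prod.cong)
    also have "\<dots> * emeasure \<nu> (A i) = (\<Prod>j\<in>UNIV. emeasure \<nu> (A j))"
      by (subst prod.remove[of UNIV i]) (auto simp: mult.commute)
    finally show "emeasure ?D (Pi\<^sub>E UNIV A) = (\<Prod>j\<in>UNIV. emeasure \<nu> (A j))" .
  qed auto
qed

lemma nn_integral_fun_upd:
  assumes u: "u \<in> borel_measurable (borel_prod :: ('n::finite \<Rightarrow> complex) measure)"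
  shows "(\<integral>\<^sup>+y. u y \<partial>PiM UNIV (\<lambda>_. \<nu>)) = (\<integral>\<^sup>+y. \<integral>\<^sup>+t. u (y(i := t)) \<partial>\<nu> \<partial>PiM UNIV (\<lambda>_. \<nu>))"
    and "(\<integral>\<^sup>+y. u y \<partial>PiM UNIV (\<lambda>_. \<nu>)) = (\<integral>\<^sup>+t. \<integral>\<^sup>+y. u (y(i := t)) \<partial>PiM UNIV (\<lambda>_. \<nu>) \<partial>\<nu>)"
proof -
  have sf: "sigma_finite_measure \<nu>" by unfold_locales
  interpret P: prob_space "PiM UNIV (\<lambda>_::'n. \<nu>)" by (rule prob_space_power)
  interpret pair_sigma_finite "PiM UNIV (\<lambda>_::'n. \<nu>)" \<nu> ..
  note u[measurable]
  have s: "sets (PiM UNIV (\<lambda>_::'n. \<nu>) \<Otimes>\<^sub>M \<nu>) = sets (borel_prod \<Otimes>\<^sub>M borel)"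
    by (intro sets_pair_measure_cong sets_power sets_nu)
  have m0: "(\<lambda>(y, t). y(i := t)) \<in> measurable (borel_prod \<Otimes>\<^sub>M borel) (borel_prod :: ('n \<Rightarrow> complex) measure)"
    unfolding split_beta' by measurable
  have m: "(\<lambda>(y, t). y(i := t)) \<in> measurable (PiM UNIV (\<lambda>_::'n. \<nu>) \<Otimes>\<^sub>M \<nu>) (PiM UNIV (\<lambda>_. \<nu>))"
    using m0 measurable_cong_sets[OF s sets_power] by blast
  have mu: "(\<lambda>(y, t). u (y(i := t))) \<in> borel_measurable (PiM UNIV (\<lambda>_::'n. \<nu>) \<Otimes>\<^sub>M \<nu>)"
    unfolding measurable_cong_sets[OF s refl] split_beta' by measurable
  have "(\<integral>\<^sup>+y. u y \<partial>PiM UNIV (\<lambda>_. \<nu>)) = (\<integral>\<^sup>+x. u (case x of (y, t) \<Rightarrow> y(i := t)) \<partial>(PiM UNIV (\<lambda>_::'n. \<nu>) \<Otimes>\<^sub>M \<nu>))"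
    by (subst distr_fun_upd[of i, symmetric], subst nn_integral_distr[OF m]) (simp_all add: u)
  also have "\<dots> = (\<integral>\<^sup>+x. (case x of (y, t) \<Rightarrow> u (y(i := t))) \<partial>(PiM UNIV (\<lambda>_::'n. \<nu>) \<Otimes>\<^sub>M \<nu>))"
    by (simp add: split_beta')
  finally have eq: "(\<integral>\<^sup>+y. u y \<partial>PiM UNIV (\<lambda>_. \<nu>)) = (\<integral>\<^sup>+x. (case x of (y, t) \<Rightarrow> u (y(i := t))) \<partial>(PiM UNIV (\<lambda>_::'n. \<nu>) \<Otimes>\<^sub>M \<nu>))" .
  show "(\<integral>\<^sup>+y. u y \<partial>PiM UNIV (\<lambda>_. \<nu>)) = (\<integral>\<^sup>+y. \<integral>\<^sup>+t. u (y(i := t)) \<partial>\<nu> \<partial>PiM UNIV (\<lambda>_. \<nu>))"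
    unfolding eq by (subst sigma_finite_measure.nn_integral_fst[OF sf mu, symmetric]) simp
  show "(\<integral>\<^sup>+y. u y \<partial>PiM UNIV (\<lambda>_. \<nu>)) = (\<integral>\<^sup>+t. \<integral>\<^sup>+y. u (y(i := t)) \<partial>PiM UNIV (\<lambda>_. \<nu>) \<partial>\<nu>)"
    unfolding eq by (subst nn_integral_snd[OF mu, symmetric]) simp
qed

lemma AE_fun_upd:
  assumes N: "N \<in> sets (borel_prod :: ('n::finite \<Rightarrow> complex) measure)"
    and AE: "AE y in PiM UNIV (\<lambda>_. \<nu>). AE t in \<nu>. y(i := t) \<notin> N"
  shows "AE y in PiM UNIV (\<lambda>_. \<nu>). y \<notin> N"
proof -
  have m: "(\<lambda>y. indicator N y :: ennreal) \<in> borel_measurable borel_prod" using N by measurable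
  have m': "(\<lambda>t. indicator N (y(i := t)) :: ennreal) \<in> borel_measurable \<nu>" for y
    unfolding measurable_power by (rule measurable_compose[OF _ m], rule measurable_fun_upd_pair) (auto simp: space_PiM)
  have "(\<integral>\<^sup>+y. indicator N y \<partial>PiM UNIV (\<lambda>_. \<nu>)) = (\<integral>\<^sup>+y. \<integral>\<^sup>+t. indicator N (y(i := t)) \<partial>\<nu> \<partial>PiM UNIV (\<lambda>_. \<nu>))"
    by (rule nn_integral_fun_upd[OF m])
  also have "\<dots> = (\<integral>\<^sup>+y. 0 \<partial>PiM UNIV (\<lambda>_::'n. \<nu>))"
  proof (rule nn_integral_cong_AE)
    show "AE y in PiM UNIV (\<lambda>_. \<nu>). (\<integral>\<^sup>+t. indicator N (y(i := t)) \<partial>\<nu>) = 0"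
      using AE
    proof eventually_elim
      case (elim y)
      have "AE t in \<nu>. (indicator N (y(i := t)) :: ennreal) = 0"
        using elim by eventually_elim simp
      then show ?case using nn_integral_0_iff_AE[OF m'] by blast
    qed
  qed
  finally have "(\<integral>\<^sup>+y. indicator N y \<partial>PiM UNIV (\<lambda>_. \<nu>)) = 0" by simp
  then have "AE y in PiM UNIV (\<lambda>_. \<nu>). (indicator N y :: ennreal) = 0"
    by (subst (asm) nn_integral_0_iff_AE) (simp_all add: m)
  then show ?thesis by eventually_elim (auto split: split_indicator_asm)
qed

end

text \<open>A product of integrals is one integral over independent copies of the variable, one for
  each \<open>j\<close>; Fubini then moves the integral over \<open>x\<close> inside. This is how
  the factors come to be evaluated at different points.\<close>

lemma prod_nn_integral_swap:
  assumes J: "finite J" and M: "sigma_finite_measure M" and R: "sigma_finite_measure R"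
    and g: "\<And>j. j \<in> J \<Longrightarrow> (\<lambda>(s, x). g j s x) \<in> borel_measurable (R \<Otimes>\<^sub>M M)"
  shows "(\<integral>\<^sup>+x. (\<Prod>j\<in>J. \<integral>\<^sup>+s. g j s x \<partial>R) \<partial>M) = (\<integral>\<^sup>+s. \<integral>\<^sup>+x. (\<Prod>j\<in>J. g j (s j) x) \<partial>M \<partial>PiM J (\<lambda>_. R))"
proof -
  interpret product_sigma_finite "\<lambda>_. R" by (intro product_sigma_finite.intro R)
  interpret PJ: sigma_finite_measure "PiM J (\<lambda>_. R)" by (rule sigma_finite[OF J])
  interpret M: sigma_finite_measure M by (rule M)
  interpret pair_sigma_finite "PiM J (\<lambda>_. R)" M ..
  have gx: "(\<lambda>s. g j s x) \<in> borel_measurable R" if "j \<in> J" "x \<in> space M" for j x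
    using measurable_compose[OF measurable_Pair2'[OF that(2)] g[OF that(1)]] by simp
  have "(\<integral>\<^sup>+x. (\<Prod>j\<in>J. \<integral>\<^sup>+s. g j s x \<partial>R) \<partial>M) = (\<integral>\<^sup>+x. \<integral>\<^sup>+s. (\<Prod>j\<in>J. g j (s j) x) \<partial>PiM J (\<lambda>_. R) \<partial>M)"
    by (intro nn_integral_cong product_nn_integral_prod[symmetric] J gx)
  also have "\<dots> = (\<integral>\<^sup>+s. \<integral>\<^sup>+x. (\<Prod>j\<in>J. g j (s j) x) \<partial>M \<partial>PiM J (\<lambda>_. R))"
  proof (rule Fubini')
    show "(\<lambda>(s, x). \<Prod>j\<in>J. g j (s j) x) \<in> borel_measurable (PiM J (\<lambda>_. R) \<Otimes>\<^sub>M M)"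
      unfolding split_beta'
    proof (rule borel_measurable_prod_ennreal)
      fix j assume j: "j \<in> J"
      have "(\<lambda>z. (fst z j, snd z)) \<in> measurable (PiM J (\<lambda>_. R) \<Otimes>\<^sub>M M) (R \<Otimes>\<^sub>M M)"
        using j by measurable
      from measurable_compose[OF this g[OF j]]
      show "(\<lambda>z. g j (fst z j) (snd z)) \<in> borel_measurable (PiM J (\<lambda>_. R) \<Otimes>\<^sub>M M)" by simp
    qed
  qed
  finally show ?thesis .
qed

lemma prod_nn_integral:
  assumes J: "finite J" and R: "sigma_finite_measure R"
    and g: "\<And>j. j \<in> J \<Longrightarrow> g j \<in> borel_measurable R"
  shows "(\<Prod>j\<in>J. \<integral>\<^sup>+s. g j s \<partial>R) = (\<integral>\<^sup>+s. (\<Prod>j\<in>J. g j (s j)) \<partial>PiM J (\<lambda>_. R))"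
proof -
  interpret product_sigma_finite "\<lambda>_. R" by (intro product_sigma_finite.intro R)
  show ?thesis by (intro product_nn_integral_prod[symmetric] J g)
qed

locale two_probs = M: borel_prob \<mu> + S: borel_prob \<sigma> for \<mu> \<sigma> :: "complex measure"
begin

lemma measurable_pair_power:
  fixes f :: "('n::finite \<Rightarrow> complex) \<times> complex \<Rightarrow> 'b"
  shows "measurable (PiM UNIV (\<lambda>_::'n. \<sigma>) \<Otimes>\<^sub>M \<mu>) N = measurable (borel_prod \<Otimes>\<^sub>M borel) N"
    and "measurable (\<sigma> \<Otimes>\<^sub>M PiM UNIV (\<lambda>_::'n. \<mu>)) N = measurable (borel \<Otimes>\<^sub>M borel_prod) N"
    and "measurable (\<sigma> \<Otimes>\<^sub>M PiM UNIV (\<lambda>_::'n. \<sigma>)) N = measurable (borel \<Otimes>\<^sub>M borel_prod) N"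
  by (intro measurable_cong_sets sets_pair_measure_cong M.sets_power S.sets_power M.sets_nu S.sets_nu refl)+

lemma override_on_upd:
  assumes "i \<notin> K"
  shows "override_on x (y(i := t)) (insert i K) = (override_on x y K)(i := t)"
    and "(override_on x y K)(i := t) = override_on (x(i := t)) y K"
  using assms by (auto simp: override_on_def fun_eq_iff)

lemma tensor_inequality:
  fixes u :: "'j \<Rightarrow> ('n::finite \<Rightarrow> complex) \<Rightarrow> ennreal"
  assumes J: "finite J" and u: "\<And>j. j \<in> J \<Longrightarrow> u j \<in> borel_measurable borel_prod"
    and one: "\<And>i x. (\<integral>\<^sup>+t. (\<Prod>j\<in>J. u j ((x j)(i := t))) \<partial>\<mu>) \<le> (\<Prod>j\<in>J. \<integral>\<^sup>+t. u j ((x j)(i := t)) \<partial>\<sigma>)"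
  shows "(\<integral>\<^sup>+y. (\<Prod>j\<in>J. u j (override_on (x j) y K)) \<partial>PiM UNIV (\<lambda>_. \<mu>))
    \<le> (\<Prod>j\<in>J. \<integral>\<^sup>+y. u j (override_on (x j) y K) \<partial>PiM UNIV (\<lambda>_. \<sigma>))"
proof -
  interpret PM: prob_space "PiM UNIV (\<lambda>_::'n. \<mu>)" by (rule M.prob_space_power)
  interpret PS: prob_space "PiM UNIV (\<lambda>_::'n. \<sigma>)" by (rule S.prob_space_power)
  have "finite K" by simp
  then show ?thesis
  proof (induction K arbitrary: x rule: finite_induct)
    case empty
    then show ?case by (simp add: PM.emeasure_space_1 PS.emeasure_space_1)
  next
    case (insert i K)
    have mo: "(\<lambda>y. u j (override_on (x j) y (insert i K))) \<in> borel_measurable borel_prod" if "j \<in> J" for j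
      using u[OF that] by measurable
    have mo2: "(\<lambda>(y, t). u j ((override_on (x j) y K)(i := t))) \<in> borel_measurable (borel_prod \<Otimes>\<^sub>M borel)" if "j \<in> J" for j
      using u[OF that] unfolding split_beta' by measurable
    have "(\<integral>\<^sup>+y. (\<Prod>j\<in>J. u j (override_on (x j) y (insert i K))) \<partial>PiM UNIV (\<lambda>_. \<mu>))
      = (\<integral>\<^sup>+t. \<integral>\<^sup>+y. (\<Prod>j\<in>J. u j (override_on ((x j)(i := t)) y K)) \<partial>PiM UNIV (\<lambda>_. \<mu>) \<partial>\<mu>)"
      by (subst M.nn_integral_fun_upd(2)[of _ i])
         (auto intro!: borel_measurable_prod_ennreal mo simp: override_on_upd[OF insert.hyps(2)])
    \<comment> \<open>The induction hypothesis, at points sharing the disc variable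
      \<open>t\<close>, leaves a product of torus integrals; giving each factor its own variable
      \<open>s j\<close> exposes the one-variable inequality in coordinate \<open>i\<close>.\<close>
    also have "\<dots> \<le> (\<integral>\<^sup>+t. (\<Prod>j\<in>J. \<integral>\<^sup>+y. u j (override_on ((x j)(i := t)) y K) \<partial>PiM UNIV (\<lambda>_. \<sigma>)) \<partial>\<mu>)"
      by (intro nn_integral_mono insert.IH)
    also have "\<dots> = (\<integral>\<^sup>+t. (\<Prod>j\<in>J. \<integral>\<^sup>+y. u j ((override_on (x j) y K)(i := t)) \<partial>PiM UNIV (\<lambda>_. \<sigma>)) \<partial>\<mu>)"
      by (simp add: override_on_upd(2)[OF insert.hyps(2)])
    also have "\<dots> = (\<integral>\<^sup>+s. \<integral>\<^sup>+t. (\<Prod>j\<in>J. u j ((override_on (x j) (s j) K)(i := t))) \<partial>\<mu> \<partial>PiM J (\<lambda>_. PiM UNIV (\<lambda>_. \<sigma>)))"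
      using mo2 by (intro prod_nn_integral_swap J M.sigma_finite_measure_axioms PS.sigma_finite_measure_axioms)
        (simp add: measurable_pair_power)
    also have "\<dots> \<le> (\<integral>\<^sup>+s. (\<Prod>j\<in>J. \<integral>\<^sup>+t. u j ((override_on (x j) (s j) K)(i := t)) \<partial>\<sigma>) \<partial>PiM J (\<lambda>_. PiM UNIV (\<lambda>_. \<sigma>)))"
      by (intro nn_integral_mono one)
    also have "\<dots> = (\<Prod>j\<in>J. \<integral>\<^sup>+y. \<integral>\<^sup>+t. u j ((override_on (x j) y K)(i := t)) \<partial>\<sigma> \<partial>PiM UNIV (\<lambda>_. \<sigma>))"
    proof (intro prod_nn_integral[symmetric] J PS.sigma_finite_measure_axioms)
      fix j assume "j \<in> J"
      have "(\<lambda>(y, t). u j ((override_on (x j) y K)(i := t))) \<in> borel_measurable (PiM UNIV (\<lambda>_::'n. \<sigma>) \<Otimes>\<^sub>M \<sigma>)"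
        using mo2[OF \<open>j \<in> J\<close>]
        by (subst measurable_cong_sets[OF sets_pair_measure_cong[OF S.sets_power S.sets_nu] refl])
      then show "(\<lambda>y. \<integral>\<^sup>+t. u j ((override_on (x j) y K)(i := t)) \<partial>\<sigma>) \<in> borel_measurable (PiM UNIV (\<lambda>_. \<sigma>))"
        by (rule S.borel_measurable_nn_integral_fst[of "\<lambda>(y, t). u j ((override_on (x j) y K)(i := t))", simplified])
    qed
    also have "\<dots> = (\<Prod>j\<in>J. \<integral>\<^sup>+y. u j (override_on (x j) y (insert i K)) \<partial>PiM UNIV (\<lambda>_. \<sigma>))"
      by (intro prod.cong refl, subst (2) S.nn_integral_fun_upd(1)[of _ i])
         (auto intro!: mo simp: override_on_upd(1)[OF insert.hyps(2)])
    finally show ?case .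
  qed
qed

end

section \<open>The inequality on the polydisc\<close>

definition polydisc_fun :: "('n::finite \<Rightarrow> complex) set" where "polydisc_fun = {x. \<forall>i. norm (x i) < 1}"
definition closed_polydisc_fun :: "('n::finite \<Rightarrow> complex) set" where "closed_polydisc_fun = {x. \<forall>i. norm (x i) \<le> 1}"

text \<open>Continuity gives measurability and limits, holomorphic slices give access to one
  variable; the argument in several variables uses nothing else about the functions.\<close>

definition sep_hol :: "(('n::finite \<Rightarrow> complex) \<Rightarrow> complex) \<Rightarrow> bool" where
  "sep_hol F \<longleftrightarrow> continuous_on polydisc_fun F \<and> (\<forall>x\<in>polydisc_fun. \<forall>i. (\<lambda>t. F (x(i := t))) holomorphic_on ball 0 1)"

definition rescale :: "real \<Rightarrow> ('n \<Rightarrow> complex) \<Rightarrow> 'n \<Rightarrow> complex" where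
  "rescale r x = (\<lambda>i. of_real r * x i)"

lemma rescale_upd: "rescale r (x(i := t)) = (rescale r x)(i := of_real r * t)"
  by (auto simp: rescale_def fun_eq_iff)

lemma polydisc_fun_upd: "x \<in> polydisc_fun \<Longrightarrow> norm t < 1 \<Longrightarrow> x(i := t) \<in> polydisc_fun"
  by (auto simp: polydisc_fun_def)

lemma rescale_closed_polydisc_fun: "x \<in> closed_polydisc_fun \<Longrightarrow> 0 \<le> r \<Longrightarrow> r < 1 \<Longrightarrow> rescale r x \<in> polydisc_fun"
proof -
  assume x: "x \<in> closed_polydisc_fun" and r: "0 \<le> r" "r < 1"
  have "r * norm (x i) < 1" for i
    using mult_left_mono[of "norm (x i)" 1 r] x r by (auto simp: closed_polydisc_fun_def)
  then show "rescale r x \<in> polydisc_fun" using r by (simp add: polydisc_fun_def rescale_def norm_mult)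
qed

lemma polydisc_fun_subset_closed_polydisc_fun: "polydisc_fun \<subseteq> closed_polydisc_fun"
  by (auto simp: polydisc_fun_def closed_polydisc_fun_def less_imp_le)

lemma polydisc_fun_sets: "polydisc_fun \<in> sets (borel :: ('n::finite \<Rightarrow> complex) measure)"
  and closed_polydisc_fun_sets: "closed_polydisc_fun \<in> sets (borel :: ('n::finite \<Rightarrow> complex) measure)"
proof -
  have "{x \<in> space borel_prod. \<forall>i::'n. norm (x i) < 1} \<in> sets (borel_prod :: ('n \<Rightarrow> complex) measure)"
    "{x \<in> space borel_prod. \<forall>i::'n. norm (x i) \<le> 1} \<in> sets (borel_prod :: ('n \<Rightarrow> complex) measure)"
    by measurable
  then show "polydisc_fun \<in> sets (borel :: ('n::finite \<Rightarrow> complex) measure)"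
    "closed_polydisc_fun \<in> sets (borel :: ('n::finite \<Rightarrow> complex) measure)"
    unfolding sets_borel_prod polydisc_fun_def closed_polydisc_fun_def by (simp_all add: space_PiM)
qed

lemma borel_measurable_borel_prod_indicator:
  fixes h :: "('n::finite \<Rightarrow> complex) \<Rightarrow> real"
  assumes "continuous_on S h" "S \<in> sets borel"
  shows "(\<lambda>x. ennreal (h x) * indicator S x) \<in> borel_measurable borel_prod"
  using indicator_ennreal_measurable[OF assms] measurable_cong_sets[OF sets_borel_prod refl] by blast

lemma continuous_on_rescale: "continuous_on S (rescale r :: ('n::finite \<Rightarrow> complex) \<Rightarrow> _)"
  unfolding rescale_def
  by (intro continuous_on_coordinatewise_then_product continuous_intros
        continuous_on_subset[OF continuous_on_product_coordinates]) auto

lemma borel_prob_circle: "borel_prob circle_haar"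
  by (intro borel_prob.intro prob_space_circle_haar borel_prob_axioms.intro sets_circle_haar)

lemma borel_prob_bergman: "m \<ge> 2 \<Longrightarrow> borel_prob (bergman_disc m)"
  by (intro borel_prob.intro prob_space_bergman_disc borel_prob_axioms.intro sets_bergman_disc)

lemma two_probs_disc_circle: "m \<ge> 2 \<Longrightarrow> two_probs (bergman_disc m) circle_haar"
  by (intro two_probs.intro borel_prob_circle borel_prob_bergman)

abbreviation bergman_prod :: "nat \<Rightarrow> ('n::finite \<Rightarrow> complex) measure" where
  "bergman_prod m \<equiv> PiM UNIV (\<lambda>_. bergman_disc m)"
abbreviation torus_prod :: "('n::finite \<Rightarrow> complex) measure" where
  "torus_prod \<equiv> PiM UNIV (\<lambda>_. circle_haar)"

context borel_prob
begin

lemma AE_all_components: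
  assumes Q: "{t. \<not> Q t} \<in> sets borel" and AE: "AE t in \<nu>. Q t"
  shows "AE y in PiM UNIV (\<lambda>_::'n::finite. \<nu>). \<forall>i. Q (y i)"
proof -
  have "AE y in PiM UNIV (\<lambda>_::'n. \<nu>). Q (y i)" for i
  proof -
    let ?N = "{y :: 'n \<Rightarrow> complex. \<not> Q (y i)}"
    have "(\<lambda>y. y i) -` {t. \<not> Q t} \<inter> space (borel_prod :: ('n \<Rightarrow> complex) measure) \<in> sets borel_prod"
      by (rule measurable_sets[where A = borel, OF _ Q]) simp
    then have N: "?N \<in> sets borel_prod" by (simp add: vimage_def space_PiM)
    have "AE y in PiM UNIV (\<lambda>_::'n. \<nu>). AE t in \<nu>. y(i := t) \<notin> ?N"
      using AE by simp
    from AE_fun_upd[OF N this] show ?thesis by simp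
  qed
  then show ?thesis by (subst AE_all_countable) (rule allI)
qed

text \<open>If the property failed throughout a box, the box would be null, but its measure is a
  product of positive numbers.\<close>

lemma AE_imp_dense:
  assumes AE: "AE y in PiM UNIV (\<lambda>_::'n::finite. \<nu>). \<phi> y"
    and pos: "\<And>i. 0 < emeasure \<nu> (ball (y0 i) e)"
  shows "\<exists>y. \<phi> y \<and> (\<forall>i. dist (y0 i) (y i) < e)"
proof (rule ccontr)
  assume no: "\<not> ?thesis"
  let ?B = "Pi\<^sub>E UNIV (\<lambda>i. ball (y0 i) e)"
  interpret product_sigma_finite "\<lambda>_::'n. \<nu>" by (rule product_sigma_finite_nu)
  have s: "?B \<in> sets (PiM UNIV (\<lambda>_::'n. \<nu>))"
    by (intro sets_PiM_I_finite) (auto simp: sets_nu)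
  have "AE y in PiM UNIV (\<lambda>_::'n. \<nu>). y \<notin> ?B"
    using AE by eventually_elim (use no in \<open>auto simp: PiE_iff\<close>)
  then have "emeasure (PiM UNIV (\<lambda>_::'n. \<nu>)) ?B = 0"
    using s by (subst (asm) AE_iff_null_sets[symmetric]) auto
  moreover have "emeasure (PiM UNIV (\<lambda>_::'n. \<nu>)) ?B = (\<Prod>i\<in>UNIV. emeasure \<nu> (ball (y0 i) e))"
    by (subst emeasure_PiM) (auto simp: sets_nu)
  moreover have "emeasure \<nu> (ball (y0 i) e) \<noteq> 0" for i using pos[of i] by (rule less_imp_neq[symmetric])
  then have "(\<Prod>i\<in>UNIV. emeasure \<nu> (ball (y0 i) e)) \<noteq> 0" by simp
  ultimately show False by simp
qed

end

lemma AE_bergman_prod: "m \<ge> 2 \<Longrightarrow> AE y in (bergman_prod m :: ('n::finite \<Rightarrow> complex) measure). y \<in> polydisc_fun"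
  unfolding polydisc_fun_def mem_Collect_eq
  by (intro borel_prob.AE_all_components borel_prob_bergman AE_bergman_disc) auto

lemma AE_torus_prod: "AE y in (torus_prod :: ('n::finite \<Rightarrow> complex) measure). \<forall>i. norm (y i) = 1"
  by (intro borel_prob.AE_all_components borel_prob_circle AE_circle_haar) auto

lemma sep_hol_slice:
  assumes F: "sep_hol F" and r: "0 < r" "r < 1" and x: "\<And>k. k \<noteq> i \<Longrightarrow> norm (x k) \<le> 1"
  shows "(\<lambda>t. F (rescale r (x(i := t)))) holomorphic_on ball 0 (1 / r)"
proof -
  have "x(i := 0) \<in> closed_polydisc_fun" using x by (auto simp: closed_polydisc_fun_def)
  then have "rescale r (x(i := 0)) \<in> polydisc_fun" using r by (intro rescale_closed_polydisc_fun) auto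
  then have "(\<lambda>t. F ((rescale r (x(i := 0)))(i := t))) holomorphic_on ball 0 1"
    using F by (simp add: sep_hol_def)
  then have "(\<lambda>t. F ((rescale r (x(i := 0)))(i := of_real r * t))) holomorphic_on ball 0 (1 / r)"
    by (rule holomorphic_on_compose_gen[unfolded o_def, rotated])
       (use r in \<open>auto intro!: holomorphic_intros simp: norm_mult field_simps\<close>)
  moreover have "(rescale r (x(i := 0)))(i := of_real r * t) = rescale r (x(i := t))" for t
    by (simp add: rescale_upd)
  ultimately show ?thesis by simp
qed

text \<open>For \<open>0 \<le> r < 1\<close>, \<open>rescale r\<close> maps the closed polydisc into
  the open one, where \<open>F\<close> is controlled. Vanishing outside makes the one-variable
  inequality true at every frozen point, as \<open>tensor_inequality\<close> demands.\<close>

definition cutoff :: "real \<Rightarrow> (('n::finite \<Rightarrow> complex) \<Rightarrow> complex) \<Rightarrow> real \<Rightarrow> ('n \<Rightarrow> complex) \<Rightarrow> ennreal" where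
  "cutoff p F r x = ennreal (norm (F (rescale r x)) powr p) * indicator closed_polydisc_fun x"

definition torus_mean :: "real \<Rightarrow> (('n::finite \<Rightarrow> complex) \<Rightarrow> complex) \<Rightarrow> real \<Rightarrow> ennreal" where
  "torus_mean p F r = (\<integral>\<^sup>+y. cutoff p F r y \<partial>torus_prod)"

lemma cutoff_measurable:
  assumes F: "sep_hol F" and p: "p > 0" and r: "0 < r" "r < 1"
  shows "cutoff p F r \<in> borel_measurable borel_prod"
proof -
  have "continuous_on closed_polydisc_fun (\<lambda>x. F (rescale r x))"
    using F r by (intro continuous_on_compose2[OF _ continuous_on_rescale, of polydisc_fun F]) (auto simp: sep_hol_def intro: rescale_closed_polydisc_fun)
  from borel_measurable_borel_prod_indicator[OF continuous_on_norm_powr[OF this p] closed_polydisc_fun_sets]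
  show ?thesis by (simp add: cutoff_def[abs_def])
qed

lemma cutoff_slice_circle:
  assumes "\<And>k. k \<noteq> i \<Longrightarrow> norm (x k) \<le> 1"
  shows "(\<integral>\<^sup>+t. cutoff p F r (x(i := t)) \<partial>circle_haar) = circle_mean p (\<lambda>t. F (rescale r (x(i := t))))"
  unfolding circle_mean_def cutoff_def
proof (rule nn_integral_cong_AE, rule eventually_mono[OF AE_circle_haar])
  fix t :: complex assume t: "norm t = 1"
  then have "x(i := t) \<in> closed_polydisc_fun" using assms by (auto simp: closed_polydisc_fun_def)
  then show "ennreal (norm (F (rescale r (x(i := t)))) powr p) * indicator closed_polydisc_fun (x(i := t))
    = ennreal (norm (F (rescale r (x(i := t)))) powr p) * indicator (sphere 0 1) t"
    using t by simp
qed

lemma cutoff_slice_disc: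
  assumes J: "finite J" and x: "\<And>j k. j \<in> J \<Longrightarrow> k \<noteq> i \<Longrightarrow> norm (x j k) \<le> 1"
  shows "(\<integral>\<^sup>+t. (\<Prod>j\<in>J. cutoff (p j) (F j) r ((x j)(i := t))) \<partial>bergman_disc m)
    = (\<integral>\<^sup>+t. ennreal (\<Prod>j\<in>J. norm (F j (rescale r ((x j)(i := t)))) powr p j) * indicator (ball 0 1) t \<partial>bergman_disc m)"
proof (rule nn_integral_cong_AE, rule eventually_mono[OF AE_bergman_disc])
  fix t :: complex assume t: "norm t < 1"
  then have "(x j)(i := t) \<in> closed_polydisc_fun" if "j \<in> J" for j using x[OF that] by (auto simp: closed_polydisc_fun_def)
  then show "(\<Prod>j\<in>J. cutoff (p j) (F j) r ((x j)(i := t)))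
    = ennreal (\<Prod>j\<in>J. norm (F j (rescale r ((x j)(i := t)))) powr p j) * indicator (ball 0 1) t"
    using t by (simp add: cutoff_def prod_ennreal)
qed

lemma cutoff_zero:
  assumes J: "finite J" and j: "j \<in> J" "k \<noteq> i" "\<not> norm (x j k) \<le> 1"
  shows "(\<Prod>j\<in>J. cutoff (p j) (F j) r ((x j)(i := t))) = 0"
proof (rule prod_zero[OF J])
  have "(x j)(i := t) \<notin> closed_polydisc_fun" using j by (auto simp: closed_polydisc_fun_def)
  then show "\<exists>a\<in>J. cutoff (p a) (F a) r ((x a)(i := t)) = 0"
    using j(1) by (intro bexI[of _ j]) (auto simp: cutoff_def)
qed

text \<open>Frozen coordinates in the closed disc give slices holomorphic up to radius
  \<open>1 / r > 1\<close>; a frozen coordinate outside makes a factor, and with it the left side,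
  zero.\<close>

lemma cutoff_one_variable:
  assumes J: "finite J" "card J \<ge> 2" and p: "\<And>j. j \<in> J \<Longrightarrow> p j > 0"
    and F: "\<And>j. j \<in> J \<Longrightarrow> sep_hol (F j)" and r: "0 < r" "r < 1"
  shows "(\<integral>\<^sup>+t. (\<Prod>j\<in>J. cutoff (p j) (F j) r ((x j)(i := t))) \<partial>bergman_disc (card J))
    \<le> (\<Prod>j\<in>J. \<integral>\<^sup>+t. cutoff (p j) (F j) r ((x j)(i := t)) \<partial>circle_haar)"
proof (cases "\<forall>j\<in>J. \<forall>k. k \<noteq> i \<longrightarrow> norm (x j k) \<le> 1")
  case True
  have "(\<integral>\<^sup>+t. (\<Prod>j\<in>J. cutoff (p j) (F j) r ((x j)(i := t))) \<partial>bergman_disc (card J))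
      = (\<integral>\<^sup>+t. ennreal (\<Prod>j\<in>J. norm (F j (rescale r ((x j)(i := t)))) powr p j) * indicator (ball 0 1) t \<partial>bergman_disc (card J))"
    using True by (intro cutoff_slice_disc J) auto
  also have "\<dots> \<le> (\<Prod>j\<in>J. circle_mean (p j) (\<lambda>t. F j (rescale r ((x j)(i := t)))))"
    using True r by (intro disc_product_inequality[where R = "1 / r"] J p sep_hol_slice F) auto
  also have "\<dots> = (\<Prod>j\<in>J. \<integral>\<^sup>+t. cutoff (p j) (F j) r ((x j)(i := t)) \<partial>circle_haar)"
    using True by (intro prod.cong refl cutoff_slice_circle[symmetric]) auto
  finally show ?thesis .
next
  case False
  then obtain j k where j: "j \<in> J" "k \<noteq> i" "\<not> norm (x j k) \<le> 1" by auto
  show ?thesis unfolding cutoff_zero[where i = i and x = x, OF J(1) j] by simp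
qed

lemma polydisc_inequality_dilated:
  assumes J: "finite J" "card J \<ge> 2" and p: "\<And>j. j \<in> J \<Longrightarrow> p j > 0"
    and F: "\<And>j. j \<in> J \<Longrightarrow> sep_hol (F j)" and r: "0 < r" "r < 1"
  shows "(\<integral>\<^sup>+y. (\<Prod>j\<in>J. cutoff (p j) (F j) r y) \<partial>bergman_prod (card J)) \<le> (\<Prod>j\<in>J. torus_mean (p j) (F j) r)"
proof -
  interpret two_probs "bergman_disc (card J)" circle_haar by (rule two_probs_disc_circle[OF J(2)])
  show ?thesis
    using tensor_inequality[where u = "\<lambda>j. cutoff (p j) (F j) r" and J = J and K = UNIV,
        OF J(1) cutoff_measurable cutoff_one_variable[OF J p F r], OF F p r]
    by (simp add: override_on_def torus_mean_def)
qed

lemma tendsto_funI: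
  fixes f :: "'a \<Rightarrow> 'i \<Rightarrow> 'b::topological_space"
  assumes "\<And>i. ((\<lambda>n. f n i) \<longlongrightarrow> l i) A"
  shows "(f \<longlongrightarrow> l) A"
proof -
  have "limitin (product_topology (\<lambda>_. euclidean) UNIV) f l A"
    using assms by (simp add: limitin_componentwise)
  then show ?thesis by (simp add: euclidean_product_topology)
qed

lemma rescale_lim:
  assumes "x \<in> polydisc_fun" and h: "continuous_on polydisc_fun (h :: ('n::finite \<Rightarrow> complex) \<Rightarrow> 'b::topological_space)"
  shows "(\<lambda>n. h (rescale (radius_seq n) x)) \<longlonglongrightarrow> h x"
proof (rule continuous_on_tendsto_compose[OF h])
  have "(\<lambda>n. rescale (radius_seq n) x i) \<longlonglongrightarrow> x i" for i
    unfolding rescale_def using tendsto_mult[OF tendsto_of_real[OF radius_seq(3)] tendsto_const[of "x i"]] by simp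
  then show "(\<lambda>n. rescale (radius_seq n) x) \<longlonglongrightarrow> x"
    by (rule tendsto_funI)
  show "\<forall>\<^sub>F n in sequentially. rescale (radius_seq n) x \<in> polydisc_fun"
    using assms(1) polydisc_fun_subset_closed_polydisc_fun radius_seq(1,2) by (intro always_eventually allI rescale_closed_polydisc_fun) (auto intro: less_imp_le)
qed (rule assms(1))

definition polydisc_integral :: "nat set \<Rightarrow> (nat \<Rightarrow> real) \<Rightarrow> (nat \<Rightarrow> ('n::finite \<Rightarrow> complex) \<Rightarrow> complex) \<Rightarrow> ennreal" where
  "polydisc_integral J p F = (\<integral>\<^sup>+y. ennreal (\<Prod>j\<in>J. norm (F j y) powr p j) * indicator polydisc_fun y \<partial>bergman_prod (card J))"

lemma continuous_on_prod_powr: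
  assumes "\<And>j. j \<in> J \<Longrightarrow> p j > 0" "\<And>j. j \<in> J \<Longrightarrow> sep_hol (F j)"
  shows "continuous_on polydisc_fun (\<lambda>y. \<Prod>j\<in>J. norm (F j y) powr p j)"
  using assms by (intro continuous_on_prod continuous_on_norm_powr) (auto simp: sep_hol_def)

lemma polydisc_integral_le_liminf:
  assumes J: "finite J" "card J \<ge> 2" and p: "\<And>j. j \<in> J \<Longrightarrow> p j > 0"
    and F: "\<And>j. j \<in> J \<Longrightarrow> sep_hol (F j)"
  shows "polydisc_integral J p F \<le> liminf (\<lambda>n. \<integral>\<^sup>+y. (\<Prod>j\<in>J. cutoff (p j) (F j) (radius_seq n) y) \<partial>bergman_prod (card J))"
proof -
  interpret two_probs "bergman_disc (card J)" circle_haar by (rule two_probs_disc_circle[OF J(2)])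
  have "polydisc_integral J p F = (\<integral>\<^sup>+y. liminf (\<lambda>n. \<Prod>j\<in>J. cutoff (p j) (F j) (radius_seq n) y) \<partial>bergman_prod (card J))"
    unfolding polydisc_integral_def
  proof (rule nn_integral_cong_AE, rule eventually_mono[OF AE_bergman_prod[OF J(2)]])
    fix y :: "'a \<Rightarrow> complex" assume y: "y \<in> polydisc_fun"
    have "(\<lambda>n. ennreal (\<Prod>j\<in>J. norm (F j (rescale (radius_seq n) y)) powr p j)) \<longlonglongrightarrow> ennreal (\<Prod>j\<in>J. norm (F j y) powr p j)"
      by (intro tendsto_ennrealI rescale_lim[OF y continuous_on_prod_powr[OF p F]])
    moreover have "(\<Prod>j\<in>J. cutoff (p j) (F j) (radius_seq n) y) = ennreal (\<Prod>j\<in>J. norm (F j (rescale (radius_seq n) y)) powr p j)" for n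
      using y polydisc_fun_subset_closed_polydisc_fun by (auto simp: cutoff_def prod_ennreal)
    ultimately show "ennreal (\<Prod>j\<in>J. norm (F j y) powr p j) * indicator polydisc_fun y
      = liminf (\<lambda>n. \<Prod>j\<in>J. cutoff (p j) (F j) (radius_seq n) y)"
      using y lim_imp_Liminf[OF trivial_limit_sequentially] by fastforce
  qed
  also have "\<dots> \<le> liminf (\<lambda>n. \<integral>\<^sup>+y. (\<Prod>j\<in>J. cutoff (p j) (F j) (radius_seq n) y) \<partial>bergman_prod (card J))"
    by (intro nn_integral_liminf) (auto intro!: borel_measurable_prod_ennreal cutoff_measurable F p radius_seq)
  finally show ?thesis .
qed

theorem polydisc_inequality:
  assumes J: "finite J" "card J \<ge> 2" and p: "\<And>j. j \<in> J \<Longrightarrow> p j > 0"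
    and F: "\<And>j. j \<in> J \<Longrightarrow> sep_hol (F j)" and N: "\<And>j n. j \<in> J \<Longrightarrow> torus_mean (p j) (F j) (radius_seq n) \<le> N j"
  shows "polydisc_integral J p F \<le> (\<Prod>j\<in>J. N j)"
proof -
  have "(\<integral>\<^sup>+y. (\<Prod>j\<in>J. cutoff (p j) (F j) (radius_seq n) y) \<partial>bergman_prod (card J)) \<le> (\<Prod>j\<in>J. N j)" for n
    by (rule order_trans[OF polydisc_inequality_dilated[OF J p F radius_seq(1,2)]]) (simp_all add: prod_mono_ennreal N)
  then have "liminf (\<lambda>n. \<integral>\<^sup>+y. (\<Prod>j\<in>J. cutoff (p j) (F j) (radius_seq n) y) \<partial>bergman_prod (card J)) \<le> (\<Prod>j\<in>J. N j)"
    by (intro Liminf_le always_eventually allI) auto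
  with polydisc_integral_le_liminf[OF J p F] show ?thesis by (rule order_trans)
qed

lemma fsigma_unit_disc: "fsigma (ball (0::complex) 1)"
proof -
  have "(\<Union>n. cball 0 (radius_seq n)) = ball (0::complex) 1"
  proof (intro equalityI subsetI)
    fix z :: complex assume "z \<in> ball 0 1"
    then have "\<forall>\<^sub>F n in sequentially. norm z < radius_seq n" using order_tendstoD(1)[OF radius_seq(3)] by simp
    then obtain n where "norm z < radius_seq n" by (auto simp: eventually_sequentially)
    then show "z \<in> (\<Union>n. cball 0 (radius_seq n))" by (auto intro!: exI[of _ n])
  qed (use radius_seq(2) le_less_trans in \<open>auto\<close>)
  moreover have "fsigma (\<Union>n. cball (0::complex) (radius_seq n))" by (intro fsigma.intros closed_cball)
  ultimately show ?thesis by simp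
qed

text \<open>The coordinates of \<open>x0\<close> are replaced by random ones one after another. Each
  replacement moves along a slice that is not identically zero, so its zeros are countable and hence
  null.\<close>

lemma sep_hol_nonzero_AE:
  assumes m: "m \<ge> 2" and F: "sep_hol F" and x0: "x0 \<in> polydisc_fun" "F x0 \<noteq> 0"
  shows "AE y in (bergman_prod m :: ('n::finite \<Rightarrow> complex) measure). F y \<noteq> 0"
proof -
  interpret borel_prob "bergman_disc m" by (rule borel_prob_bergman[OF m])
  have open0: "{x \<in> polydisc_fun. F x = 0} \<in> sets borel_prod"
  proof -
    have "(\<lambda>x. ennreal (norm (F x)) * indicator polydisc_fun x) \<in> borel_measurable borel_prod"
      using F by (intro borel_measurable_borel_prod_indicator polydisc_fun_sets continuous_intros) (auto simp: sep_hol_def)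
    then have "(\<lambda>x. ennreal (norm (F x)) * indicator polydisc_fun x) -` {0} \<inter> space borel_prod \<inter> polydisc_fun \<in> sets borel_prod"
      using polydisc_fun_sets unfolding sets_borel_prod[symmetric] by (intro sets.Int measurable_sets) auto
    also have "(\<lambda>x. ennreal (norm (F x)) * indicator polydisc_fun x) -` {0} \<inter> space borel_prod \<inter> polydisc_fun = {x \<in> polydisc_fun. F x = 0}"
      by (auto simp: space_PiM)
    finally show ?thesis .
  qed
  have "AE y in bergman_prod m. override_on x0 y K \<notin> {x \<in> polydisc_fun. F x = 0}" if "finite K" for K :: "'n set"
    using that
  proof (induction K rule: finite_induct)
    case empty
    then show ?case using x0 by simp
  next
    case (insert i K)
    let ?Z = "{x \<in> polydisc_fun. F x = 0}"
    have N: "(\<lambda>y. override_on x0 y (insert i K)) -` ?Z \<inter> space borel_prod \<in> sets borel_prod"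
      by (rule measurable_sets[OF measurable_override_on open0])
    have "AE y in bergman_prod m. AE t in bergman_disc m. y(i := t) \<notin> (\<lambda>y. override_on x0 y (insert i K)) -` ?Z \<inter> space borel_prod"
      using insert.IH AE_bergman_prod[OF m]
    proof eventually_elim
      case (elim y)
      define x where "x = override_on x0 y K"
      have x: "x \<in> polydisc_fun" using x0 elim by (auto simp: x_def polydisc_fun_def override_on_def)
      have Fx: "F x \<noteq> 0" using elim x by (auto simp: x_def)
      have hol: "(\<lambda>t. F (x(i := t))) holomorphic_on ball 0 1" using F x by (auto simp: sep_hol_def)
      have xi: "norm (x i) < 1" using x by (auto simp: polydisc_fun_def)
      have "countable {t \<in> ball 0 1. F (x(i := t)) = 0}"
      proof (cases "(\<lambda>t. F (x(i := t))) constant_on ball 0 1")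
        case True
        then have "{t \<in> ball 0 1. F (x(i := t)) = 0} = {}"
          using Fx xi unfolding constant_on_def by force
        then show ?thesis by (simp only: countable_empty)
      next
        case False
        then show ?thesis by (intro holomorphic_countable_zeros hol fsigma_unit_disc) auto
      qed
      then have "AE t in lborel. t \<notin> {t \<in> ball 0 1. F (x(i := t)) = 0}"
        by (intro AE_not_in countable_imp_null_set_lborel)
      then have "AE t in bergman_disc m. t \<notin> {t \<in> ball 0 1. F (x(i := t)) = 0}"
        unfolding bergman_disc_def by (subst AE_density) (measurable, auto)
      then show ?case
        using AE_bergman_disc
      proof eventually_elim
        case (elim t)
        have "override_on x0 (y(i := t)) (insert i K) = x(i := t)"
          using insert.hyps by (auto simp: x_def override_on_def fun_eq_iff)
        then show ?case using elim by auto
      qed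
    qed
    from AE_fun_upd[OF N this] show ?case by eventually_elim (auto simp: space_PiM)
  qed
  from this[of UNIV, OF finite] AE_bergman_prod[OF m] show ?thesis
    by eventually_elim (auto simp: override_on_def)
qed

section \<open>Equality on almost every slice\<close>

lemma nn_integral_eq_imp_AE_eq:
  assumes [measurable]: "f \<in> borel_measurable M" "g \<in> borel_measurable M"
    and le: "AE x in M. f x \<le> g x" and int: "(\<integral>\<^sup>+x. g x \<partial>M) \<le> (\<integral>\<^sup>+x. f x \<partial>M)" "(\<integral>\<^sup>+x. f x \<partial>M) < \<top>"
  shows "AE x in M. f x = g x"
proof -
  have "(\<integral>\<^sup>+x. g x - f x \<partial>M) = (\<integral>\<^sup>+x. g x \<partial>M) - (\<integral>\<^sup>+x. f x \<partial>M)"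
    using le int(2) by (intro nn_integral_diff) auto
  also have "\<dots> = 0" by (rule diff_eq_0_ennreal[OF le_less_trans[OF int] int(1)])
  finally have "AE x in M. g x - f x = 0" by (subst (asm) nn_integral_0_iff_AE) auto
  moreover have "AE x in M. f x \<noteq> \<infinity>"
    using int(2) by (intro nn_integral_noteq_infinite) auto
  ultimately show ?thesis
    using le by eventually_elim (auto simp: diff_eq_0_iff_ennreal intro: antisym)
qed

text \<open>Fatou applied once, to the integral over independent copies that represents the
  product.\<close>

lemma prod_nn_integral_liminf:
  fixes g :: "'j \<Rightarrow> nat \<Rightarrow> 'a \<Rightarrow> ennreal"
  assumes J: "finite J" and R: "sigma_finite_measure R"
    and g: "\<And>j k. j \<in> J \<Longrightarrow> g j k \<in> borel_measurable R" and G: "\<And>j. j \<in> J \<Longrightarrow> G j \<in> borel_measurable R"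
    and lim: "\<And>j s. j \<in> J \<Longrightarrow> (\<lambda>k. g j k s) \<longlonglongrightarrow> G j s" and fin: "\<And>j s. j \<in> J \<Longrightarrow> G j s < \<top>"
  shows "(\<Prod>j\<in>J. \<integral>\<^sup>+s. G j s \<partial>R) \<le> liminf (\<lambda>k. \<Prod>j\<in>J. \<integral>\<^sup>+s. g j k s \<partial>R)"
proof -
  have m: "(\<lambda>s. \<Prod>j\<in>J. g j k (s j)) \<in> borel_measurable (PiM J (\<lambda>_. R))" for k
  proof (rule borel_measurable_prod_ennreal)
    fix j assume j: "j \<in> J"
    show "(\<lambda>s. g j k (s j)) \<in> borel_measurable (PiM J (\<lambda>_. R))"
      by (rule measurable_compose[OF measurable_component_singleton[OF j] g[OF j]])
  qed
  have "(\<Prod>j\<in>J. \<integral>\<^sup>+s. G j s \<partial>R) = (\<integral>\<^sup>+s. (\<Prod>j\<in>J. G j (s j)) \<partial>PiM J (\<lambda>_. R))"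
    by (rule prod_nn_integral[OF J R G])
  also have "\<dots> = (\<integral>\<^sup>+s. liminf (\<lambda>k. \<Prod>j\<in>J. g j k (s j)) \<partial>PiM J (\<lambda>_. R))"
  proof (rule nn_integral_cong)
    fix s :: "'j \<Rightarrow> 'a"
    have "(\<lambda>k. \<Prod>j\<in>J. g j k (s j)) \<longlonglongrightarrow> (\<Prod>j\<in>J. G j (s j))"
      by (intro tendsto_prod_ennreal lim fin)
    from lim_imp_Liminf[OF trivial_limit_sequentially this]
    show "(\<Prod>j\<in>J. G j (s j)) = liminf (\<lambda>k. \<Prod>j\<in>J. g j k (s j))" by simp
  qed
  also have "\<dots> \<le> liminf (\<lambda>k. \<integral>\<^sup>+s. (\<Prod>j\<in>J. g j k (s j)) \<partial>PiM J (\<lambda>_. R))"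
    by (rule nn_integral_liminf[OF m])
  also have "\<dots> = liminf (\<lambda>k. \<Prod>j\<in>J. \<integral>\<^sup>+s. g j k s \<partial>R)"
    by (simp add: prod_nn_integral[OF J R g])
  finally show ?thesis .
qed

lemma upd_override: "y(l := s) = override_on (x(l := s)) y (UNIV - {l})"
  by (auto simp: override_on_def fun_eq_iff)

text \<open>Coordinate \<open>l\<close> is integrated over the circle separately in each factor, the
  others by \<open>tensor_inequality\<close> with \<open>l\<close> frozen. The left side is the
  intermediate quantity through which equality descends to slices.\<close>

lemma cutoff_average:
  assumes J: "finite J" "card J \<ge> 2" and p: "\<And>j. j \<in> J \<Longrightarrow> p j > 0"
    and F: "\<And>j. j \<in> J \<Longrightarrow> sep_hol (F j :: ('n::finite \<Rightarrow> complex) \<Rightarrow> complex)" and r: "0 < r" "r < 1"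
  shows "(\<integral>\<^sup>+y. (\<Prod>j\<in>J. \<integral>\<^sup>+s. cutoff (p j) (F j) r (y(l := s)) \<partial>circle_haar) \<partial>bergman_prod (card J))
    \<le> (\<Prod>j\<in>J. torus_mean (p j) (F j) r)"
proof -
  interpret two_probs "bergman_disc (card J)" circle_haar by (rule two_probs_disc_circle[OF J(2)])
  interpret PM: prob_space "bergman_prod (card J) :: ('n \<Rightarrow> complex) measure" by (rule M.prob_space_power)
  interpret PS: prob_space "torus_prod :: ('n \<Rightarrow> complex) measure" by (rule S.prob_space_power)
  let ?u = "\<lambda>j. cutoff (p j) (F j) r"
  have u: "?u j \<in> borel_measurable borel_prod" if "j \<in> J" for j using that by (intro cutoff_measurable F p r)
  have m: "(\<lambda>(s, y). ?u j (y(l := s))) \<in> borel_measurable (borel \<Otimes>\<^sub>M borel_prod)" if "j \<in> J" for j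
    using u[OF that] unfolding split_beta' by measurable
  have "(\<integral>\<^sup>+y. (\<Prod>j\<in>J. \<integral>\<^sup>+s. ?u j (y(l := s)) \<partial>circle_haar) \<partial>bergman_prod (card J))
     = (\<integral>\<^sup>+s. \<integral>\<^sup>+y. (\<Prod>j\<in>J. ?u j (y(l := s j))) \<partial>bergman_prod (card J) \<partial>PiM J (\<lambda>_. circle_haar))"
    using m by (intro prod_nn_integral_swap J PM.sigma_finite_measure_axioms S.sigma_finite_measure_axioms)
      (simp add: measurable_pair_power)
  also have "\<dots> \<le> (\<integral>\<^sup>+s. (\<Prod>j\<in>J. \<integral>\<^sup>+y. ?u j (y(l := s j)) \<partial>torus_prod) \<partial>PiM J (\<lambda>_. circle_haar))"
  proof (rule nn_integral_mono)
    fix s :: "'a \<Rightarrow> complex"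
    have "(\<integral>\<^sup>+y. (\<Prod>j\<in>J. ?u j (override_on ((\<lambda>_. 0)(l := s j)) y (UNIV - {l}))) \<partial>bergman_prod (card J))
      \<le> (\<Prod>j\<in>J. \<integral>\<^sup>+y. ?u j (override_on ((\<lambda>_. 0)(l := s j)) y (UNIV - {l})) \<partial>torus_prod)"
      by (rule tensor_inequality[OF J(1) u cutoff_one_variable[OF J p F r]])
    then show "(\<integral>\<^sup>+y. (\<Prod>j\<in>J. ?u j (y(l := s j))) \<partial>bergman_prod (card J)) \<le> (\<Prod>j\<in>J. \<integral>\<^sup>+y. ?u j (y(l := s j)) \<partial>torus_prod)"
      by (simp only: upd_override[of _ l, symmetric])
  qed
  also have "\<dots> = (\<Prod>j\<in>J. \<integral>\<^sup>+s. \<integral>\<^sup>+y. ?u j (y(l := s)) \<partial>torus_prod \<partial>circle_haar)"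
  proof (intro prod_nn_integral[symmetric] J S.sigma_finite_measure_axioms)
    fix j assume j: "j \<in> J"
    have "(\<lambda>(s, y). ?u j (y(l := s))) \<in> borel_measurable (circle_haar \<Otimes>\<^sub>M (torus_prod :: ('n \<Rightarrow> complex) measure))"
      using m[OF j] by (simp add: measurable_pair_power)
    from PS.borel_measurable_nn_integral_fst[OF this]
    show "(\<lambda>s. \<integral>\<^sup>+y. ?u j (y(l := s)) \<partial>torus_prod) \<in> borel_measurable circle_haar" by simp
  qed
  also have "\<dots> = (\<Prod>j\<in>J. torus_mean (p j) (F j) r)"
    unfolding torus_mean_def by (intro prod.cong refl S.nn_integral_fun_upd(2)[symmetric] u)
  finally show ?thesis .
qed

text \<open>In the proof \<open>V y\<close> is the slice integral over the disc and
  \<open>Q n y\<close> the product of slice means at radius \<open>radius_seq n\<close>. One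
  variable gives \<open>V y \<le> (SUP n. Q n y)\<close>, while the integral of the supremum is at
  most that of \<open>V\<close>; so they agree almost everywhere, and
  \<open>disc_product_equality\<close> applies to almost every slice.\<close>

lemma slice_equality_AE:
  fixes F :: "nat \<Rightarrow> ('n::finite \<Rightarrow> complex) \<Rightarrow> complex"
  assumes J: "finite J" "card J \<ge> 2" and p: "\<And>j. j \<in> J \<Longrightarrow> p j > 0"
    and F: "\<And>j. j \<in> J \<Longrightarrow> sep_hol (F j)" and N: "\<And>j n. j \<in> J \<Longrightarrow> torus_mean (p j) (F j) (radius_seq n) \<le> N j"
    and Nfin: "\<And>j. j \<in> J \<Longrightarrow> N j < \<top>" and eq: "(\<Prod>j\<in>J. N j) \<le> polydisc_integral J p F"
    and nz: "\<And>j. j \<in> J \<Longrightarrow> \<exists>x\<in>polydisc_fun. F j x \<noteq> 0"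
  shows "AE y in bergman_prod (card J). \<exists>q. norm q < 1 \<and> (\<forall>j\<in>J. \<forall>t. norm t < 1 \<longrightarrow>
    F j (y(l := t)) = F j (y(l := 0)) * (1 - q * t) powr (- of_real (2 / p j)))"
proof -
  interpret two_probs "bergman_disc (card J)" circle_haar by (rule two_probs_disc_circle[OF J(2)])
  interpret PM: prob_space "bergman_prod (card J) :: ('n \<Rightarrow> complex) measure" by (rule M.prob_space_power)
  define w where "w j x = ennreal (norm (F j x) powr p j) * indicator polydisc_fun x" for j x
  have w: "w j \<in> borel_measurable borel_prod" if "j \<in> J" for j
    unfolding w_def[abs_def] using F[OF that] p[OF that]
    by (intro borel_measurable_borel_prod_indicator polydisc_fun_sets continuous_on_norm_powr) (auto simp: sep_hol_def)
  define Q where "Q n y = (\<Prod>j\<in>J. \<integral>\<^sup>+s. w j (y(l := of_real (radius_seq n) * s)) \<partial>circle_haar) * indicator polydisc_fun y" for n y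
  define W where "W y = ennreal (\<Prod>j\<in>J. norm (F j y) powr p j) * indicator polydisc_fun y" for y
  have W: "W \<in> borel_measurable borel_prod"
    unfolding W_def[abs_def] by (intro borel_measurable_borel_prod_indicator polydisc_fun_sets continuous_on_prod_powr p F)
  define V where "V y = (\<integral>\<^sup>+t. W (y(l := t)) \<partial>bergman_disc (card J))" for y
  have hol: "(\<lambda>t. F j (y(l := t))) holomorphic_on ball 0 1" if "j \<in> J" "y \<in> polydisc_fun" for j y
    using F[OF that(1)] that(2) by (simp add: sep_hol_def)
  have indPD: "indicator polydisc_fun (y(l := t)) = (indicator (ball 0 1) t :: ennreal)" if "y \<in> polydisc_fun" for y t
    using that by (auto simp: polydisc_fun_def split: split_indicator)
  have Qm: "Q n \<in> borel_measurable borel_prod" for n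
  proof -
    have "(\<lambda>y. \<integral>\<^sup>+s. w j (y(l := of_real (radius_seq n) * s)) \<partial>circle_haar) \<in> borel_measurable borel_prod" if "j \<in> J" for j
    proof -
      have "(\<lambda>(y, s). w j (y(l := of_real (radius_seq n) * s))) \<in> borel_measurable (borel_prod \<Otimes>\<^sub>M circle_haar)"
        using w[OF that] unfolding split_beta' by measurable
      from S.borel_measurable_nn_integral_fst[OF this] show ?thesis by simp
    qed
    moreover have "polydisc_fun \<in> sets (borel_prod :: ('n \<Rightarrow> complex) measure)" by (simp add: sets_borel_prod polydisc_fun_sets)
    ultimately show ?thesis unfolding Q_def[abs_def]
      by (intro borel_measurable_times_ennreal borel_measurable_prod_ennreal borel_measurable_indicator)
  qed
  have Vm: "V \<in> borel_measurable borel_prod"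
  proof -
    have "(\<lambda>(y, t). W (y(l := t))) \<in> borel_measurable (borel_prod \<Otimes>\<^sub>M bergman_disc (card J))"
      using W unfolding split_beta' by measurable
    from M.borel_measurable_nn_integral_fst[OF this] show ?thesis by (simp add: V_def[abs_def])
  qed
  have pintV: "polydisc_integral J p F = (\<integral>\<^sup>+y. V y \<partial>bergman_prod (card J))"
    unfolding polydisc_integral_def V_def W_def[symmetric] by (rule M.nn_integral_fun_upd(1)[OF W])
  have wc: "(\<integral>\<^sup>+s. w j (y(l := of_real (radius_seq n) * s)) \<partial>circle_haar) = circle_mean (p j) (\<lambda>s. F j (y(l := of_real (radius_seq n) * s)))"
    if "y \<in> polydisc_fun" for j y n
    unfolding circle_mean_def
    by (rule nn_integral_cong_AE, rule eventually_mono[OF AE_circle_haar])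
       (use radius_seq(1,2)[of n] that in \<open>auto simp: w_def indPD norm_mult\<close>)
  have Qc: "Q n y = (\<Prod>j\<in>J. circle_mean (p j) (\<lambda>s. F j (y(l := of_real (radius_seq n) * s))))" if "y \<in> polydisc_fun" for n y
    using that by (simp add: Q_def wc)
  have Qinc: "Q n y \<le> Q n' y" if "n \<le> n'" for n n' y
  proof (cases "y \<in> polydisc_fun")
    case True
    show ?thesis unfolding Qc[OF True]
      using radius_seq(1,2)[of n] radius_seq(1,2)[of n'] radius_seq(4)[OF that]
      by (intro prod_mono_ennreal circle_mean_mono_radius hol p True) auto
  qed (simp add: Q_def)
  have Vc: "V y = (\<integral>\<^sup>+t. ennreal (\<Prod>j\<in>J. norm (F j (y(l := t))) powr p j) * indicator (ball 0 1) t \<partial>bergman_disc (card J))"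
    if "y \<in> polydisc_fun" for y
    unfolding V_def W_def indPD[OF that] ..
  \<comment> \<open>The disc inequality is available for dilations of the slice; Fatou removes the
    dilation on the left.\<close>
  have VQ: "V y \<le> (SUP n. Q n y)" if y: "y \<in> polydisc_fun" for y
  proof -
    let ?g = "\<lambda>n t. ennreal (\<Prod>j\<in>J. norm (F j (y(l := of_real (radius_seq n) * t))) powr p j) * indicator (ball 0 1) t"
    have contg: "continuous_on (ball 0 1) (\<lambda>t. \<Prod>j\<in>J. norm (F j (y(l := t))) powr p j)"
      by (intro continuous_on_prod continuous_on_norm_powr p holomorphic_on_imp_continuous_on hol y)
    have rb: "of_real (radius_seq n) * t \<in> ball 0 1" if "norm t < 1" for n and t :: complex
      using radius_seq(1,2)[of n] that mult_strict_mono'[of "radius_seq n" 1 "norm t" 1] by (simp add: norm_mult)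
    have "V y = (\<integral>\<^sup>+t. liminf (\<lambda>n. ?g n t) \<partial>bergman_disc (card J))"
      unfolding Vc[OF y]
    proof (rule nn_integral_cong)
      fix t :: complex
      show "ennreal (\<Prod>j\<in>J. norm (F j (y(l := t))) powr p j) * indicator (ball 0 1) t = liminf (\<lambda>n. ?g n t)"
      proof (cases "norm t < 1")
        case True
        have "(\<lambda>n. of_real (radius_seq n) * t) \<longlonglongrightarrow> t"
          using tendsto_mult[OF tendsto_of_real[OF radius_seq(3)] tendsto_const[of t]] by simp
        then have "(\<lambda>n. \<Prod>j\<in>J. norm (F j (y(l := of_real (radius_seq n) * t))) powr p j) \<longlonglongrightarrow> (\<Prod>j\<in>J. norm (F j (y(l := t))) powr p j)"
          by (rule continuous_on_tendsto_compose[OF contg]) (use True rb in auto)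
        from lim_imp_Liminf[OF trivial_limit_sequentially tendsto_ennrealI[OF this]]
        show ?thesis using True by simp
      qed (simp add: Liminf_const)
    qed
    also have "\<dots> \<le> liminf (\<lambda>n. \<integral>\<^sup>+t. ?g n t \<partial>bergman_disc (card J))"
    proof (rule nn_integral_liminf)
      fix n
      have "continuous_on (ball 0 1) (\<lambda>t. \<Prod>j\<in>J. norm (F j (y(l := of_real (radius_seq n) * t))) powr p j)"
        by (rule continuous_on_compose2[OF contg]) (use rb in \<open>auto intro!: continuous_intros\<close>)
      then show "?g n \<in> borel_measurable (bergman_disc (card J))"
        by (simp add: indicator_ennreal_measurable)
    qed
    also have "\<dots> \<le> (SUP n. Q n y)"
    proof (intro Liminf_le always_eventually allI)
      fix n
      have "(\<integral>\<^sup>+t. ?g n t \<partial>bergman_disc (card J)) \<le> (\<Prod>j\<in>J. circle_mean (p j) (\<lambda>s. F j (y(l := of_real (radius_seq n) * s))))"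
      proof (rule disc_product_inequality[where R = "1 / radius_seq n", OF J p])
        fix j assume "j \<in> J"
        show "(\<lambda>t. F j (y(l := of_real (radius_seq n) * t))) holomorphic_on ball 0 (1 / radius_seq n)"
          by (rule holomorphic_on_compose_gen[OF _ hol[OF \<open>j \<in> J\<close> y], unfolded o_def])
             (use radius_seq(1)[of n] in \<open>auto intro!: holomorphic_intros simp: norm_mult field_simps\<close>)
      qed (use radius_seq(1,2)[of n] in auto)
      also have "\<dots> = Q n y" by (rule Qc[OF y, symmetric])
      also have "\<dots> \<le> (SUP n. Q n y)" by (rule SUP_upper) simp
      finally show "(\<integral>\<^sup>+t. ?g n t \<partial>bergman_disc (card J)) \<le> (SUP n. Q n y)" .
    qed simp
    finally show ?thesis .
  qed
  \<comment> \<open>\<open>Q n\<close> dilates coordinate \<open>l\<close> only, whereas the bound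
    by \<open>N\<close> is for dilation of all coordinates. For \<open>k \<ge> n\<close>
    monotonicity raises the radius in \<open>l\<close> to that of the other coordinates; then
    \<open>k\<close> tends to infinity by Fatou.\<close>
  have Qint: "(\<integral>\<^sup>+y. Q n y \<partial>bergman_prod (card J)) \<le> (\<Prod>j\<in>J. N j)" for n
  proof -
    let ?X = "\<lambda>k y. \<Prod>j\<in>J. \<integral>\<^sup>+s. cutoff (p j) (F j) (radius_seq k) (y(l := s)) \<partial>circle_haar"
    have QX: "Q n y \<le> liminf (\<lambda>k. ?X k y)" if y: "y \<in> polydisc_fun" for y
    proof -
      have sy: "rescale (radius_seq k) y \<in> polydisc_fun" for k
        using y polydisc_fun_subset_closed_polydisc_fun radius_seq(1,2)[of k] by (intro rescale_closed_polydisc_fun) auto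
      let ?G = "\<lambda>j s. ennreal (norm (F j (y(l := of_real (radius_seq n) * s))) powr p j) * indicator (sphere 0 1) s"
      let ?g = "\<lambda>j k s. ennreal (norm (F j ((rescale (radius_seq k) y)(l := of_real (radius_seq n) * s))) powr p j) * indicator (sphere 0 1) s"
      have rb: "of_real (radius_seq n) * s \<in> ball 0 1" if "norm s = 1" for s :: complex
        using radius_seq(1,2)[of n] that by (simp add: norm_mult)
      have meas: "(\<lambda>s. ennreal (norm (F j (x(l := of_real (radius_seq n) * s))) powr p j) * indicator (sphere 0 1) s) \<in> borel_measurable circle_haar"
        if "j \<in> J" "x \<in> polydisc_fun" for j x
        unfolding borel_measurable_circle_haar using rb
        by (intro circle_mean_measurable p that continuous_on_compose2[OF holomorphic_on_imp_continuous_on[OF hol[OF that]]] continuous_intros) auto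
      have "Q n y = (\<Prod>j\<in>J. \<integral>\<^sup>+s. ?G j s \<partial>circle_haar)"
        unfolding Qc[OF y] circle_mean_def ..
      also have "\<dots> \<le> liminf (\<lambda>k. \<Prod>j\<in>J. \<integral>\<^sup>+s. ?g j k s \<partial>circle_haar)"
      proof (rule prod_nn_integral_liminf[OF J(1) S.sigma_finite_measure_axioms])
        fix j s assume j: "j \<in> J"
        show "(\<lambda>k. ?g j k s) \<longlonglongrightarrow> ?G j s"
        proof (cases "norm s = 1")
          case True
          have "(\<lambda>k. ((rescale (radius_seq k) y)(l := of_real (radius_seq n) * s)) i) \<longlonglongrightarrow> (y(l := of_real (radius_seq n) * s)) i" for i
            using tendsto_mult[OF tendsto_of_real[OF radius_seq(3)] tendsto_const[of "y i"]] by (simp add: rescale_def)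
          then have l: "(\<lambda>k. (rescale (radius_seq k) y)(l := of_real (radius_seq n) * s)) \<longlonglongrightarrow> y(l := of_real (radius_seq n) * s)"
            by (rule tendsto_funI)
          have "continuous_on polydisc_fun (\<lambda>x. norm (F j x) powr p j)"
            using F[OF j] p[OF j] by (intro continuous_on_norm_powr) (auto simp: sep_hol_def)
          from continuous_on_tendsto_compose[OF this l]
          have "(\<lambda>k. norm (F j ((rescale (radius_seq k) y)(l := of_real (radius_seq n) * s))) powr p j) \<longlonglongrightarrow> norm (F j (y(l := of_real (radius_seq n) * s))) powr p j"
            using polydisc_fun_upd[OF y] polydisc_fun_upd[OF sy] rb[OF True] by (simp del: norm_mult)
          then show ?thesis using True by (simp add: tendsto_ennrealI)
        qed simp
      qed (use meas y sy in \<open>auto simp: ennreal_mult_less_top split: split_indicator\<close>)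
      also have "\<dots> \<le> liminf (\<lambda>k. ?X k y)"
      proof (rule Liminf_mono)
        show "\<forall>\<^sub>F k in sequentially. (\<Prod>j\<in>J. \<integral>\<^sup>+s. ?g j k s \<partial>circle_haar) \<le> ?X k y"
        proof (rule eventually_sequentiallyI[of n])
          fix k assume "n \<le> k"
          show "(\<Prod>j\<in>J. \<integral>\<^sup>+s. ?g j k s \<partial>circle_haar) \<le> ?X k y"
          proof (rule prod_mono_ennreal)
            fix j assume j: "j \<in> J"
            have "(\<integral>\<^sup>+s. ?g j k s \<partial>circle_haar) = circle_mean (p j) (\<lambda>s. F j ((rescale (radius_seq k) y)(l := of_real (radius_seq n) * s)))"
              unfolding circle_mean_def ..
            also have "\<dots> \<le> circle_mean (p j) (\<lambda>s. F j ((rescale (radius_seq k) y)(l := of_real (radius_seq k) * s)))"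
              using radius_seq(1,2)[of n] radius_seq(1,2)[of k] radius_seq(4)[OF \<open>n \<le> k\<close>]
              by (intro circle_mean_mono_radius hol p j sy) auto
            also have "\<dots> = (\<integral>\<^sup>+s. cutoff (p j) (F j) (radius_seq k) (y(l := s)) \<partial>circle_haar)"
              using y by (subst cutoff_slice_circle) (auto simp: polydisc_fun_def rescale_upd less_imp_le)
            finally show "(\<integral>\<^sup>+s. ?g j k s \<partial>circle_haar) \<le> (\<integral>\<^sup>+s. cutoff (p j) (F j) (radius_seq k) (y(l := s)) \<partial>circle_haar)" .
          qed
        qed
      qed
      finally show ?thesis .
    qed
    have "(\<integral>\<^sup>+y. Q n y \<partial>bergman_prod (card J)) \<le> (\<integral>\<^sup>+y. liminf (\<lambda>k. ?X k y) \<partial>bergman_prod (card J))"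
      by (rule nn_integral_mono_AE, rule eventually_mono[OF AE_bergman_prod[OF J(2)]]) (rule QX)
    also have "\<dots> \<le> liminf (\<lambda>k. \<integral>\<^sup>+y. ?X k y \<partial>bergman_prod (card J))"
    proof (rule nn_integral_liminf)
      fix k
      have "(\<lambda>y. \<integral>\<^sup>+s. cutoff (p j) (F j) (radius_seq k) (y(l := s)) \<partial>circle_haar) \<in> borel_measurable borel_prod" if "j \<in> J" for j
      proof -
        have "cutoff (p j) (F j) (radius_seq k) \<in> borel_measurable borel_prod" using that by (intro cutoff_measurable F p radius_seq)
        then have "(\<lambda>(y, s). cutoff (p j) (F j) (radius_seq k) (y(l := s))) \<in> borel_measurable (borel_prod \<Otimes>\<^sub>M circle_haar)"
          unfolding split_beta' by measurable
        from S.borel_measurable_nn_integral_fst[OF this] show ?thesis by simp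
      qed
      then show "?X k \<in> borel_measurable (bergman_prod (card J))"
        by (simp add: borel_measurable_prod_ennreal)
    qed
    also have "\<dots> \<le> (\<Prod>j\<in>J. N j)"
    proof (intro Liminf_le always_eventually allI)
      fix k
      have "(\<integral>\<^sup>+y. ?X k y \<partial>bergman_prod (card J)) \<le> (\<Prod>j\<in>J. torus_mean (p j) (F j) (radius_seq k))"
        by (rule cutoff_average[OF J p F radius_seq(1,2)])
      also have "\<dots> \<le> (\<Prod>j\<in>J. N j)" by (intro prod_mono_ennreal N)
      finally show "(\<integral>\<^sup>+y. ?X k y \<partial>bergman_prod (card J)) \<le> (\<Prod>j\<in>J. N j)" .
    qed simp
    finally show ?thesis .
  qed
  have Nfin': "(\<Prod>j\<in>J. N j) < \<top>" by (rule ennreal_prod_less_top[OF Nfin])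
  have Vfin: "(\<integral>\<^sup>+y. V y \<partial>bergman_prod (card J)) < \<top>"
    unfolding pintV[symmetric] using polydisc_inequality[OF J p F N] Nfin' by (rule le_less_trans)
  have "(\<integral>\<^sup>+y. (SUP n. Q n y) \<partial>bergman_prod (card J)) = (SUP n. \<integral>\<^sup>+y. Q n y \<partial>bergman_prod (card J))"
    by (rule nn_integral_monotone_convergence_SUP) (auto simp: incseq_def le_fun_def Qinc Qm)
  also have "\<dots> \<le> (\<Prod>j\<in>J. N j)" by (intro SUP_least Qint)
  also have "\<dots> \<le> (\<integral>\<^sup>+y. V y \<partial>bergman_prod (card J))" using eq by (simp add: pintV)
  finally have le: "(\<integral>\<^sup>+y. (SUP n. Q n y) \<partial>bergman_prod (card J)) \<le> (\<integral>\<^sup>+y. V y \<partial>bergman_prod (card J))" .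
  have AEeq: "AE y in bergman_prod (card J). V y = (SUP n. Q n y)"
    by (rule nn_integral_eq_imp_AE_eq[OF _ _ eventually_mono[OF AE_bergman_prod[OF J(2)] VQ] le Vfin])
       (auto simp: Vm intro!: borel_measurable_SUP Qm)
  have AEfin: "AE y in bergman_prod (card J). V y \<noteq> \<infinity>"
    using Vfin by (intro nn_integral_noteq_infinite) (auto simp: Vm)
  \<comment> \<open>The equality theorem in one variable asks for slices that do not vanish
    identically.\<close>
  have "AE y in bergman_prod (card J). \<forall>j\<in>J. F j y \<noteq> 0"
    using nz sep_hol_nonzero_AE[OF J(2) F] J(1) by (intro AE_finite_allI) auto
  then show ?thesis
    using AEeq AEfin AE_bergman_prod[OF J(2)]
  proof eventually_elim
    case (elim y)
    obtain q where "norm q < 1"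
      "\<And>j t. j \<in> J \<Longrightarrow> norm t < 1 \<Longrightarrow> F j (y(l := t)) = F j (y(l := 0)) * (1 - q * t) powr (- of_real (2 / p j))"
    proof (rule disc_product_equality[where f = "\<lambda>j t. F j (y(l := t))" and p = p, OF J p])
      show "(\<lambda>t. F j (y(l := t))) holomorphic_on ball 0 1" if "j \<in> J" for j
        by (rule hol[OF that elim(4)])
      show "\<exists>z\<in>ball 0 1. F j (y(l := z)) \<noteq> 0" if "j \<in> J" for j
        using elim that by (intro bexI[of _ "y l"]) (auto simp: polydisc_fun_def)
      show "(\<integral>\<^sup>+t. ennreal (\<Prod>j\<in>J. norm (F j (y(l := t))) powr p j) * indicator (ball 0 1) t \<partial>bergman_disc (card J)) < \<top>"
        using elim(3) unfolding Vc[OF elim(4)] by (simp add: less_top)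
      show "(\<Prod>j\<in>J. circle_mean (p j) (\<lambda>\<zeta>. F j (y(l := of_real (radius_seq n) * \<zeta>))))
        \<le> (\<integral>\<^sup>+t. ennreal (\<Prod>j\<in>J. norm (F j (y(l := t))) powr p j) * indicator (ball 0 1) t \<partial>bergman_disc (card J))" for n
        unfolding Vc[OF elim(4), symmetric] Qc[OF elim(4), symmetric] elim(2) by (rule SUP_upper) simp
    next
      fix q assume "norm q < 1"
        "\<And>j z. j \<in> J \<Longrightarrow> norm z < 1 \<Longrightarrow> F j (y(l := z)) = F j (y(l := 0)) * (1 - q * z) powr (- of_real (2 / p j))"
      then show thesis by (rule that)
    qed
    then show ?case by blast
  qed
qed

section \<open>Density of sets of full measure, and freezing a coordinate\<close>

lemma emeasure_bergman_disc_ball_pos: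
  assumes m: "m \<ge> 2" and z: "norm z < 1" and e: "e > 0"
  shows "0 < emeasure (bergman_disc m) (ball z e)"
proof (rule ccontr)
  assume "\<not> ?thesis"
  then have "ball z e \<in> null_sets (bergman_disc m)" by (intro null_setsI) auto
  then have "AE x in bergman_disc m. x \<notin> ball z e" by (rule AE_not_in)
  then have "AE x in bergman_disc m. x \<notin> ball z e \<inter> ball 0 1" by eventually_elim auto
  then have "ball z e \<inter> ball 0 1 = {}" by (intro open_subset_AE_bergman_disc[OF m]) auto
  then show False using z e by (metis IntI centre_in_ball empty_iff mem_ball_0)
qed

lemma emeasure_circle_haar_ball_pos:
  assumes z: "norm z = 1" and e: "e > 0"
  shows "0 < emeasure circle_haar (ball z e)"
proof (rule ccontr)
  assume "\<not> ?thesis"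
  then have "ball z e \<in> null_sets circle_haar" by (intro null_setsI) auto
  then have AE: "AE x in circle_haar. x \<notin> ball z e" by (rule AE_not_in)
  have [measurable]: "cis \<in> borel_measurable borel"
    by (intro borel_measurable_continuous_onI continuous_intros)
  have [measurable]: "ball z e \<in> sets borel" by simp
  have "AE t in uniform_measure lborel {0..<2*pi}. cis t \<notin> ball z e"
    using AE unfolding circle_haar_def by (subst (asm) AE_distr_iff) measurable
  then have AE2: "AE t in lborel. t \<in> {0..<2*pi} \<longrightarrow> cis t \<notin> ball z e"
    by (subst (asm) AE_uniform_measure) auto
  define \<theta> where "\<theta> = Arg2pi z"
  have th: "0 \<le> \<theta>" "\<theta> < 2*pi" "cis \<theta> = z"
    using Arg2pi[of z] z by (auto simp: \<theta>_def cis_conv_exp is_Arg_def)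
  have "continuous_on UNIV cis" by (intro continuous_intros)
  then have "isCont cis \<theta>" by (simp add: continuous_on_eq_continuous_at)
  then obtain d where d: "d > 0" "\<And>t. dist t \<theta> < d \<Longrightarrow> dist (cis t) (cis \<theta>) < e"
    using e unfolding continuous_at_eps_delta by blast
  \<comment> \<open>Cutting at \<open>2*pi\<close> keeps the interval inside the parameter range; it
    is nonempty since \<open>\<theta> < 2*pi\<close>.\<close>
  define b where "b = min (\<theta> + d) (2*pi)"
  have b: "\<theta> < b" using d th by (simp add: b_def)
  have "AE t in lborel. t \<notin> {\<theta><..<b}"
    using AE2
  proof eventually_elim
    case (elim t)
    show ?case
    proof
      assume t: "t \<in> {\<theta><..<b}"
      then have "dist (cis t) (cis \<theta>) < e" by (intro d(2)) (auto simp: b_def dist_real_def)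
      moreover have "t \<in> {0..<2*pi}" using t th by (auto simp: b_def)
      ultimately show False using elim th by (simp add: dist_commute)
    qed
  qed
  then have "emeasure lborel {\<theta><..<b} = 0"
    by (subst (asm) AE_iff_null_sets[symmetric]) auto
  then show False using b by simp
qed

lemma tendsto_fun_dist:
  fixes y :: "nat \<Rightarrow> 'n \<Rightarrow> complex"
  assumes "\<And>k i. dist (x i) (y k i) < 1 / (real k + 1)"
  shows "y \<longlonglongrightarrow> x"
proof (rule tendsto_funI)
  fix i
  have lim: "(\<lambda>k. 1 / (real k + 1)) \<longlonglongrightarrow> 0" by real_asymp
  have "(\<lambda>k. dist (y k i) (x i)) \<longlonglongrightarrow> 0"
    by (rule real_tendsto_sandwich[OF _ _ tendsto_const lim])
       (rule always_eventually, simp, rule always_eventually, metis assms dist_commute less_imp_le)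
  then show "(\<lambda>k. y k i) \<longlonglongrightarrow> x i" by (rule tendsto_dist_iff[THEN iffD2])
qed

lemma sep_hol_upd_0:
  assumes F: "sep_hol F" and c: "norm c < 1" shows "sep_hol (\<lambda>x. F (x(l := c)))"
  unfolding sep_hol_def
proof (intro conjI ballI allI)
  have c1: "continuous_on polydisc_fun (\<lambda>x :: 'a \<Rightarrow> complex. x(l := c))"
  proof (rule continuous_on_coordinatewise_then_product)
    show "continuous_on polydisc_fun (\<lambda>x :: 'a \<Rightarrow> complex. (x(l := c)) i)" for i
      by (cases "i = l") (auto intro: continuous_on_subset[OF continuous_on_product_coordinates])
  qed
  have c2: "continuous_on polydisc_fun F" using F by (simp add: sep_hol_def)
  show "continuous_on polydisc_fun (\<lambda>x. F (x(l := c)))"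
    by (rule continuous_on_compose2[OF c2 c1]) (use c in \<open>auto simp: polydisc_fun_upd\<close>)
  fix x :: "'a \<Rightarrow> complex" and i assume x: "x \<in> polydisc_fun"
  show "(\<lambda>t. F ((x(i := t))(l := c))) holomorphic_on ball 0 1"
  proof (cases "i = l")
    case False
    then have "(x(i := t))(l := c) = (x(l := c))(i := t)" for t by (rule fun_upd_twist)
    then show ?thesis using F polydisc_fun_upd[OF x c] by (simp add: sep_hol_def)
  qed simp
qed

lemma one_minus_notin_nonpos: "norm (w :: complex) < 1 \<Longrightarrow> 1 - w \<notin> \<real>\<^sub>\<le>\<^sub>0"
  using complex_Re_le_cmod[of w] by (auto simp: complex_nonpos_Reals_iff)

lemma norm_mult_less_1: "norm (q :: complex) \<le> 1 \<Longrightarrow> norm t < 1 \<Longrightarrow> norm (q * t) < 1"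
  using mult_right_mono[of "norm q" 1 "norm t"] by (simp add: norm_mult)

section \<open>Monotonicity of torus means in each radius\<close>

text \<open>The consequence of separate subharmonicity that the gap argument uses, taken as a
  definition: circle means of slices about \<open>0\<close> increase with the radius.\<close>

definition slice_mono :: "(('n::finite \<Rightarrow> complex) \<Rightarrow> real) \<Rightarrow> bool" where
  "slice_mono v \<longleftrightarrow> continuous_on polydisc_fun v \<and> (\<forall>x\<in>polydisc_fun. \<forall>i a b. 0 \<le> a \<longrightarrow> a \<le> b \<longrightarrow> b < 1 \<longrightarrow>
     (\<integral>\<^sup>+s. ennreal (v (x(i := of_real a * s))) * indicator (sphere 0 1) s \<partial>circle_haar)
     \<le> (\<integral>\<^sup>+s. ennreal (v (x(i := of_real b * s))) * indicator (sphere 0 1) s \<partial>circle_haar))"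

text \<open>One radius per coordinate, so that radii can be raised one at a time and every point of
  the polydisc is a dilated torus point.\<close>

definition dilate :: "('n \<Rightarrow> real) \<Rightarrow> ('n \<Rightarrow> complex) \<Rightarrow> 'n \<Rightarrow> complex" where
  "dilate r x = (\<lambda>i. of_real (r i) * x i)"

definition dilated_mean :: "(('n::finite \<Rightarrow> complex) \<Rightarrow> real) \<Rightarrow> ('n \<Rightarrow> real) \<Rightarrow> ennreal" where
  "dilated_mean v r = (\<integral>\<^sup>+y. ennreal (v (dilate r y)) * indicator closed_polydisc_fun y \<partial>torus_prod)"

lemma dilate_polydisc_fun:
  assumes "y \<in> closed_polydisc_fun" "\<And>i. 0 \<le> r i \<and> r i < 1" shows "dilate r y \<in> polydisc_fun"
proof -
  have "r i * norm (y i) < 1" for i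
    using mult_left_mono[of "norm (y i)" 1 "r i"] assms(1) assms(2)[of i] by (auto simp: closed_polydisc_fun_def)
  then show ?thesis using assms(2) by (simp add: polydisc_fun_def dilate_def norm_mult)
qed

lemma continuous_on_dilate: "continuous_on S (dilate r :: ('n::finite \<Rightarrow> complex) \<Rightarrow> _)"
  unfolding dilate_def
  by (intro continuous_on_coordinatewise_then_product continuous_intros
        continuous_on_subset[OF continuous_on_product_coordinates]) auto

lemma dilated_mean_measurable:
  assumes "continuous_on polydisc_fun v" "\<And>i. 0 \<le> r i \<and> r i < 1"
  shows "(\<lambda>y. ennreal (v (dilate r y)) * indicator closed_polydisc_fun y) \<in> borel_measurable borel_prod"
  by (intro borel_measurable_borel_prod_indicator closed_polydisc_fun_sets continuous_on_compose2[OF assms(1) continuous_on_dilate])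
     (rule image_subsetI, erule dilate_polydisc_fun, rule assms(2))

lemma dilated_mean_mono:
  fixes r s :: "'n::finite \<Rightarrow> real"
  assumes v: "slice_mono v" and rs: "\<And>i. 0 \<le> r i \<and> r i \<le> s i \<and> s i < 1"
  shows "dilated_mean v r \<le> dilated_mean v s"
proof -
  interpret borel_prob circle_haar by (rule borel_prob_circle)
  have cv: "continuous_on polydisc_fun v" using v by (simp add: slice_mono_def)
  have "dilated_mean v r \<le> dilated_mean v (override_on r s K)" if "finite K" for K
    using that
  proof (induction K rule: finite_induct)
    case (insert i K)
    define r' where "r' = override_on r s K"
    define r'' where "r'' = override_on r s (insert i K)"
    have r': "0 \<le> r' k \<and> r' k < 1" "0 \<le> r'' k \<and> r'' k < 1" for k
      using rs[of k] by (auto simp: r'_def r''_def override_on_def)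
    have r'i: "r' i = r i" "r'' i = s i" "\<And>k. k \<noteq> i \<Longrightarrow> r'' k = r' k"
      using insert.hyps by (auto simp: r'_def r''_def override_on_def)
    have e1: "dilate r' (y(i := t)) = (dilate r' y)(i := of_real (r i) * t)"
      and e2: "dilate r'' (y(i := t)) = (dilate r' y)(i := of_real (s i) * t)" for y :: "'n \<Rightarrow> complex" and t
      using r'i by (auto simp: dilate_def fun_eq_iff)
    have ind: "AE t in circle_haar. indicator closed_polydisc_fun (y(i := t)) = (indicator (sphere 0 1) t :: ennreal)" if "y \<in> closed_polydisc_fun" for y :: "'n \<Rightarrow> complex"
      using AE_circle_haar by eventually_elim (use that in \<open>auto simp: closed_polydisc_fun_def split: split_indicator\<close>)
    have "dilated_mean v r' = (\<integral>\<^sup>+y. \<integral>\<^sup>+t. ennreal (v (dilate r' (y(i := t)))) * indicator closed_polydisc_fun (y(i := t)) \<partial>circle_haar \<partial>torus_prod)"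
      unfolding dilated_mean_def by (rule nn_integral_fun_upd(1)[OF dilated_mean_measurable[OF cv r'(1)]])
    also have "\<dots> \<le> (\<integral>\<^sup>+y. \<integral>\<^sup>+t. ennreal (v (dilate r'' (y(i := t)))) * indicator closed_polydisc_fun (y(i := t)) \<partial>circle_haar \<partial>torus_prod)"
    proof (rule nn_integral_mono_AE, rule eventually_mono[OF AE_torus_prod])
      fix y :: "'n \<Rightarrow> complex" assume "\<forall>i. norm (y i) = 1"
      then have y: "y \<in> closed_polydisc_fun" by (simp add: closed_polydisc_fun_def)
      have "(\<integral>\<^sup>+t. ennreal (v (dilate r' (y(i := t)))) * indicator closed_polydisc_fun (y(i := t)) \<partial>circle_haar)
        = (\<integral>\<^sup>+t. ennreal (v ((dilate r' y)(i := of_real (r i) * t))) * indicator (sphere 0 1) t \<partial>circle_haar)"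
        by (rule nn_integral_cong_AE, rule eventually_mono[OF ind[OF y]]) (simp add: e1)
      also have "\<dots> \<le> (\<integral>\<^sup>+t. ennreal (v ((dilate r' y)(i := of_real (s i) * t))) * indicator (sphere 0 1) t \<partial>circle_haar)"
        using v rs[of i] dilate_polydisc_fun[OF y r'(1)] by (auto simp: slice_mono_def)
      also have "\<dots> = (\<integral>\<^sup>+t. ennreal (v (dilate r'' (y(i := t)))) * indicator closed_polydisc_fun (y(i := t)) \<partial>circle_haar)"
        by (rule nn_integral_cong_AE, rule eventually_mono[OF ind[OF y]]) (simp add: e2)
      finally show "(\<integral>\<^sup>+t. ennreal (v (dilate r' (y(i := t)))) * indicator closed_polydisc_fun (y(i := t)) \<partial>circle_haar)
        \<le> (\<integral>\<^sup>+t. ennreal (v (dilate r'' (y(i := t)))) * indicator closed_polydisc_fun (y(i := t)) \<partial>circle_haar)" .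
    qed
    also have "\<dots> = dilated_mean v r''"
      unfolding dilated_mean_def by (rule nn_integral_fun_upd(1)[OF dilated_mean_measurable[OF cv r'(2)], symmetric])
    finally show ?case using insert.IH by (simp add: r'_def r''_def)
  qed simp
  from this[of UNIV, OF finite] show ?thesis by (simp add: override_on_def)
qed

lemma dilated_mean_zero: "dilated_mean v (\<lambda>_. 0) = ennreal (v (\<lambda>_. 0 :: complex))"
proof -
  interpret borel_prob circle_haar by (rule borel_prob_circle)
  interpret T: prob_space "torus_prod :: ('a \<Rightarrow> complex) measure" by (rule prob_space_power)
  have "dilated_mean v (\<lambda>_. 0) = (\<integral>\<^sup>+y. ennreal (v (\<lambda>_. 0)) \<partial>(torus_prod :: ('a \<Rightarrow> complex) measure))"
    unfolding dilated_mean_def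
    by (rule nn_integral_cong_AE, rule eventually_mono[OF AE_torus_prod]) (auto simp: closed_polydisc_fun_def dilate_def)
  then show ?thesis by (simp add: T.emeasure_space_1)
qed

text \<open>On a slice the zero-free \<open>G\<close> has a logarithm, so the function is the
  squared modulus of a holomorphic \<open>H\<close>, and \<open>circle_mean_mono_radius\<close> with
  exponent \<open>2\<close> applies.\<close>

lemma slice_mono_norm:
  assumes g: "sep_hol g" and G: "sep_hol G" "\<And>x. x \<in> polydisc_fun \<Longrightarrow> G x \<noteq> 0" and p: "p > 0"
  shows "slice_mono (\<lambda>x. (norm (g x))\<^sup>2 * norm (G x) powr p)"
  unfolding slice_mono_def
proof (intro conjI ballI allI impI)
  show "continuous_on polydisc_fun (\<lambda>x. (norm (g x))\<^sup>2 * norm (G x) powr p)"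
    using g G p by (intro continuous_intros continuous_on_norm_powr) (auto simp: sep_hol_def)
  fix x :: "'a \<Rightarrow> complex" and i a b
  assume x: "x \<in> polydisc_fun" and ab: "0 \<le> (a::real)" "a \<le> b" "b < 1"
  have hG: "(\<lambda>t. G (x(i := t))) holomorphic_on ball 0 1" and hg: "(\<lambda>t. g (x(i := t))) holomorphic_on ball 0 1"
    using g G x by (auto simp: sep_hol_def)
  obtain L where L: "L holomorphic_on ball 0 1" "\<And>t. t \<in> ball 0 1 \<Longrightarrow> G (x(i := t)) = exp (L t)"
    using contractible_imp_holomorphic_log[OF hG convex_imp_contractible[OF convex_ball]] G(2) polydisc_fun_upd[OF x] by auto
  define H where "H t = g (x(i := t)) * exp (of_real (p / 2) * L t)" for t
  have H: "H holomorphic_on ball 0 1" unfolding H_def by (intro holomorphic_intros L hg)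
  have nH: "norm (H t) powr 2 = (norm (g (x(i := t))))\<^sup>2 * norm (G (x(i := t))) powr p" if "norm t < 1" for t
  proof -
    have "norm (H t) powr 2 = (norm (H t))\<^sup>2" by simp
    also have "\<dots> = (norm (g (x(i := t))))\<^sup>2 * norm (G (x(i := t))) powr p"
      using that L(2)[of t]
      by (simp add: H_def norm_mult power_mult_distrib powr_def exp_double[symmetric] flip: exp_of_nat_mult)
    finally show ?thesis .
  qed
  have eq: "(\<integral>\<^sup>+s. ennreal ((norm (g (x(i := of_real c * s))))\<^sup>2 * norm (G (x(i := of_real c * s))) powr p) * indicator (sphere 0 1) s \<partial>circle_haar)
    = circle_mean 2 (\<lambda>s. H (of_real c * s))" if "0 \<le> c" "c < 1" for c
    unfolding circle_mean_def
    by (rule nn_integral_cong) (use that in \<open>auto split: split_indicator simp: nH norm_mult simp del: powr_numeral\<close>)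
  show "(\<integral>\<^sup>+s. ennreal ((norm (g (x(i := of_real a * s))))\<^sup>2 * norm (G (x(i := of_real a * s))) powr p) * indicator (sphere 0 1) s \<partial>circle_haar)
    \<le> (\<integral>\<^sup>+s. ennreal ((norm (g (x(i := of_real b * s))))\<^sup>2 * norm (G (x(i := of_real b * s))) powr p) * indicator (sphere 0 1) s \<partial>circle_haar)"
    using ab by (subst (1 2) eq) (auto intro!: circle_mean_mono_radius H)
qed

section \<open>The equality case\<close>

lemma contraction_less_1:
  fixes R x :: real
  assumes "0 \<le> R" "R < 1" "x \<le> 1" shows "R * x < 1"
  using mult_left_mono[OF assms(3,1)] assms(2) by linarith

text \<open>The assumption \<open>eq\<close> is the nontrivial half of equality; the other half is
  \<open>polydisc_inequality\<close>.\<close>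

locale polydisc_equality =
  fixes J :: "nat set" and p :: "nat \<Rightarrow> real" and F :: "nat \<Rightarrow> ('n::finite \<Rightarrow> complex) \<Rightarrow> complex" and N :: "nat \<Rightarrow> ennreal"
  assumes J: "finite J" "card J \<ge> 2" and p: "\<And>j. j \<in> J \<Longrightarrow> p j > 0"
    and F: "\<And>j. j \<in> J \<Longrightarrow> sep_hol (F j)" and N: "\<And>j n. j \<in> J \<Longrightarrow> torus_mean (p j) (F j) (radius_seq n) \<le> N j"
    and Nfin: "\<And>j. j \<in> J \<Longrightarrow> N j < \<top>" and eq: "(\<Prod>j\<in>J. N j) \<le> polydisc_integral J p F"
    and nz: "\<And>j. j \<in> J \<Longrightarrow> \<exists>x\<in>polydisc_fun. F j x \<noteq> 0"
begin

text \<open>One \<open>q\<close> serves all \<open>j\<close>. It is the conjugate of the kernel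
  point in coordinate \<open>l\<close>. The bound \<open>norm q < 1\<close> is kept apart because
  limits of slices preserve only \<open>norm q \<le> 1\<close>.\<close>

definition slice_pole :: "'n \<Rightarrow> ('n \<Rightarrow> complex) \<Rightarrow> complex \<Rightarrow> bool" where
  "slice_pole l y q \<longleftrightarrow> (\<forall>j\<in>J. \<forall>t. norm t < 1 \<longrightarrow>
    F j (y(l := t)) = F j (y(l := 0)) * (1 - q * t) powr (- of_real (2 / p j)))"

lemma slice_poleD:
  "slice_pole l y q \<Longrightarrow> j \<in> J \<Longrightarrow> norm t < 1 \<Longrightarrow>
    F j (y(l := t)) = F j (y(l := 0)) * (1 - q * t) powr (- of_real (2 / p j))"
  unfolding slice_pole_def by blast

lemma slice_pole_AE: "AE y in bergman_prod (card J). \<exists>q. norm q < 1 \<and> slice_pole l y q"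
  unfolding slice_pole_def using slice_equality_AE[OF J p F N Nfin eq nz] .

lemma slice_pole_dense:
  assumes y: "y \<in> polydisc_fun" and e: "e > 0"
  obtains y' q where "y' \<in> polydisc_fun" "norm q < 1" "slice_pole l y' q" "\<And>i. dist (y i) (y' i) < e"
proof -
  interpret borel_prob "bergman_disc (card J)" by (rule borel_prob_bergman[OF J(2)])
  have "AE y in bergman_prod (card J). (\<exists>q. norm q < 1 \<and> slice_pole l y q) \<and> y \<in> polydisc_fun"
    using slice_pole_AE[of l] AE_bergman_prod[OF J(2)] by eventually_elim auto
  moreover have "0 < emeasure (bergman_disc (card J)) (ball (y i) e)" for i
    using y e by (intro emeasure_bergman_disc_ball_pos[OF J(2)]) (simp_all add: polydisc_fun_def)
  ultimately have "\<exists>y'. ((\<exists>q. norm q < 1 \<and> slice_pole l y' q) \<and> y' \<in> polydisc_fun) \<and> (\<forall>i. dist (y i) (y' i) < e)"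
    by (rule AE_imp_dense)
  then show ?thesis by (elim exE conjE) (rule that, assumption+, erule spec)
qed

text \<open>Good slices are dense and their parameters lie in a compact disc, so a subsequence
  converges and the kernel formula passes to the limit.\<close>

lemma slice_pole_exists:
  assumes y: "y \<in> polydisc_fun"
  obtains q where "norm q \<le> 1" "slice_pole l y q"
proof -
  have "\<exists>y' q. y' \<in> polydisc_fun \<and> norm q < 1 \<and> slice_pole l y' q \<and> (\<forall>i. dist (y i) (y' i) < 1 / (real k + 1))" for k
  proof -
    have "1 / (real k + 1) > 0" by simp
    show ?thesis
    proof (rule slice_pole_dense[OF y \<open>1 / (real k + 1) > 0\<close>])
      fix y' q assume "y' \<in> polydisc_fun" "norm q < 1" "slice_pole l y' q" "\<And>i. dist (y i) (y' i) < 1 / (real k + 1)"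
      then show ?thesis by (intro exI conjI allI)
    qed
  qed
  then obtain Y Q where Y: "\<And>k. Y k \<in> polydisc_fun" "\<And>k. norm (Q k) < 1" "\<And>k. slice_pole l (Y k) (Q k)"
    "\<And>k i. dist (y i) (Y k i) < 1 / (real k + 1)"
    by metis
  have "\<forall>k. Q k \<in> cball 0 1" using Y(2) by (auto simp: less_imp_le)
  then obtain q r where q: "q \<in> cball 0 1" "strict_mono (r :: nat \<Rightarrow> nat)" "(Q \<circ> r) \<longlonglongrightarrow> q"
    using compact_cball[of "0::complex" 1] unfolding compact_def by metis
  have Ylim: "(\<lambda>k. Y (r k)) \<longlonglongrightarrow> y"
    using LIMSEQ_subseq_LIMSEQ[OF tendsto_fun_dist[OF Y(4)] q(2)] by (simp add: o_def)
  have "slice_pole l y q"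
    unfolding slice_pole_def
  proof (intro ballI allI impI)
    fix j t assume j: "j \<in> J" and t: "norm (t::complex) < 1"
    have lim: "(\<lambda>k. F j ((Y (r k))(l := c))) \<longlonglongrightarrow> F j (y(l := c))" if "norm c < 1" for c
    proof -
      have "continuous_on polydisc_fun (\<lambda>x. F j (x(l := c)))"
        using sep_hol_upd_0[OF F[OF j] that, of l] unfolding sep_hol_def by blast
      from continuous_on_tendsto_compose[OF this Ylim y] show ?thesis using Y(1) by simp
    qed
    have "(\<lambda>k. (1 - Q (r k) * t) powr (- of_real (2 / p j))) \<longlonglongrightarrow> (1 - q * t) powr (- of_real (2 / p j))"
      using q t by (intro tendsto_powr_complex tendsto_intros one_minus_notin_nonpos norm_mult_less_1)
        (auto simp: o_def)
    then have "(\<lambda>k. F j ((Y (r k))(l := 0)) * (1 - Q (r k) * t) powr (- of_real (2 / p j)))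
      \<longlonglongrightarrow> F j (y(l := 0)) * (1 - q * t) powr (- of_real (2 / p j))"
      by (intro tendsto_mult lim) auto
    moreover have "F j ((Y (r k))(l := 0)) * (1 - Q (r k) * t) powr (- of_real (2 / p j)) = F j ((Y (r k))(l := t))" for k
      by (rule slice_poleD[OF Y(3) j t, symmetric])
    ultimately have "(\<lambda>k. F j ((Y (r k))(l := t))) \<longlonglongrightarrow> F j (y(l := 0)) * (1 - q * t) powr (- of_real (2 / p j))"
      by simp
    with lim[OF t] show "F j (y(l := t)) = F j (y(l := 0)) * (1 - q * t) powr (- of_real (2 / p j))"
      by (rule LIMSEQ_unique)
  qed
  then show ?thesis using that q by auto
qed

text \<open>Zeros propagate along coordinate lines, hence everywhere.\<close>

lemma F_nonzero:
  assumes j: "j \<in> J" and x: "x \<in> polydisc_fun" shows "F j x \<noteq> 0"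
proof
  assume x0: "F j x = 0"
  have line: "F j (y(l := t)) = 0" if y: "y \<in> polydisc_fun" "F j y = 0" and t: "norm t < 1" for y l t
  proof -
    obtain q where q: "norm q \<le> 1" "slice_pole l y q" using slice_pole_exists[OF y(1)] by metis
    have sl: "F j (y(l := s)) = F j (y(l := 0)) * (1 - q * s) powr (- of_real (2 / p j))" if "norm s < 1" for s
      by (rule slice_poleD[OF q(2) j that])
    have yl: "norm (y l) < 1" using y by (simp add: polydisc_fun_def)
    have "1 - q * y l \<noteq> 0" using one_minus_notin_nonpos[OF norm_mult_less_1[OF q(1) yl]] by auto
    then have "(1 - q * y l) powr (- of_real (2 / p j)) \<noteq> 0" by simp
    moreover have "F j (y(l := 0)) * (1 - q * y l) powr (- of_real (2 / p j)) = 0"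
      unfolding sl[OF yl, symmetric] using y by simp
    ultimately have "F j (y(l := 0)) = 0" unfolding mult_eq_0_iff by blast
    then show ?thesis unfolding sl[OF t] by simp
  qed
  obtain z where z: "z \<in> polydisc_fun" "F j z \<noteq> 0" using nz[OF j] by auto
  have "F j (override_on x z K) = 0" if "finite K" for K
    using that
  proof (induction K rule: finite_induct)
    case (insert i K)
    have "override_on x z K \<in> polydisc_fun" using x z by (auto simp: polydisc_fun_def override_on_def)
    from line[OF this insert.IH, of "z i" i]
    have "F j ((override_on x z K)(i := z i)) = 0" using z by (simp add: polydisc_fun_def)
    moreover have "(override_on x z K)(i := z i) = override_on x z (insert i K)"
      by (auto simp: override_on_def fun_eq_iff)
    ultimately show ?case by simp
  qed (simp add: x0)
  from this[of UNIV, OF finite] show False using z by (simp add: override_on_def)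
qed

text \<open>The pole is recovered from the values at \<open>0\<close> and at a point \<open>c\<close> so close to \<open>0\<close> that all
  logarithms are principal; hence it is holomorphic in the remaining variables.\<close>

lemma pole_function:
  obtains h where "sep_hol h" "\<And>y. y \<in> polydisc_fun \<Longrightarrow> norm (h y) \<le> 1" "\<And>y. y \<in> polydisc_fun \<Longrightarrow> slice_pole l y (h y)"
    "\<And>y q. y \<in> polydisc_fun \<Longrightarrow> norm q \<le> 1 \<Longrightarrow> slice_pole l y q \<Longrightarrow> q = h y"
    "\<And>y t. h (y(l := t)) = h y"
proof -
  obtain j where j: "j \<in> J" using J(2) by (metis card.empty ex_in_conv not_numeral_le_zero)
  \<comment> \<open>\<open>norm c \<le> 1/4\<close> makes \<open>norm (q * c)\<close> small enough
    for \<open>norm_Ln_le\<close>; \<open>norm c \<le> p j / 4\<close> then gives the exponent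
    \<open>w\<close> modulus at most \<open>1\<close>, so that \<open>Ln (exp w) = w\<close> and
    \<open>Re (exp w) > 0\<close>.\<close>
  define c :: complex where "c = of_real (min (1/4) (p j / 4))"
  have c: "c \<noteq> 0" "norm c \<le> 1/4" "norm c \<le> p j / 4" "norm c < 1" using p[OF j] by (auto simp: c_def)
  define R where "R y = F j (y(l := c)) / F j (y(l := 0))" for y
  define h where "h y = (1 - exp (- of_real (p j / 2) * Ln (R y))) / c" for y
  have key: "q = h y \<and> Re (R y) > 0" if y: "y \<in> polydisc_fun" and q: "norm q \<le> 1" "slice_pole l y q" for y q
  proof -
    have nqc: "norm (q * c) \<le> norm c" using q(1) by (simp add: norm_mult mult_left_le_one_le)
    have nz0: "F j (y(l := 0)) \<noteq> 0" by (intro F_nonzero[OF j] polydisc_fun_upd[OF y]) simp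
    have nz1: "1 - q * c \<noteq> 0" using one_minus_notin_nonpos[of "q * c"] nqc c by auto
    define w where "w = - of_real (2 / p j) * Ln (1 - q * c)"
    have "R y = (1 - q * c) powr (- of_real (2 / p j))"
      unfolding R_def slice_poleD[OF q(2) j c(4)] using nz0 by simp
    also have "\<dots> = exp w" using nz1 by (simp add: powr_def w_def)
    finally have Rw: "R y = exp w" .
    have "norm (Ln (1 + (- (q * c)))) \<le> 2 * norm (- (q * c))"
      by (rule norm_Ln_le) (use nqc c in auto)
    then have "norm (Ln (1 - q * c)) \<le> 2 * (p j / 4)" using nqc c(3) by simp
    then have nw: "norm w \<le> 1"
      using p[OF j] mult_left_mono[of "norm (Ln (1 - q * c))" "2 * (p j / 4)" "2 / p j"]
      by (simp add: w_def norm_mult norm_divide)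
    then have im: "\<bar>Im w\<bar> \<le> 1" using abs_Im_le_cmod[of w] by linarith
    have "Ln (R y) = w" unfolding Rw using im pi_gt3 by (intro Ln_exp) auto
    moreover have "- of_real (p j / 2) * w = Ln (1 - q * c)"
      using p[OF j] by (simp add: w_def)
    ultimately have "h y = (1 - (1 - q * c)) / c" unfolding h_def using nz1 by simp
    then have "h y = q" using c by simp
    moreover have "Re (R y) > 0"
      unfolding Rw Re_exp using im pi_gt3 by (intro mult_pos_pos cos_gt_zero_pi) auto
    ultimately show ?thesis by simp
  qed
  have ex: "\<exists>q. norm q \<le> 1 \<and> slice_pole l y q" if "y \<in> polydisc_fun" for y using slice_pole_exists[OF that] by metis
  have Rpos: "Re (R y) > 0" if "y \<in> polydisc_fun" for y using key[OF that] ex[OF that] by blast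
  have Rn: "R y \<notin> \<real>\<^sub>\<le>\<^sub>0" if "y \<in> polydisc_fun" for y using Rpos[OF that] by (auto simp: complex_nonpos_Reals_iff)
  have sc: "sep_hol (\<lambda>y. F j (y(l := c)))" and s0: "sep_hol (\<lambda>y. F j (y(l := 0)))"
    using sep_hol_upd_0[OF F[OF j]] c by auto
  have nz0: "F j (y(l := 0)) \<noteq> 0" if "y \<in> polydisc_fun" for y
    by (intro F_nonzero[OF j] polydisc_fun_upd[OF that]) simp
  have hs: "sep_hol h"
    unfolding sep_hol_def
  proof (intro conjI ballI allI)
    have "continuous_on polydisc_fun R"
      unfolding R_def using sc s0 nz0 by (intro continuous_on_divide) (auto simp: sep_hol_def)
    then show "continuous_on polydisc_fun h"
      unfolding h_def using Rn c by (intro continuous_intros) auto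
    fix x :: "'n \<Rightarrow> complex" and i assume x: "x \<in> polydisc_fun"
    have "(\<lambda>t. R (x(i := t))) holomorphic_on ball 0 1"
      unfolding R_def using sc s0 x nz0[OF polydisc_fun_upd[OF x]] by (intro holomorphic_intros) (auto simp: sep_hol_def)
    then show "(\<lambda>t. h (x(i := t))) holomorphic_on ball 0 1"
      unfolding h_def using Rn[OF polydisc_fun_upd[OF x]] c by (intro holomorphic_intros) auto
  qed
  show ?thesis
  proof (rule that[OF hs])
    show "norm (h y) \<le> 1" if "y \<in> polydisc_fun" for y using key[OF that] ex[OF that] by blast
    show "slice_pole l y (h y)" if "y \<in> polydisc_fun" for y using key[OF that] ex[OF that] by blast
    show "q = h y" if "y \<in> polydisc_fun" "norm q \<le> 1" "slice_pole l y q" for y q using key[OF that] by blast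
    show "h (y(l := t)) = h y" for y t by (simp add: h_def R_def)
  qed
qed


lemma kernel_slice:
  assumes "slice_pole l x q" "norm q \<le> 1" "j \<in> J" "norm t < 1"
  shows "norm (F j (x(l := t))) powr p j = norm (F j (x(l := 0))) powr p j / (norm (1 - q * t))\<^sup>2"
proof -
  have nz: "1 - q * t \<noteq> 0" using one_minus_notin_nonpos[OF norm_mult_less_1[OF assms(2,4)]] by auto
  have "norm ((1 - q * t) powr (- of_real (2 / p j))) powr p j = (norm (1 - q * t) powr (- (2 / p j))) powr p j"
    by (subst norm_powr_real_powr') simp_all
  also have "\<dots> = norm (1 - q * t) powr (- 2)"
    using p[OF assms(3)] by (simp add: powr_powr)
  also have "\<dots> = 1 / (norm (1 - q * t))\<^sup>2"
    using nz by (simp add: powr_minus powr_numeral divide_inverse)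
  finally show ?thesis
    unfolding slice_poleD[OF assms(1,3,4)] by (simp add: norm_mult powr_mult)
qed

text \<open>In all coordinates except \<open>l\<close>, \<open>tensor_inequality\<close> leaves
  factors at independent torus points \<open>z j\<close>, whose slices in \<open>l\<close> are
  kernels with ratios \<open>q j\<close>. There \<open>kernel_defect\<close> adds
  \<open>\<delta> z\<close>, and the integral of \<open>\<delta>\<close> plus \<open>a n\<close>
  stays below the product of the \<open>N j\<close>. As \<open>liminf a\<close> is at least that
  product, no lower bound of the gap that is uniform in \<open>n\<close> can be positive.\<close>

lemma pole_constant:
  obtains w where "norm w < 1" "\<And>y. y \<in> polydisc_fun \<Longrightarrow> slice_pole l y w"
proof -
  interpret two_probs "bergman_disc (card J)" circle_haar by (rule two_probs_disc_circle[OF J(2)])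
  interpret PM: prob_space "bergman_prod (card J) :: ('n \<Rightarrow> complex) measure" by (rule M.prob_space_power)
  interpret PS: prob_space "torus_prod :: ('n \<Rightarrow> complex) measure" by (rule S.prob_space_power)
  obtain h where h: "sep_hol h" "\<And>y. y \<in> polydisc_fun \<Longrightarrow> norm (h y) \<le> 1" "\<And>y. y \<in> polydisc_fun \<Longrightarrow> slice_pole l y (h y)"
    "\<And>y q. y \<in> polydisc_fun \<Longrightarrow> norm q \<le> 1 \<Longrightarrow> slice_pole l y q \<Longrightarrow> q = h y"
    "\<And>y t. h (y(l := t)) = h y"
  proof (rule pole_function[of l])
    fix h :: "('n \<Rightarrow> complex) \<Rightarrow> complex"
    assume "sep_hol h" "\<And>y. y \<in> polydisc_fun \<Longrightarrow> norm (h y) \<le> 1" "\<And>y. y \<in> polydisc_fun \<Longrightarrow> slice_pole l y (h y)"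
      "\<And>y q. y \<in> polydisc_fun \<Longrightarrow> norm q \<le> 1 \<Longrightarrow> slice_pole l y q \<Longrightarrow> q = h y" "\<And>y t. h (y(l := t)) = h y"
    then show thesis by (rule that)
  qed
  obtain j1 j2 where j12: "j1 \<in> J" "j2 \<in> J" "j1 \<noteq> j2"
  proof -
    have "\<not> card J \<le> Suc 0" using J(2) by simp
    then show ?thesis using that J(1) by (auto simp: card_le_Suc0_iff_eq)
  qed
  define b where "b j x = norm (F j (x(l := 0))) powr p j" for j x
  have b0: "0 \<le> b j x" for j x by (simp add: b_def)
  have bpos: "0 < b j x" if "j \<in> J" "x \<in> polydisc_fun" for j x
    using F_nonzero[OF that(1) polydisc_fun_upd[OF that(2)], of 0 l] by (simp add: b_def)
  have cb: "continuous_on polydisc_fun (b j)" if "j \<in> J" for j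
    unfolding b_def using sep_hol_upd_0[OF F[OF that], of 0 l] p[OF that]
    by (intro continuous_on_norm_powr) (auto simp: sep_hol_def)
  have ch: "continuous_on polydisc_fun h" using h(1) by (simp add: sep_hol_def)
  \<comment> \<open>The contribution of factor \<open>j\<close> to the gap once the pole of
    \<open>j1\<close> is fixed at \<open>c\<close>: the squared distance of the poles is charged to
    \<open>j2\<close>.\<close>
  define v where "v c j x = (if j = j2 then (norm (c - h x))\<^sup>2 else 1) * b j x" for c j x
  have vm: "slice_mono (v c j)" if "j \<in> J" for c j
  proof -
    have s: "sep_hol (\<lambda>x. if j = j2 then c - h x else 1)"
      using h(1) unfolding sep_hol_def by (cases "j = j2") (auto intro!: continuous_intros holomorphic_intros)
    have "slice_mono (\<lambda>x. (norm (if j = j2 then c - h x else 1))\<^sup>2 * norm (F j (x(l := 0))) powr p j)"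
      using that by (intro slice_mono_norm s sep_hol_upd_0 F p F_nonzero polydisc_fun_upd) auto
    also have "(\<lambda>x. (norm (if j = j2 then c - h x else 1))\<^sup>2 * norm (F j (x(l := 0))) powr p j) = v c j"
      by (auto simp: v_def b_def fun_eq_iff)
    finally show ?thesis .
  qed
  \<comment> \<open>What remains of the gap as a function of the point of \<open>j1\<close> when all
    other factors are replaced by their values at the centre; \<open>\<kappa>\<close> below collects
    those values apart from the squared distance.\<close>
  define v1 where "v1 x = (norm (h x - h (\<lambda>_. 0)))\<^sup>2 * b j1 x" for x
  have v1m: "slice_mono v1"
  proof -
    have "sep_hol (\<lambda>x. h x - h (\<lambda>_. 0))"
      using h(1) unfolding sep_hol_def by (auto intro!: continuous_intros holomorphic_intros)
    then show ?thesis
      unfolding v1_def b_def using j12(1) by (intro slice_mono_norm sep_hol_upd_0 F p F_nonzero polydisc_fun_upd) auto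
  qed
  define \<kappa> where "\<kappa> = (\<Prod>j\<in>J - {j1}. b j (\<lambda>_. 0))"
  have kpos: "\<kappa> > 0" unfolding \<kappa>_def by (intro prod_pos bpos) (auto simp: polydisc_fun_def)
  define a where "a n = (\<integral>\<^sup>+y. (\<Prod>j\<in>J. cutoff (p j) (F j) (radius_seq n) y) \<partial>bergman_prod (card J))" for n
  have gap: "a n + ennreal ((radius_seq n)\<^sup>2 / 2 * \<kappa>) * dilated_mean v1 (\<lambda>_. radius_seq n) \<le> (\<Prod>j\<in>J. N j)" for n
  proof -
    let ?R = "radius_seq n"
    have R: "0 < ?R" "?R < 1" "0 \<le> ?R" using radius_seq(1,2)[of n] by auto
    let ?u = "\<lambda>j. cutoff (p j) (F j) ?R"
    have u: "?u j \<in> borel_measurable borel_prod" if "j \<in> J" for j using that by (intro cutoff_measurable F p R)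
    have mu: "(\<lambda>(y, t). ?u j (y(l := t))) \<in> borel_measurable (borel_prod \<Otimes>\<^sub>M borel)" if "j \<in> J" for j
      using u[OF that] unfolding split_beta' by measurable
    define \<delta> where "\<delta> z = ennreal (?R\<^sup>2 / 2 * (norm (h (rescale ?R (z j1)) - h (rescale ?R (z j2))))\<^sup>2 * (\<Prod>j\<in>J. b j (rescale ?R (z j))))
        * (\<Prod>j\<in>J. indicator closed_polydisc_fun (z j))" for z :: "nat \<Rightarrow> 'n \<Rightarrow> complex"
    have one: "(\<integral>\<^sup>+t. (\<Prod>j\<in>J. ?u j ((z j)(l := t))) \<partial>bergman_disc (card J)) + \<delta> z
      \<le> (\<Prod>j\<in>J. \<integral>\<^sup>+t. ?u j ((z j)(l := t)) \<partial>circle_haar)" for z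
    proof (cases "\<forall>j\<in>J. z j \<in> closed_polydisc_fun")
      case True
      \<comment> \<open>Dilation multiplies the ratio by \<open>?R\<close>, which brings it strictly
        below \<open>1\<close> in modulus although \<open>h\<close> is only known to be bounded by
        \<open>1\<close>.\<close>
      define q where "q j = of_real ?R * h (rescale ?R (z j))" for j
      have sP: "rescale ?R (z j) \<in> polydisc_fun" if "j \<in> J" for j using True that R by (intro rescale_closed_polydisc_fun) auto
      have q1: "norm (q j) < 1" if "j \<in> J" for j
        using contraction_less_1[OF R(3,2) h(2)[OF sP[OF that]]] R by (simp add: q_def norm_mult)
      have rt: "norm (of_real ?R * t) < 1" if "norm t \<le> 1" for t :: complex
        using contraction_less_1[OF R(3,2) that] R by (simp add: norm_mult)
      have val: "norm (F j (rescale ?R ((z j)(l := t)))) powr p j = b j (rescale ?R (z j)) / (norm (1 - q j * t))\<^sup>2"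
        if "j \<in> J" "norm t \<le> 1" for j t
        unfolding rescale_upd b_def q_def
        using kernel_slice[OF h(3)[OF sP[OF that(1)]] h(2)[OF sP[OF that(1)]] that(1) rt[OF that(2)]]
        by (simp add: mult_ac)
      have zc: "norm (z j k) \<le> 1" if "j \<in> J" for j k using True that by (auto simp: closed_polydisc_fun_def)
      have disc: "(\<integral>\<^sup>+t. (\<Prod>j\<in>J. ?u j ((z j)(l := t))) \<partial>bergman_disc (card J))
        = (\<integral>\<^sup>+t. ennreal (\<Prod>j\<in>J. b j (rescale ?R (z j)) / (norm (1 - q j * t))\<^sup>2) * indicator (ball 0 1) t \<partial>bergman_disc (card J))"
        by (subst cutoff_slice_disc[OF J(1) zc]) (auto intro!: nn_integral_cong prod.cong arg_cong[where f = ennreal] simp: val split: split_indicator)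
      have circ: "(\<integral>\<^sup>+t. ?u j ((z j)(l := t)) \<partial>circle_haar)
        = (\<integral>\<^sup>+t. ennreal (b j (rescale ?R (z j)) / (norm (1 - q j * t))\<^sup>2) * indicator (sphere 0 1) t \<partial>circle_haar)" if "j \<in> J" for j
        unfolding cutoff_slice_circle[OF zc[OF that]] circle_mean_def
        using that by (auto intro!: nn_integral_cong simp: val split: split_indicator)
      have d: "\<delta> z = ennreal ((norm (q j1 - q j2))\<^sup>2 / 2 * (\<Prod>j\<in>J. b j (rescale ?R (z j))))"
      proof -
        have "q j1 - q j2 = of_real ?R * (h (rescale ?R (z j1)) - h (rescale ?R (z j2)))"
          by (simp add: q_def algebra_simps)
        then have "(norm (q j1 - q j2))\<^sup>2 = ?R\<^sup>2 * (norm (h (rescale ?R (z j1)) - h (rescale ?R (z j2))))\<^sup>2"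
          using R by (simp add: norm_mult power_mult_distrib)
        moreover have "(\<Prod>j\<in>J. indicator closed_polydisc_fun (z j)) = (1 :: ennreal)" using True by simp
        ultimately show ?thesis by (simp add: \<delta>_def)
      qed
      show ?thesis
        unfolding disc d using kernel_defect[where q = q and b = "\<lambda>j. b j (rescale ?R (z j))", OF J(1) j12 q1 b0]
        by (simp add: circ cong: prod.cong)
    next
      case False
      then obtain j where "j \<in> J" "z j \<notin> closed_polydisc_fun" by auto
      then have "(\<Prod>j\<in>J. indicator closed_polydisc_fun (z j)) = (0 :: ennreal)"
        by (intro prod_zero J(1) bexI[of _ j]) simp_all
      then have "\<delta> z = 0" by (simp only: \<delta>_def mult_zero_right)
      then show ?thesis using cutoff_one_variable[where x = z and i = l, OF J p F R(1,2)] by simp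
    qed
    have \<delta>m: "\<delta> \<in> borel_measurable (PiM J (\<lambda>_. torus_prod))"
    proof -
      have cs: "continuous_on closed_polydisc_fun (\<lambda>x. f (rescale ?R x))" if "continuous_on polydisc_fun f" for f :: "('n \<Rightarrow> complex) \<Rightarrow> 'c::topological_space"
        by (rule continuous_on_compose2[OF that continuous_on_rescale]) (use R in \<open>auto intro: rescale_closed_polydisc_fun\<close>)
      \<comment> \<open>The indicators make \<open>H\<close> and \<open>B j\<close> Borel on the
        whole space; \<open>\<delta>\<close> carries the same indicators, so the product is
        unchanged.\<close>
      define H where "H x = indicator closed_polydisc_fun x *\<^sub>R h (rescale ?R x)" for x
      define B where "B j x = indicator closed_polydisc_fun x *\<^sub>R b j (rescale ?R x)" for j x
      have H: "H \<in> borel_measurable borel_prod"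
        unfolding H_def measurable_cong_sets[OF sets_borel_prod refl]
        by (intro borel_measurable_continuous_on_indicator closed_polydisc_fun_sets cs ch)
      have B: "B j \<in> borel_measurable borel_prod" if "j \<in> J" for j
        unfolding B_def measurable_cong_sets[OF sets_borel_prod refl]
        by (intro borel_measurable_continuous_on_indicator closed_polydisc_fun_sets cs cb that)
      have I: "(\<lambda>x :: 'n \<Rightarrow> complex. indicator closed_polydisc_fun x :: ennreal) \<in> borel_measurable borel_prod"
        by (intro borel_measurable_indicator) (simp add: sets_borel_prod closed_polydisc_fun_sets)
      have comp: "(\<lambda>z. f (z j)) \<in> borel_measurable (PiM J (\<lambda>_. torus_prod))" if "j \<in> J" "f \<in> borel_measurable borel_prod"
        for j and f :: "('n \<Rightarrow> complex) \<Rightarrow> 'c::topological_space"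
        using that by (intro measurable_compose[OF measurable_component_singleton[OF that(1)]]) simp
      have m1: "(\<lambda>z. norm (H (z j1) - H (z j2))) \<in> borel_measurable (PiM J (\<lambda>_. torus_prod))"
        by (rule measurable_compose[OF borel_measurable_diff[OF comp[OF j12(1) H] comp[OF j12(2) H]] borel_measurable_norm])
      have m2: "(\<lambda>z. \<Prod>j\<in>J. B j (z j)) \<in> borel_measurable (PiM J (\<lambda>_. torus_prod))"
        by (rule borel_measurable_prod, rule comp[OF _ B])
      have m3: "(\<lambda>z :: nat \<Rightarrow> 'n \<Rightarrow> complex. \<Prod>j\<in>J. indicator closed_polydisc_fun (z j) :: ennreal) \<in> borel_measurable (PiM J (\<lambda>_. torus_prod))"
        by (rule borel_measurable_prod_ennreal, rule comp[OF _ I])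
      have "(\<lambda>z. ennreal (?R\<^sup>2 / 2 * (norm (H (z j1) - H (z j2)))\<^sup>2 * (\<Prod>j\<in>J. B j (z j))) * (\<Prod>j\<in>J. indicator closed_polydisc_fun (z j)))
         \<in> borel_measurable (PiM J (\<lambda>_. torus_prod))"
        by (intro borel_measurable_times_ennreal m3 measurable_compose[OF _ measurable_ennreal]
              borel_measurable_times m2 borel_measurable_power m1 borel_measurable_const)
      also have "(\<lambda>z. ennreal (?R\<^sup>2 / 2 * (norm (H (z j1) - H (z j2)))\<^sup>2 * (\<Prod>j\<in>J. B j (z j))) * (\<Prod>j\<in>J. indicator closed_polydisc_fun (z j))) = \<delta>"
      proof
        fix z
        show "ennreal (?R\<^sup>2 / 2 * (norm (H (z j1) - H (z j2)))\<^sup>2 * (\<Prod>j\<in>J. B j (z j))) * (\<Prod>j\<in>J. indicator closed_polydisc_fun (z j)) = \<delta> z"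
        proof (cases "\<forall>j\<in>J. z j \<in> closed_polydisc_fun")
          case True
          then show ?thesis using j12 by (simp add: \<delta>_def H_def B_def cong: prod.cong)
        next
          case False
          then obtain j where "j \<in> J" "z j \<notin> closed_polydisc_fun" by auto
      then have "(\<Prod>j\<in>J. indicator closed_polydisc_fun (z j)) = (0 :: ennreal)"
        by (intro prod_zero J(1) bexI[of _ j]) simp_all
          then show ?thesis by (simp only: \<delta>_def mult_zero_right)
        qed
      qed
      finally show ?thesis .
    qed
    have inner_m: "(\<lambda>z. \<integral>\<^sup>+t. (\<Prod>j\<in>J. ?u j ((z j)(l := t))) \<partial>bergman_disc (card J)) \<in> borel_measurable (PiM J (\<lambda>_. torus_prod))"
    proof -
      have "(\<lambda>(z, t). \<Prod>j\<in>J. ?u j ((z j)(l := t))) \<in> borel_measurable (PiM J (\<lambda>_. torus_prod) \<Otimes>\<^sub>M bergman_disc (card J))"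
        unfolding split_beta'
      proof (rule borel_measurable_prod_ennreal)
        fix j assume j: "j \<in> J"
        have "(\<lambda>x. fst x j) \<in> measurable (PiM J (\<lambda>_. torus_prod) \<Otimes>\<^sub>M bergman_disc (card J)) torus_prod"
          by (rule measurable_compose[OF measurable_fst measurable_component_singleton[OF j]])
        then have "(\<lambda>x. (fst x j, snd x)) \<in> measurable (PiM J (\<lambda>_. torus_prod) \<Otimes>\<^sub>M bergman_disc (card J)) (borel_prod \<Otimes>\<^sub>M borel)"
          by (intro measurable_Pair) (simp_all, measurable)
        from measurable_compose[OF this mu[OF j]]
        show "(\<lambda>x. ?u j ((fst x j)(l := snd x))) \<in> borel_measurable (PiM J (\<lambda>_. torus_prod) \<Otimes>\<^sub>M bergman_disc (card J))" by simp
      qed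
      from M.borel_measurable_nn_integral_fst[OF this] show ?thesis by simp
    qed
    \<comment> \<open>Only the coordinates other than \<open>l\<close> are estimated first; the disc
      variable \<open>t\<close> in coordinate \<open>l\<close> stays common to all factors, so after
      the swap the slices in \<open>l\<close> meet \<open>kernel_defect\<close>.\<close>
    have "a n = (\<integral>\<^sup>+t. \<integral>\<^sup>+y. (\<Prod>j\<in>J. ?u j (y(l := t))) \<partial>bergman_prod (card J) \<partial>bergman_disc (card J))"
      unfolding a_def by (rule M.nn_integral_fun_upd(2)) (intro borel_measurable_prod_ennreal u)
    also have "\<dots> \<le> (\<integral>\<^sup>+t. (\<Prod>j\<in>J. \<integral>\<^sup>+y. ?u j (y(l := t)) \<partial>torus_prod) \<partial>bergman_disc (card J))"
    proof (rule nn_integral_mono)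
      fix t :: complex
      have "(\<integral>\<^sup>+y. (\<Prod>j\<in>J. ?u j (override_on ((\<lambda>_. 0)(l := t)) y (UNIV - {l}))) \<partial>bergman_prod (card J))
        \<le> (\<Prod>j\<in>J. \<integral>\<^sup>+y. ?u j (override_on ((\<lambda>_. 0)(l := t)) y (UNIV - {l})) \<partial>torus_prod)"
        by (rule tensor_inequality[OF J(1) u cutoff_one_variable[OF J p F R(1,2)]])
      then show "(\<integral>\<^sup>+y. (\<Prod>j\<in>J. ?u j (y(l := t))) \<partial>bergman_prod (card J)) \<le> (\<Prod>j\<in>J. \<integral>\<^sup>+y. ?u j (y(l := t)) \<partial>torus_prod)"
        by (simp only: upd_override[of _ l, symmetric])
    qed
    also have "\<dots> = (\<integral>\<^sup>+z. \<integral>\<^sup>+t. (\<Prod>j\<in>J. ?u j ((z j)(l := t))) \<partial>bergman_disc (card J) \<partial>PiM J (\<lambda>_. torus_prod))"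
      using mu by (intro prod_nn_integral_swap J M.sigma_finite_measure_axioms PS.sigma_finite_measure_axioms)
        (simp add: measurable_pair_power)
    finally have "a n + (\<integral>\<^sup>+z. \<delta> z \<partial>PiM J (\<lambda>_. torus_prod))
      \<le> (\<integral>\<^sup>+z. (\<integral>\<^sup>+t. (\<Prod>j\<in>J. ?u j ((z j)(l := t))) \<partial>bergman_disc (card J)) + \<delta> z \<partial>PiM J (\<lambda>_. torus_prod))"
      by (subst nn_integral_add[OF inner_m \<delta>m]) (rule add_right_mono)
    also have "\<dots> \<le> (\<integral>\<^sup>+z. (\<Prod>j\<in>J. \<integral>\<^sup>+t. ?u j ((z j)(l := t)) \<partial>circle_haar) \<partial>PiM J (\<lambda>_. torus_prod))"
      by (intro nn_integral_mono one)
    also have "\<dots> = (\<Prod>j\<in>J. \<integral>\<^sup>+y. \<integral>\<^sup>+t. ?u j (y(l := t)) \<partial>circle_haar \<partial>torus_prod)"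
    proof (intro prod_nn_integral[symmetric] J PS.sigma_finite_measure_axioms)
      fix j assume j: "j \<in> J"
      have "(\<lambda>(y, t). ?u j (y(l := t))) \<in> borel_measurable (borel_prod \<Otimes>\<^sub>M circle_haar)"
        using u[OF j] unfolding split_beta' by measurable
      from S.borel_measurable_nn_integral_fst[OF this]
      show "(\<lambda>y. \<integral>\<^sup>+t. ?u j (y(l := t)) \<partial>circle_haar) \<in> borel_measurable torus_prod" by simp
    qed
    also have "\<dots> = (\<Prod>j\<in>J. torus_mean (p j) (F j) ?R)"
      unfolding torus_mean_def by (intro prod.cong refl S.nn_integral_fun_upd(1)[symmetric] u)
    also have "\<dots> \<le> (\<Prod>j\<in>J. N j)" by (intro prod_mono_ennreal N)
    finally have up: "a n + (\<integral>\<^sup>+z. \<delta> z \<partial>PiM J (\<lambda>_. torus_prod)) \<le> (\<Prod>j\<in>J. N j)" .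
    have low: "ennreal (?R\<^sup>2 / 2 * \<kappa>) * dilated_mean v1 (\<lambda>_. ?R) \<le> (\<integral>\<^sup>+z. \<delta> z \<partial>PiM J (\<lambda>_. torus_prod))"
    proof -
      interpret PT: product_sigma_finite "\<lambda>_::nat. (torus_prod :: ('n \<Rightarrow> complex) measure)"
        by (intro product_sigma_finite.intro PS.sigma_finite_measure_axioms)
      define J' where "J' = J - {j1}"
      have J': "finite J'" "j1 \<notin> J'" "J = insert j1 J'" "j2 \<in> J'" "J' \<subseteq> J" using J(1) j12 by (auto simp: J'_def)
      have dilate_rescale: "dilate (\<lambda>_. ?R) = (rescale ?R :: ('n \<Rightarrow> complex) \<Rightarrow> _)"
        by (auto simp: dilate_def rescale_def fun_eq_iff)
      \<comment> \<open>With the point \<open>y\<close> of factor \<open>j1\<close> fixed,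
        \<open>\<delta>\<close> is a product over the other factors, so its integral is a product of
        torus means, each at least the value at the centre.\<close>
      have pt: "ennreal (?R\<^sup>2 / 2 * \<kappa>) * (ennreal (v1 (dilate (\<lambda>_. ?R) y)) * indicator closed_polydisc_fun y)
        \<le> (\<integral>\<^sup>+z. \<delta> (z(j1 := y)) \<partial>PiM J' (\<lambda>_. torus_prod))" if "y \<in> closed_polydisc_fun" for y
      proof -
        define c where "c = h (rescale ?R y)"
        define \<psi> where "\<psi> j x = ennreal (v c j (dilate (\<lambda>_. ?R) x)) * indicator closed_polydisc_fun x" for j x
        have v0: "0 \<le> v c j x" for j x by (simp add: v_def b0)
        have \<delta>_eq: "\<delta> (z(j1 := y)) = ennreal (?R\<^sup>2 / 2 * b j1 (rescale ?R y)) * (\<Prod>j\<in>J'. \<psi> j (z j))" for z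
        proof -
          have p1: "(\<Prod>j\<in>J. b j (rescale ?R ((z(j1 := y)) j))) = b j1 (rescale ?R y) * (\<Prod>j\<in>J'. b j (rescale ?R (z j)))"
            unfolding J'(3) using J'(1,2) by (simp, intro disjI2 prod.cong) auto
          have p2: "(\<Prod>j\<in>J. indicator closed_polydisc_fun ((z(j1 := y)) j)) = (\<Prod>j\<in>J'. indicator closed_polydisc_fun (z j) :: ennreal)"
            unfolding J'(3) using J'(1,2) that by (simp, intro prod.cong) auto
          have p3: "(\<Prod>j\<in>J'. v c j (rescale ?R (z j))) = (norm (c - h (rescale ?R (z j2))))\<^sup>2 * (\<Prod>j\<in>J'. b j (rescale ?R (z j)))"
            unfolding v_def prod.distrib using J'(1,4) by (simp add: prod.delta if_distrib[of "\<lambda>f. f _"] cong: if_cong)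
          have psi: "(\<Prod>j\<in>J'. \<psi> j (z j)) = ennreal (\<Prod>j\<in>J'. v c j (rescale ?R (z j))) * (\<Prod>j\<in>J'. indicator closed_polydisc_fun (z j))"
            unfolding \<psi>_def prod.distrib dilate_rescale using v0 by (simp add: prod_ennreal)
          have "ennreal (?R\<^sup>2 / 2 * b j1 (rescale ?R y)) * (\<Prod>j\<in>J'. \<psi> j (z j))
            = ennreal (?R\<^sup>2 / 2 * b j1 (rescale ?R y) * ((norm (c - h (rescale ?R (z j2))))\<^sup>2 * (\<Prod>j\<in>J'. b j (rescale ?R (z j))))) * (\<Prod>j\<in>J'. indicator closed_polydisc_fun (z j))"
            unfolding psi p3 by (subst ennreal_mult) (auto intro!: mult_nonneg_nonneg prod_nonneg b0 simp: mult.assoc)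
          then show ?thesis unfolding \<delta>_def p1 p2 using j12(3) by (simp add: c_def mult_ac)
        qed
        have "(\<integral>\<^sup>+z. \<delta> (z(j1 := y)) \<partial>PiM J' (\<lambda>_. torus_prod))
          = ennreal (?R\<^sup>2 / 2 * b j1 (rescale ?R y)) * (\<integral>\<^sup>+z. (\<Prod>j\<in>J'. \<psi> j (z j)) \<partial>PiM J' (\<lambda>_. torus_prod))"
        proof -
          have \<psi>m: "\<psi> j \<in> borel_measurable borel_prod" if "j \<in> J'" for j
            unfolding \<psi>_def[abs_def] using vm[of j c] that J' R
            by (intro dilated_mean_measurable) (auto simp: slice_mono_def)
          have "(\<lambda>z. \<Prod>j\<in>J'. \<psi> j (z j)) \<in> borel_measurable (PiM J' (\<lambda>_. torus_prod))"
            by (intro borel_measurable_prod_ennreal measurable_compose[OF measurable_component_singleton])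
               (simp_all add: \<psi>m)
          then show ?thesis
            unfolding \<delta>_eq by (rule nn_integral_cmult)
        qed
        also have "(\<integral>\<^sup>+z. (\<Prod>j\<in>J'. \<psi> j (z j)) \<partial>PiM J' (\<lambda>_. torus_prod)) = (\<Prod>j\<in>J'. dilated_mean (v c j) (\<lambda>_. ?R))"
        proof -
          have \<psi>m: "\<psi> j \<in> borel_measurable torus_prod" if "j \<in> J'" for j
            unfolding S.measurable_power \<psi>_def[abs_def] using vm[of j c] that J' R
            by (intro dilated_mean_measurable) (auto simp: slice_mono_def)
          show ?thesis
            using prod_nn_integral[OF J'(1) PS.sigma_finite_measure_axioms \<psi>m] by (simp add: dilated_mean_def \<psi>_def)
        qed
        finally have e: "(\<integral>\<^sup>+z. \<delta> (z(j1 := y)) \<partial>PiM J' (\<lambda>_. torus_prod))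
          = ennreal (?R\<^sup>2 / 2 * b j1 (rescale ?R y)) * (\<Prod>j\<in>J'. dilated_mean (v c j) (\<lambda>_. ?R))" .
        have "ennreal (\<Prod>j\<in>J'. v c j (\<lambda>_. 0)) = (\<Prod>j\<in>J'. dilated_mean (v c j) (\<lambda>_. 0))"
          using v0 by (simp add: dilated_mean_zero prod_ennreal)
        also have "\<dots> \<le> (\<Prod>j\<in>J'. dilated_mean (v c j) (\<lambda>_. ?R))"
          using J' R by (intro prod_mono_ennreal dilated_mean_mono vm) auto
        finally have le: "ennreal (\<Prod>j\<in>J'. v c j (\<lambda>_. 0)) \<le> (\<Prod>j\<in>J'. dilated_mean (v c j) (\<lambda>_. ?R))" .
        have p0: "(\<Prod>j\<in>J'. v c j (\<lambda>_. 0)) = (norm (c - h (\<lambda>_. 0)))\<^sup>2 * \<kappa>"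
          unfolding v_def prod.distrib \<kappa>_def J'_def[symmetric] using J'(1,4)
          by (simp add: prod.delta if_distrib[of "\<lambda>f. f _"] cong: if_cong)
        have "ennreal (?R\<^sup>2 / 2 * \<kappa>) * (ennreal (v1 (dilate (\<lambda>_. ?R) y)) * indicator closed_polydisc_fun y)
          = ennreal (?R\<^sup>2 / 2 * b j1 (rescale ?R y)) * ennreal (\<Prod>j\<in>J'. v c j (\<lambda>_. 0))"
          unfolding p0 dilate_rescale v1_def using that kpos b0
          by (simp add: c_def ennreal_mult'[symmetric] mult_ac)
        also have "\<dots> \<le> (\<integral>\<^sup>+z. \<delta> (z(j1 := y)) \<partial>PiM J' (\<lambda>_. torus_prod))"
          unfolding e by (intro mult_left_mono le) auto
        finally show ?thesis .
      qed
      have "ennreal (?R\<^sup>2 / 2 * \<kappa>) * dilated_mean v1 (\<lambda>_. ?R)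
        = (\<integral>\<^sup>+y. ennreal (?R\<^sup>2 / 2 * \<kappa>) * (ennreal (v1 (dilate (\<lambda>_. ?R) y)) * indicator closed_polydisc_fun y) \<partial>torus_prod)"
        unfolding dilated_mean_def using v1m R
        by (intro nn_integral_cmult[symmetric]) (auto simp: slice_mono_def intro!: dilated_mean_measurable)
      also have "\<dots> \<le> (\<integral>\<^sup>+y. \<integral>\<^sup>+z. \<delta> (z(j1 := y)) \<partial>PiM J' (\<lambda>_. torus_prod) \<partial>torus_prod)"
        by (rule nn_integral_mono_AE, rule eventually_mono[OF AE_torus_prod], rule pt) (simp add: closed_polydisc_fun_def)
      also have "\<dots> = (\<integral>\<^sup>+z. \<delta> z \<partial>PiM J (\<lambda>_. torus_prod))"
        unfolding J'(3) using \<delta>m J' by (intro PT.product_nn_integral_insert_rev[symmetric]) auto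
      finally show ?thesis .
    qed
    show ?thesis by (rule order_trans[OF add_left_mono[OF low] up])
  qed
  have Pfin: "(\<Prod>j\<in>J. N j) < \<top>" by (rule ennreal_prod_less_top[OF Nfin])
  have v1zero: "dilated_mean v1 r = 0" if r: "\<And>i. 0 \<le> r i \<and> r i < 1" for r
  proof -
    have "\<forall>\<^sub>F n in sequentially. r i < radius_seq n" for i using order_tendstoD(1)[OF radius_seq(3)] r by auto
    then have "\<forall>\<^sub>F n in sequentially. \<forall>i. r i < radius_seq n" by (rule eventually_all_finite)
    then obtain n0 where n0: "\<And>n i. n \<ge> n0 \<Longrightarrow> r i < radius_seq n" by (auto simp: eventually_sequentially)
    \<comment> \<open>The constant taken at \<open>radius_seq 0\<close> and the mean taken at the
      fixed radii \<open>r\<close> bound the gap from below for all large \<open>n\<close> at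
      once.\<close>
    define d where "d = ennreal ((radius_seq 0)\<^sup>2 / 2 * \<kappa>) * dilated_mean v1 r"
    have ad: "a n + d \<le> (\<Prod>j\<in>J. N j)" if n: "n \<ge> n0" for n
    proof -
      have "d \<le> ennreal ((radius_seq n)\<^sup>2 / 2 * \<kappa>) * dilated_mean v1 (\<lambda>_. radius_seq n)"
        unfolding d_def using radius_seq(1,2)[of n] radius_seq(1)[of 0] radius_seq(4)[of 0 n] n0[OF n] r kpos
        by (intro mult_mono ennreal_leI mult_right_mono divide_right_mono power_mono dilated_mean_mono v1m)
          (auto simp: less_imp_le)
      then show ?thesis using gap[of n] by (meson add_left_mono order_trans)
    qed
    have "polydisc_integral J p F \<le> liminf a" unfolding a_def by (rule polydisc_integral_le_liminf[OF J p F])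
    also have "\<dots> \<le> (\<Prod>j\<in>J. N j) - d"
    proof (rule Liminf_le)
      show "\<forall>\<^sub>F n in sequentially. a n \<le> (\<Prod>j\<in>J. N j) - d"
      proof (rule eventually_sequentiallyI[of n0])
        fix n assume "n0 \<le> n"
        from ad[OF this] have "a n + d - d \<le> (\<Prod>j\<in>J. N j) - d" by (rule ennreal_minus_mono) simp
        moreover have "d < \<top>"
          using ad[OF \<open>n0 \<le> n\<close>] Pfin by (metis add_increasing2 dual_order.strict_trans1 le_less_trans order_refl add.commute zero_le)
        ultimately show "a n \<le> (\<Prod>j\<in>J. N j) - d" by simp
      qed
    qed simp
    finally have le: "(\<Prod>j\<in>J. N j) \<le> (\<Prod>j\<in>J. N j) - d" using eq by (rule order_trans[rotated])
    have "d \<le> a n0 + d" by simp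
    also have "\<dots> \<le> (\<Prod>j\<in>J. N j)" by (rule ad) simp
    finally have dN: "d \<le> (\<Prod>j\<in>J. N j)" .
    obtain x where x: "(\<Prod>j\<in>J. N j) = ennreal x" "x \<ge> 0" using Pfin by (cases "\<Prod>j\<in>J. N j") auto
    obtain y where y: "d = ennreal y" "y \<ge> 0" using dN x by (cases d) (auto simp: top_unique)
    have "y = 0" using le dN x y by (simp add: ennreal_minus)
    then have "d = 0" using y by simp
    moreover have "ennreal ((radius_seq 0)\<^sup>2 / 2 * \<kappa>) \<noteq> 0" using kpos radius_seq(1)[of 0] by simp
    ultimately show ?thesis unfolding d_def by simp
  qed
  have hconst: "h z = h (\<lambda>_. 0)" if z: "z \<in> polydisc_fun" for z
  proof -
    \<comment> \<open>Polar coordinates: \<open>z\<close> is a dilated torus point, with phase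
      \<open>1\<close> where \<open>z i = 0\<close>. On that torus \<open>h\<close> equals its
      central value almost everywhere, hence on a dense set, hence at \<open>z\<close> by
      continuity.\<close>
    define r where "r i = norm (z i)" for i
    define s where "s i = (if z i = 0 then 1 else z i / of_real (norm (z i)))" for i
    have r: "0 \<le> r i \<and> r i < 1" for i using z by (auto simp: r_def polydisc_fun_def)
    have s: "norm (s i) = 1" for i by (simp add: s_def norm_divide)
    have zs: "z = dilate r s" by (auto simp: dilate_def r_def s_def fun_eq_iff)
    have "AE y in torus_prod. ennreal (v1 (dilate r y)) * indicator closed_polydisc_fun y = 0"
      using v1zero[OF r] v1m unfolding dilated_mean_def
      by (subst (asm) nn_integral_0_iff_AE) (auto simp: slice_mono_def intro!: dilated_mean_measurable r)
    then have "AE y in torus_prod. h (dilate r y) = h (\<lambda>_. 0) \<and> y \<in> closed_polydisc_fun"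
      using AE_torus_prod
    proof eventually_elim
      case (elim y)
      then have y: "y \<in> closed_polydisc_fun" by (simp add: closed_polydisc_fun_def)
      then have "v1 (dilate r y) \<le> 0" using elim by (simp add: ennreal_eq_0_iff)
      moreover have "0 < b j1 (dilate r y)" by (intro bpos j12 dilate_polydisc_fun y r)
      ultimately show ?case using y unfolding v1_def by (auto simp: mult_le_0_iff)
    qed
    moreover have "0 < emeasure circle_haar (ball (s i) (1 / (real k + 1)))" for i k
      by (intro emeasure_circle_haar_ball_pos s) auto
    ultimately have "\<exists>y. (h (dilate r y) = h (\<lambda>_. 0) \<and> y \<in> closed_polydisc_fun) \<and> (\<forall>i. dist (s i) (y i) < 1 / (real k + 1))" for k
      by (rule S.AE_imp_dense)
    then obtain Y where Y: "\<And>k. h (dilate r (Y k)) = h (\<lambda>_. 0)" "\<And>k. Y k \<in> closed_polydisc_fun" "\<And>k i. dist (s i) (Y k i) < 1 / (real k + 1)"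
      by metis
    have "(\<lambda>k. dilate r (Y k)) \<longlonglongrightarrow> dilate r s"
    proof (rule tendsto_funI)
      fix i
      have "(\<lambda>k. Y k i) \<longlonglongrightarrow> s i"
        using continuous_on_tendsto_compose[OF continuous_on_product_coordinates[of i] tendsto_fun_dist[OF Y(3)]] by simp
      then show "(\<lambda>k. dilate r (Y k) i) \<longlonglongrightarrow> dilate r s i" unfolding dilate_def by (intro tendsto_intros)
    qed
    then have "(\<lambda>k. h (dilate r (Y k))) \<longlonglongrightarrow> h (dilate r s)"
      by (rule continuous_on_tendsto_compose[OF ch]) (use z zs dilate_polydisc_fun[OF Y(2) r] in auto)
    then show ?thesis using Y(1) zs by (simp add: LIMSEQ_const_iff)
  qed
  have zero: "(\<lambda>_. 0) \<in> (polydisc_fun :: ('n \<Rightarrow> complex) set)" by (simp add: polydisc_fun_def)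
  \<comment> \<open>A single good slice with \<open>norm q < 1\<close> gives strictness everywhere,
    because the pole is constant.\<close>
  obtain y' q where yq: "y' \<in> polydisc_fun" "norm q < 1" "slice_pole l y' q"
  proof (rule slice_pole_dense[OF zero zero_less_one])
    fix y' q assume "y' \<in> polydisc_fun" "norm q < 1" "slice_pole l y' q"
    then show thesis by (rule that)
  qed
  have "q = h y'" using yq by (intro h(4)) auto
  then have hq: "h y = q" if "y \<in> polydisc_fun" for y using hconst[OF that] hconst[OF yq(1)] by simp
  show ?thesis by (rule that[OF yq(2)]) (use h(3) hq in auto)
qed

text \<open>Starting from \<open>0\<close>, the coordinates of \<open>y\<close> are inserted one at
  a time; the pole in a coordinate does not depend on the others, so the kernel factors
  multiply.\<close>

theorem polydisc_equality_kernel: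
  obtains w where "\<And>l. norm (w l) < 1"
    "\<And>j y. j \<in> J \<Longrightarrow> y \<in> polydisc_fun \<Longrightarrow> F j y = F j (\<lambda>_. 0) * (\<Prod>l\<in>UNIV. (1 - w l * y l) powr (- of_real (2 / p j)))"
    "\<And>j. j \<in> J \<Longrightarrow> F j (\<lambda>_. 0) \<noteq> 0"
proof -
  have "\<exists>w. norm w < 1 \<and> (\<forall>y\<in>polydisc_fun. slice_pole l y w)" for l
    using pole_constant[of l] by metis
  then obtain w where w: "\<And>l. norm (w l) < 1" "\<And>l y. y \<in> polydisc_fun \<Longrightarrow> slice_pole l y (w l)" by metis
  have zero: "(\<lambda>_. 0) \<in> (polydisc_fun :: ('n \<Rightarrow> complex) set)" by (simp add: polydisc_fun_def)
  have "F j (override_on (\<lambda>_. 0) y K) = F j (\<lambda>_. 0) * (\<Prod>l\<in>K. (1 - w l * y l) powr (- of_real (2 / p j)))"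
    if j: "j \<in> J" and y: "y \<in> polydisc_fun" and "finite K" for j y K
    using that(3)
  proof (induction K rule: finite_induct)
    case (insert i K)
    define x where "x = override_on (\<lambda>_. 0) y K"
    have x: "x \<in> polydisc_fun" using y by (auto simp: x_def polydisc_fun_def override_on_def)
    have yi: "norm (y i) < 1" using y by (simp add: polydisc_fun_def)
    have "override_on (\<lambda>_. 0) y (insert i K) = x(i := y i)" "x(i := 0) = x"
      using insert.hyps by (auto simp: x_def override_on_def fun_eq_iff)
    then have "F j (override_on (\<lambda>_. 0) y (insert i K)) = F j x * (1 - w i * y i) powr (- of_real (2 / p j))"
      using slice_poleD[OF w(2)[OF x] j yi, of i] by simp
    then show ?case using insert by (simp add: x_def)
  qed simp
  from this[of _ _ UNIV, OF _ _ finite] show ?thesis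
    using that[OF w(1)] F_nonzero[OF _ zero] by (simp add: override_on_def)
qed

end

unbundle no fps_syntax
unbundle vec_syntax

section \<open>Kernels attain equality\<close>

lemma measurable_prod_components:
  fixes g :: "'n::finite \<Rightarrow> complex \<Rightarrow> ennreal"
  assumes "\<And>l. g l \<in> borel_measurable borel"
  shows "(\<lambda>y. \<Prod>l\<in>UNIV. g l (y l)) \<in> borel_measurable borel_prod"
proof (intro borel_measurable_prod_ennreal)
  fix l :: 'n
  have "(\<lambda>y. y l) \<in> measurable borel_prod borel" by simp
  from measurable_compose[OF this assms] show "(\<lambda>y. g l (y l)) \<in> borel_measurable borel_prod" .
qed

lemma nn_integral_prod_power:
  assumes "borel_prob \<nu>" and g: "\<And>l. g l \<in> borel_measurable borel"
  shows "(\<integral>\<^sup>+y. (\<Prod>l\<in>UNIV. g l (y l)) \<partial>PiM UNIV (\<lambda>_::'n::finite. \<nu>)) = (\<Prod>l\<in>UNIV. \<integral>\<^sup>+t. g l t \<partial>\<nu>)"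
proof -
  interpret borel_prob \<nu> by fact
  interpret product_sigma_finite "\<lambda>_::'n. \<nu>" by (rule product_sigma_finite_nu)
  show ?thesis by (rule product_nn_integral_prod) (simp_all add: g)
qed

lemma norm_kernel_powr:
  assumes p: "p > 0" and w: "\<And>l. norm (w l) < 1" and y: "y \<in> polydisc_fun"
  shows "norm (c * (\<Prod>l\<in>UNIV. (1 - w l * y l) powr (- of_real (2 / p)))) powr p
    = norm c powr p * (\<Prod>l\<in>UNIV. 1 / (norm (1 - w l * y l :: complex))\<^sup>2)"
proof -
  have 1: "norm ((1 - w l * y l) powr (- of_real (2 / p))) powr p = 1 / (norm (1 - w l * y l))\<^sup>2" for l
  proof -
    have "norm (w l * y l) < 1"
      using w[of l] y by (intro norm_mult_less_1) (auto simp: polydisc_fun_def less_imp_le)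
    then have nz: "1 - w l * y l \<noteq> 0" by auto
    have "norm ((1 - w l * y l) powr (- of_real (2 / p))) powr p = (norm (1 - w l * y l) powr (- (2 / p))) powr p"
      by (subst norm_powr_real_powr') simp_all
    also have "\<dots> = norm (1 - w l * y l) powr (- 2)" using p by (simp add: powr_powr)
    also have "\<dots> = 1 / (norm (1 - w l * y l))\<^sup>2"
      using nz by (simp add: powr_minus powr_numeral divide_inverse)
    finally show ?thesis .
  qed
  have "(\<Prod>l\<in>A. a l) powr p = (\<Prod>l\<in>A. a l powr p)" if "\<And>l. 0 \<le> a l" for A and a :: "'a \<Rightarrow> real"
    using that by (induction A rule: infinite_finite_induct) (auto simp: powr_mult prod_nonneg)
  from this[of "\<lambda>l. norm ((1 - w l * y l) powr (- of_real (2 / p)))" UNIV]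
  show ?thesis unfolding norm_mult by (subst powr_mult) (simp_all only: prod_norm[symmetric] 1 norm_ge_zero)
qed

text \<open>On the torus a dilated kernel splits into one-variable kernels with ratios
  \<open>w l * r\<close>, whose norms are largest without dilation. An upper bound is enough, since
  the reverse estimate is the main inequality.\<close>

lemma torus_mean_kernel_le:
  fixes F :: "('n::finite \<Rightarrow> complex) \<Rightarrow> complex"
  assumes p: "p > 0" and w: "\<And>l. norm (w l) < 1" and r: "0 \<le> r" "r < 1"
    and F: "\<And>y. y \<in> polydisc_fun \<Longrightarrow> F y = c * (\<Prod>l\<in>UNIV. (1 - w l * y l) powr (- of_real (2 / p)))"
  shows "torus_mean p F r \<le> ennreal (norm c powr p) * (\<Prod>l\<in>UNIV. wnorm 0 (geom_fps (w l)))"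
proof -
  define g where "g l t = ennreal (1 / (norm (1 - (w l * of_real r) * t))\<^sup>2) * indicator (sphere 0 1) t" for l t
  have g: "g l \<in> borel_measurable borel" for l
  proof -
    have [measurable]: "sphere (0::complex) 1 \<in> sets borel" by (intro borel_closed closed_sphere)
    show ?thesis unfolding g_def by measurable
  qed
  have wr: "norm (w l * of_real r) \<le> norm (w l)" for l
    using r by (simp add: norm_mult mult_right_le_one_le)
  have "torus_mean p F r = (\<integral>\<^sup>+y. ennreal (norm c powr p) * (\<Prod>l\<in>UNIV. g l (y l)) \<partial>torus_prod)"
    unfolding torus_mean_def
  proof (rule nn_integral_cong_AE, rule eventually_mono[OF AE_torus_prod])
    fix y :: "'n \<Rightarrow> complex" assume y: "\<forall>i. norm (y i) = 1"
    then have yC: "y \<in> closed_polydisc_fun" by (simp add: closed_polydisc_fun_def)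
    have s: "rescale r y \<in> polydisc_fun" by (rule rescale_closed_polydisc_fun[OF yC r])
    have "cutoff p F r y = ennreal (norm c powr p * (\<Prod>l\<in>UNIV. 1 / (norm (1 - w l * rescale r y l))\<^sup>2))"
      unfolding cutoff_def F[OF s] norm_kernel_powr[OF p w s] using yC by simp
    also have "\<dots> = ennreal (norm c powr p) * (\<Prod>l\<in>UNIV. g l (y l))"
      using y by (simp add: ennreal_mult prod_nonneg prod_ennreal[symmetric] g_def rescale_def mult_ac)
    finally show "cutoff p F r y = ennreal (norm c powr p) * (\<Prod>l\<in>UNIV. g l (y l))" .
  qed
  also have "\<dots> = ennreal (norm c powr p) * (\<integral>\<^sup>+y. (\<Prod>l\<in>UNIV. g l (y l)) \<partial>torus_prod)"
  proof (rule nn_integral_cmult)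
    interpret borel_prob circle_haar by (rule borel_prob_circle)
    show "(\<lambda>y. \<Prod>l\<in>UNIV. g l (y l)) \<in> borel_measurable (torus_prod :: ('n \<Rightarrow> complex) measure)"
      unfolding measurable_power by (rule measurable_prod_components[OF g])
  qed
  also have "\<dots> = ennreal (norm c powr p) * (\<Prod>l\<in>UNIV. wnorm 0 (geom_fps (w l * of_real r)))"
    unfolding nn_integral_prod_power[OF borel_prob_circle g]
    using nn_integral_circle_kernel[OF le_less_trans[OF wr w]] by (simp add: g_def[abs_def])
  also have "\<dots> \<le> ennreal (norm c powr p) * (\<Prod>l\<in>UNIV. wnorm 0 (geom_fps (w l)))"
    by (intro mult_left_mono prod_mono_ennreal wnorm_geom_fps_mono wr) auto
  finally show ?thesis .
qed

text \<open>By \<open>nn_integral_disc_kernel\<close> the disc integral of a kernel power is the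
  power of its Hardy norm, so the integral reaches exactly the product of the bounds in
  \<open>torus_mean_kernel_le\<close>.\<close>

lemma polydisc_integral_kernel:
  fixes F :: "nat \<Rightarrow> ('n::finite \<Rightarrow> complex) \<Rightarrow> complex"
  assumes J: "finite J" "card J \<ge> 2" and p: "\<And>j. j \<in> J \<Longrightarrow> p j > 0" and w: "\<And>l. norm (w l) < 1"
    and F: "\<And>j y. j \<in> J \<Longrightarrow> y \<in> polydisc_fun \<Longrightarrow> F j y = c j * (\<Prod>l\<in>UNIV. (1 - w l * y l) powr (- of_real (2 / p j)))"
  shows "polydisc_integral J p F = (\<Prod>j\<in>J. ennreal (norm (c j) powr p j) * (\<Prod>l\<in>UNIV. wnorm 0 (geom_fps (w l))))"
proof -
  define g where "g l t = ennreal ((1 / (norm (1 - w l * t))\<^sup>2) ^ card J) * indicator (ball 0 1) t" for l t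
  have g: "g l \<in> borel_measurable borel" for l
  proof -
    have [measurable]: "ball (0::complex) 1 \<in> sets borel" by simp
    show ?thesis unfolding g_def by measurable
  qed
  define C where "C = (\<Prod>j\<in>J. norm (c j) powr p j)"
  have C: "C \<ge> 0" by (simp add: C_def prod_nonneg)
  have "polydisc_integral J p F = (\<integral>\<^sup>+y. ennreal C * (\<Prod>l\<in>UNIV. g l (y l)) \<partial>bergman_prod (card J))"
    unfolding polydisc_integral_def
  proof (rule nn_integral_cong_AE, rule eventually_mono[OF AE_bergman_prod[OF J(2)]])
    fix y :: "'n \<Rightarrow> complex" assume y: "y \<in> polydisc_fun"
    have "(\<Prod>j\<in>J. norm (F j y) powr p j) = (\<Prod>j\<in>J. norm (c j) powr p j * (\<Prod>l\<in>UNIV. 1 / (norm (1 - w l * y l))\<^sup>2))"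
      by (intro prod.cong refl) (simp only: F[OF _ y] norm_kernel_powr[OF p w y])
    also have "\<dots> = C * (\<Prod>l\<in>UNIV. (1 / (norm (1 - w l * y l))\<^sup>2) ^ card J)"
      by (simp add: prod.distrib C_def prod_power_distrib)
    finally have e: "(\<Prod>j\<in>J. norm (F j y) powr p j) = C * (\<Prod>l\<in>UNIV. (1 / (norm (1 - w l * y l))\<^sup>2) ^ card J)" .
    have "(\<Prod>l\<in>UNIV. g l (y l)) = ennreal (\<Prod>l\<in>UNIV. (1 / (norm (1 - w l * y l))\<^sup>2) ^ card J)"
      using y by (simp add: g_def polydisc_fun_def prod_ennreal)
    then show "ennreal (\<Prod>j\<in>J. norm (F j y) powr p j) * indicator polydisc_fun y = ennreal C * (\<Prod>l\<in>UNIV. g l (y l))"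
      using y C unfolding e by (simp add: ennreal_mult prod_nonneg)
  qed
  also have "\<dots> = ennreal C * (\<integral>\<^sup>+y. (\<Prod>l\<in>UNIV. g l (y l)) \<partial>bergman_prod (card J))"
  proof (rule nn_integral_cmult)
    interpret borel_prob "bergman_disc (card J)" by (rule borel_prob_bergman[OF J(2)])
    show "(\<lambda>y. \<Prod>l\<in>UNIV. g l (y l)) \<in> borel_measurable (bergman_prod (card J) :: ('n \<Rightarrow> complex) measure)"
      unfolding measurable_power by (rule measurable_prod_components[OF g])
  qed
  also have "\<dots> = ennreal C * (\<Prod>l\<in>UNIV. wnorm 0 (geom_fps (w l)) ^ card J)"
    unfolding nn_integral_prod_power[OF borel_prob_bergman[OF J(2)] g]
    using nn_integral_disc_kernel[OF J(2) w] by (simp add: g_def[abs_def])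
  also have "\<dots> = (\<Prod>j\<in>J. ennreal (norm (c j) powr p j) * (\<Prod>l\<in>UNIV. wnorm 0 (geom_fps (w l))))"
    by (simp add: prod.distrib C_def prod_ennreal prod_power_distrib)
  finally show ?thesis .
qed

section \<open>Transfer to \<open>complex ^ 'n\<close>\<close>

lemma continuous_on_vec_lambda_UNIV: "continuous_on UNIV (vec_lambda :: ('n::finite \<Rightarrow> complex) \<Rightarrow> complex ^ 'n)"
proof -
  have "continuous_on UNIV (\<lambda>x :: 'n \<Rightarrow> complex. \<chi> i. x i)"
    by (intro continuous_on_vec_lambda continuous_on_product_coordinates)
  then show ?thesis by simp
qed

lemma vec_lambda_measurable: "vec_lambda \<in> measurable borel_prod (borel :: (complex ^ 'n::finite) measure)"
  unfolding measurable_cong_sets[OF sets_borel_prod refl]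
  by (rule borel_measurable_continuous_onI[OF continuous_on_vec_lambda_UNIV])

lemma polydisc_iff: "vec_lambda x \<in> polydisc \<longleftrightarrow> x \<in> polydisc_fun"
  by (simp add: polydisc_def polydisc_fun_def)

lemma analytic_vec_on_imp_continuous_on:
  assumes "analytic_vec_on f S"
  shows "continuous_on S f"
proof (rule continuous_at_imp_continuous_on, rule ballI)
  fix z assume "z \<in> S"
  then obtain D where "(f has_derivative D) (at z)" using assms unfolding analytic_vec_on_def by blast
  then show "isCont f z" by (rule has_derivative_continuous)
qed

text \<open>The slice derivative is \<open>D\<close> composed with the embedding \<open>L\<close> of
  coordinate \<open>i\<close>; complex linearity of \<open>D\<close> makes it multiplication by
  \<open>D (L 1)\<close>.\<close>

lemma analytic_imp_sep_hol:
  fixes f :: "complex ^ 'n \<Rightarrow> complex"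
  assumes f: "analytic_vec_on f polydisc"
  shows "sep_hol (\<lambda>x. f (vec_lambda x))"
  unfolding sep_hol_def
proof (intro conjI ballI allI)
  have "continuous_on polydisc f"
    by (rule analytic_vec_on_imp_continuous_on[OF f])
  then show "continuous_on polydisc_fun (\<lambda>x. f (vec_lambda x))"
    by (rule continuous_on_compose2[OF _ continuous_on_subset[OF continuous_on_vec_lambda_UNIV]])
       (auto simp: polydisc_iff)
  fix x :: "'n \<Rightarrow> complex" and i :: 'n assume x: "x \<in> polydisc_fun"
  define L where "L v = (\<chi> k. if k = i then v else 0)" for v :: complex
  have "linear L" by (rule linearI) (auto simp: L_def vec_eq_iff)
  then have L: "bounded_linear L" by (rule linear_conv_bounded_linear[THEN iffD1])
  have e: "vec_lambda (x(i := t)) = vec_lambda (x(i := 0)) + L t" for t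
    by (auto simp: L_def vec_eq_iff)
  show "(\<lambda>t. f (vec_lambda (x(i := t)))) holomorphic_on ball 0 1"
    unfolding holomorphic_on_open[OF open_ball]
  proof (intro ballI)
    fix t :: complex assume t: "t \<in> ball 0 1"
    then have "vec_lambda (x(i := t)) \<in> polydisc" using polydisc_fun_upd[OF x] by (simp add: polydisc_iff)
    then obtain D where D: "(f has_derivative D) (at (vec_lambda (x(i := t))))" "\<And>c v. D (c *s v) = c * D v"
      using f unfolding analytic_vec_on_def by blast
    have "((\<lambda>t. vec_lambda (x(i := 0)) + L t) has_derivative L) (at t)"
      using has_derivative_add[OF has_derivative_const bounded_linear_imp_has_derivative[OF L]] by simp
    then have "((\<lambda>t. vec_lambda (x(i := t))) has_derivative L) (at t)" by (simp only: e[symmetric])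
    from has_derivative_compose[OF this D(1)]
    have d: "((\<lambda>t. f (vec_lambda (x(i := t)))) has_derivative (\<lambda>v. D (L v))) (at t)" .
    have "D (L v) = D (L 1) * v" for v
    proof -
      have "L v = v *s L 1" by (auto simp: L_def vec_eq_iff)
      then have "D (L v) = D (v *s L 1)" by (rule arg_cong)
      also have "\<dots> = D (L 1) * v" unfolding D(2) by (rule mult.commute)
      finally show ?thesis .
    qed
    then have e: "(\<lambda>v. D (L v)) = (*) (D (L 1))" by (rule ext)
    show "\<exists>f'. ((\<lambda>t. f (vec_lambda (x(i := t)))) has_field_derivative f') (at t)"
      unfolding has_field_derivative_def by (rule exI) (rule d[unfolded e])
  qed
qed

lemma nn_integral_power_measure:
  assumes "borel_prob \<nu>" "u \<in> borel_measurable borel"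
  shows "(\<integral>\<^sup>+z. u z \<partial>(power_measure \<nu> :: (complex ^ 'n) measure)) = (\<integral>\<^sup>+x. u (vec_lambda x) \<partial>PiM UNIV (\<lambda>_. \<nu>))"
proof -
  interpret borel_prob \<nu> by fact
  show ?thesis
    unfolding power_measure_def using assms(2)
    by (subst nn_integral_distr) (simp_all add: vec_lambda_measurable)
qed

lemma sets_power_measure [simp]: "sets (power_measure \<nu> :: (complex ^ 'n) measure) = sets borel"
  by (simp add: power_measure_def)

lemma borel_measurable_power_measure [simp]:
  "borel_measurable (power_measure \<nu> :: (complex ^ 'n) measure) = borel_measurable borel"
  by (rule measurable_cong_sets) simp_all

text \<open>A real-valued integral that diverges has the default value \<open>0\<close>, so
  finiteness must be shown before the means can be identified. It comes from compactness of the
  closed polydisc, where the dilated function is continuous.\<close>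

lemma hardy_mean_torus_mean:
  fixes f :: "complex ^ 'n \<Rightarrow> complex"
  assumes f: "analytic_vec_on f polydisc" and p: "p > 0" and r: "0 \<le> r" "r < 1"
  shows "torus_mean p (\<lambda>x. f (vec_lambda x)) r = ennreal (hardy_mean p f r powr p)"
    and "0 \<le> hardy_mean p f r"
proof -
  define K where "K = {z :: complex ^ 'n. \<forall>i. norm (z $ i) \<le> 1}"
  have "closed K"
    unfolding K_def by (intro closed_Collect_all closed_Collect_le continuous_intros)
  moreover have "bounded K"
  proof (rule boundedI)
    fix z assume "z \<in> K"
    then have "(\<Sum>i\<in>UNIV. norm (z $ i)) \<le> (\<Sum>i\<in>(UNIV :: 'n set). 1)"
      by (intro sum_mono) (simp add: K_def)
    then show "norm z \<le> real CARD('n)"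
      unfolding norm_vec_def using L2_set_le_sum[of UNIV "\<lambda>i. norm (z $ i)"] by simp
  qed
  ultimately have "compact K" by (simp add: compact_eq_bounded_closed)
  have torK: "(torus :: (complex ^ 'n) set) \<subseteq> K" by (auto simp: torus_def K_def)
  have "closed (torus :: (complex ^ 'n) set)"
    unfolding torus_def by (intro closed_Collect_all closed_Collect_eq continuous_intros)
  then have tor: "(torus :: (complex ^ 'n) set) \<in> sets borel" by (rule borel_closed)
  have contf: "continuous_on polydisc f"
    by (rule analytic_vec_on_imp_continuous_on[OF f])
  have contK: "continuous_on K (\<lambda>z. norm (f (r *\<^sub>R z)) powr p)"
  proof (intro continuous_on_norm_powr p continuous_on_compose2[OF contf] continuous_intros)
    show "(*\<^sub>R) r ` K \<subseteq> polydisc"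
      using r contraction_less_1[OF r] by (auto simp: K_def polydisc_def)
  qed
  have "compact ((\<lambda>z. norm (f (r *\<^sub>R z)) powr p) ` K)"
    by (rule compact_continuous_image[OF contK \<open>compact K\<close>])
  then obtain B where B: "\<forall>z\<in>K. norm (f (r *\<^sub>R z)) powr p \<le> B"
    by (auto dest!: compact_imp_bounded simp: bounded_iff)
  define u where "u z = indicator torus z *\<^sub>R (norm (f (r *\<^sub>R z)) powr p)" for z :: "complex ^ 'n"
  have um: "u \<in> borel_measurable borel"
    unfolding u_def by (intro borel_measurable_continuous_on_indicator tor continuous_on_subset[OF contK torK])
  have u0: "0 \<le> u z" for z by (simp add: u_def)
  have t: "(\<integral>\<^sup>+z. ennreal (u z) \<partial>torus_haar) = torus_mean p (\<lambda>x. f (vec_lambda x)) r"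
  proof -
    have "(\<integral>\<^sup>+z. ennreal (u z) \<partial>torus_haar) = (\<integral>\<^sup>+x. ennreal (u (vec_lambda x)) \<partial>torus_prod)"
      unfolding torus_haar_def using um by (intro nn_integral_power_measure borel_prob_circle) measurable
    also have "\<dots> = torus_mean p (\<lambda>x. f (vec_lambda x)) r"
      unfolding torus_mean_def
    proof (rule nn_integral_cong_AE, rule eventually_mono[OF AE_torus_prod])
      fix x :: "'n \<Rightarrow> complex" assume x: "\<forall>i. norm (x i) = 1"
      have "r *\<^sub>R vec_lambda x = vec_lambda (rescale r x)"
        by (simp add: vec_eq_iff rescale_def scaleR_conv_of_real[where 'a = complex])
      then show "ennreal (u (vec_lambda x)) = cutoff p (\<lambda>x. f (vec_lambda x)) r x"
        using x by (simp add: u_def cutoff_def torus_def closed_polydisc_fun_def)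
    qed
    finally show ?thesis .
  qed
  have "torus_mean p (\<lambda>x. f (vec_lambda x)) r < \<top>"
  proof -
    interpret borel_prob circle_haar by (rule borel_prob_circle)
    interpret T: prob_space "torus_prod :: ('n \<Rightarrow> complex) measure" by (rule prob_space_power)
    have "(\<integral>\<^sup>+x. ennreal (u (vec_lambda x)) \<partial>torus_prod) \<le> (\<integral>\<^sup>+x. ennreal (max 0 B) \<partial>(torus_prod :: ('n \<Rightarrow> complex) measure))"
      using B torK by (intro nn_integral_mono ennreal_leI) (auto simp: u_def max.coboundedI2 split: split_indicator)
    also have "\<dots> < \<top>" by (simp add: T.emeasure_space_1)
    finally show ?thesis
      unfolding t[symmetric] torus_haar_def
      using um by (subst nn_integral_power_measure) (auto intro: borel_prob_circle)
  qed
  moreover have I: "(LINT z:torus|torus_haar. norm (f (r *\<^sub>R z)) powr p) = enn2real (\<integral>\<^sup>+z. ennreal (u z) \<partial>torus_haar)"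
    unfolding set_lebesgue_integral_def u_def[symmetric]
    using um u0 by (intro integral_eq_nn_integral) (simp_all add: torus_haar_def)
  ultimately have eq: "torus_mean p (\<lambda>x. f (vec_lambda x)) r = ennreal (LINT z:torus|torus_haar. norm (f (r *\<^sub>R z)) powr p)"
    unfolding t by (simp add: ennreal_enn2real)
  have "0 \<le> (LINT z:torus|torus_haar. norm (f (r *\<^sub>R z)) powr p)" unfolding I by simp
  then have "hardy_mean p f r powr p = (LINT z:torus|torus_haar. norm (f (r *\<^sub>R z)) powr p)"
    unfolding hardy_mean_def using p by (simp add: powr_powr)
  then show "torus_mean p (\<lambda>x. f (vec_lambda x)) r = ennreal (hardy_mean p f r powr p)" using eq by simp
  show "0 \<le> hardy_mean p f r" by (simp add: hardy_mean_def)
qed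

lemma torus_mean_le_hardy_norm:
  assumes f: "f \<in> hardy_space p" and p: "p > 0" and r: "0 \<le> r" "r < 1"
  shows "torus_mean p (\<lambda>x. f (vec_lambda x)) r \<le> ennreal (hardy_norm p f powr p)"
proof -
  have a: "analytic_vec_on f polydisc" and b: "bdd_above (hardy_mean p f ` {0..<1})"
    using f by (auto simp: hardy_space_def)
  have "hardy_mean p f r \<le> hardy_norm p f"
    unfolding hardy_norm_def using r by (intro cSUP_upper b) auto
  then show ?thesis
    unfolding hardy_mean_torus_mean(1)[OF a p r] using p hardy_mean_torus_mean(2)[OF a p r]
    by (intro ennreal_leI powr_mono2) auto
qed

text \<open>Supplies the norm bounds for vanishing functions and for kernels, where all torus means
  are estimated directly.\<close>

lemma hardy_norm_le:
  assumes f: "f \<in> hardy_space p" and p: "p > 0" and B: "B \<ge> 0"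
    and le: "\<And>r. 0 \<le> r \<Longrightarrow> r < 1 \<Longrightarrow> torus_mean p (\<lambda>x. f (vec_lambda x)) r \<le> ennreal B"
  shows "hardy_norm p f powr p \<le> B"
proof -
  have a: "analytic_vec_on f polydisc" and b: "bdd_above (hardy_mean p f ` {0..<1})"
    using f by (auto simp: hardy_space_def)
  have "hardy_mean p f r \<le> B powr (1 / p)" if "r \<in> {0..<1}" for r
  proof -
    have r: "0 \<le> r" "r < 1" using that by auto
    have h: "hardy_mean p f r powr p \<le> B"
      using le[OF r] B unfolding hardy_mean_torus_mean(1)[OF a p r] by simp
    have "hardy_mean p f r = (hardy_mean p f r powr p) powr (1 / p)"
      using p hardy_mean_torus_mean(2)[OF a p r] by (simp add: powr_powr)
    also have "\<dots> \<le> B powr (1 / p)" using h p by (intro powr_mono2) auto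
    finally show ?thesis .
  qed
  then have le: "hardy_norm p f \<le> B powr (1 / p)"
    unfolding hardy_norm_def by (intro cSUP_least) auto
  have "0 \<le> hardy_mean p f 0" by (rule hardy_mean_torus_mean(2)[OF a p]) auto
  also have "\<dots> \<le> hardy_norm p f" unfolding hardy_norm_def by (intro cSUP_upper b) auto
  finally have "hardy_norm p f powr p \<le> (B powr (1 / p)) powr p"
    using le p by (intro powr_mono2) auto
  then show ?thesis using p B by (simp add: powr_powr)
qed

theorem theorem4p1:
  fixes m :: nat
    and p :: "nat \<Rightarrow> real"
    and f :: "nat \<Rightarrow> complex ^ 'n \<Rightarrow> complex"
  assumes "m \<ge> 2"
    and "\<And>j. j \<in> {1..m} \<Longrightarrow> 0 < p j"
    and "\<And>j. j \<in> {1..m} \<Longrightarrow> f j \<in> hardy_space (p j)"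
  shows "set_integrable (bergman_polydisc m) polydisc (\<lambda>z. \<Prod>j=1..m. norm (f j z) powr p j)
    \<and> (LINT z:polydisc|bergman_polydisc m. (\<Prod>j=1..m. norm (f j z) powr p j))
        \<le> (\<Prod>j=1..m. hardy_norm (p j) (f j) powr p j)
    \<and> ((LINT z:polydisc|bergman_polydisc m. (\<Prod>j=1..m. norm (f j z) powr p j))
        = (\<Prod>j=1..m. hardy_norm (p j) (f j) powr p j)
      \<longleftrightarrow> (\<forall>z\<in>polydisc. (\<Prod>j=1..m. f j z) = 0)
        \<or> (\<exists>w\<in>polydisc. \<exists>c :: nat \<Rightarrow> complex. \<forall>j\<in>{1..m}. c j \<noteq> 0
            \<and> (\<forall>z\<in>polydisc. f j z = c j * szego_kernel_powr (2 / p j) z w)))"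
proof -
  define J where "J = {1..m}"
  have J: "finite J" "card J \<ge> 2" "card J = m" using assms(1) by (auto simp: J_def)
  note p = assms(2)[folded J_def] and f = assms(3)[folded J_def]
  define F where "F j x = f j (vec_lambda x)" for j x
  have an: "analytic_vec_on (f j) polydisc" if "j \<in> J" for j using f[OF that] by (simp add: hardy_space_def)
  have F: "sep_hol (F j)" if "j \<in> J" for j
    unfolding F_def by (rule analytic_imp_sep_hol[OF an[OF that]])
  define h where "h j = hardy_norm (p j) (f j) powr p j" for j
  have h0: "h j \<ge> 0" for j by (simp add: h_def)
  have N: "torus_mean (p j) (F j) (radius_seq n) \<le> ennreal (h j)" if "j \<in> J" for j n
    unfolding F_def[abs_def] h_def using radius_seq(1,2)[of n] by (intro torus_mean_le_hardy_norm f p that) auto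
  have hp: "(\<Prod>j\<in>J. ennreal (h j)) = ennreal (\<Prod>j\<in>J. h j)" using h0 by (simp add: prod_ennreal)
  have le: "polydisc_integral J p F \<le> ennreal (\<Prod>j\<in>J. h j)"
    unfolding hp[symmetric] by (rule polydisc_inequality[OF J(1,2) p F N])
  define u where "u z = indicator polydisc z *\<^sub>R (\<Prod>j\<in>J. norm (f j z) powr p j)" for z
  have u0: "0 \<le> u z" for z by (simp add: u_def prod_nonneg)
  have um: "u \<in> borel_measurable borel"
  proof -
    have "open (polydisc :: (complex ^ 'n) set)"
      unfolding polydisc_def Collect_all_eq
      by (intro open_INT finite ballI open_Collect_less continuous_intros)
    moreover have "continuous_on polydisc (f j)" if "j \<in> J" for j
      by (rule analytic_vec_on_imp_continuous_on[OF an[OF that]])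
    ultimately show ?thesis
      unfolding u_def
      by (intro borel_measurable_continuous_on_indicator borel_open continuous_on_prod continuous_on_norm_powr p)
  qed
  have nu: "(\<integral>\<^sup>+z. ennreal (u z) \<partial>bergman_polydisc m) = polydisc_integral J p F"
  proof -
    have "(\<integral>\<^sup>+z. ennreal (u z) \<partial>bergman_polydisc m) = (\<integral>\<^sup>+x. ennreal (u (vec_lambda x)) \<partial>bergman_prod m)"
      unfolding bergman_polydisc_def using um assms(1)
      by (intro nn_integral_power_measure borel_prob_bergman) measurable
    also have "\<dots> = polydisc_integral J p F"
      unfolding polydisc_integral_def J(3)
      by (intro nn_integral_cong) (auto simp: u_def F_def polydisc_iff split: split_indicator)
    finally show ?thesis .
  qed
  have umb: "u \<in> borel_measurable (bergman_polydisc m)" using um by (simp add: bergman_polydisc_def)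
  have fin: "polydisc_integral J p F < \<top>" using le by (rule le_less_trans) simp
  have int: "integrable (bergman_polydisc m) u"
    using umb u0 fin by (intro integrableI_nonneg) (auto simp: nu)
  have val: "integral\<^sup>L (bergman_polydisc m) u = enn2real (polydisc_integral J p F)"
    using umb u0 by (subst integral_eq_nn_integral) (auto simp: nu)
  have polydisc_integral_val: "polydisc_integral J p F = ennreal (integral\<^sup>L (bergman_polydisc m) u)"
    unfolding val using fin by (simp add: ennreal_enn2real)
  have I0: "0 \<le> integral\<^sup>L (bergman_polydisc m) u" unfolding val by simp
  have H0: "0 \<le> (\<Prod>j\<in>J. h j)" by (intro prod_nonneg h0)
  have leI: "integral\<^sup>L (bergman_polydisc m) u \<le> (\<Prod>j\<in>J. h j)"
    using le H0 unfolding polydisc_integral_val by simp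
  have zero_case: "integral\<^sup>L (bergman_polydisc m) u = (\<Prod>j\<in>J. h j)"
    if z: "\<forall>z\<in>polydisc. (\<Prod>j\<in>J. f j z) = 0"
  proof -
    interpret borel_prob "bergman_disc m" by (rule borel_prob_bergman[OF assms(1)])
    interpret PM: prob_space "bergman_prod m :: ('n \<Rightarrow> complex) measure" by (rule prob_space_power)
    \<comment> \<open>If no factor vanished identically, all of them, and so their product, would be
      nonzero almost everywhere.\<close>
    have "\<exists>j\<in>J. \<forall>x\<in>polydisc_fun. F j x = 0"
    proof (rule ccontr)
      assume "\<not> ?thesis"
      then have "AE y in bergman_prod m. \<forall>j\<in>J. F j y \<noteq> 0"
        using sep_hol_nonzero_AE[OF assms(1) F] J(1) by (intro AE_finite_allI) auto
      then have "AE y in (bergman_prod m :: ('n \<Rightarrow> complex) measure). False"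
        using AE_bergman_prod[OF assms(1)]
      proof eventually_elim
        case (elim y)
        then have "(\<Prod>j\<in>J. f j (vec_lambda y)) = 0" using z by (auto simp: polydisc_iff)
        then show ?case using elim J(1) by (auto simp: F_def)
      qed
      then show False by simp
    qed
    then obtain j where j: "j \<in> J" "\<And>x. x \<in> polydisc_fun \<Longrightarrow> F j x = 0" by auto
    have "torus_mean (p j) (F j) r = 0" if "0 \<le> r" "r < 1" for r
    proof -
      have "cutoff (p j) (F j) r y = 0" for y
        using j(2)[OF rescale_closed_polydisc_fun[OF _ that]] by (simp add: cutoff_def split: split_indicator)
      then show ?thesis by (simp add: torus_mean_def)
    qed
    then have "h j \<le> 0"
      unfolding h_def by (intro hardy_norm_le f p j) (simp_all add: F_def[abs_def])
    then have "h j = 0" using h0[of j] by linarith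
    then have "(\<Prod>j\<in>J. h j) = 0" using j J(1) by auto
    then show ?thesis using leI I0 by simp
  qed
  have kernel_case: "integral\<^sup>L (bergman_polydisc m) u = (\<Prod>j\<in>J. h j)"
    if w: "w \<in> polydisc" and c: "\<forall>j\<in>J. c j \<noteq> 0 \<and> (\<forall>z\<in>polydisc. f j z = c j * szego_kernel_powr (2 / p j) z w)" for w c
  proof -
    define v where "v l = cnj (w $ l)" for l
    have v: "norm (v l) < 1" for l using w by (simp add: v_def polydisc_def)
    have Fv: "F j y = c j * (\<Prod>l\<in>UNIV. (1 - v l * y l) powr (- of_real (2 / p j)))" if "j \<in> J" "y \<in> polydisc_fun" for j y
      using c that by (simp add: F_def polydisc_iff szego_kernel_powr_def v_def mult.commute)
    define K where "K = (\<Prod>l\<in>UNIV. wnorm 0 (geom_fps (v l)))"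
    have "K < \<top>" unfolding K_def by (intro ennreal_prod_less_top wnorm_geom_fps_finite v)
    then obtain k where k: "K = ennreal k" "k \<ge> 0" by (cases K) auto
    have hle: "h j \<le> norm (c j) powr p j * k" if j: "j \<in> J" for j
      unfolding h_def
    proof (rule hardy_norm_le[OF f[OF j] p[OF j]])
      fix r :: real assume r: "0 \<le> r" "r < 1"
      have "torus_mean (p j) (F j) r \<le> ennreal (norm (c j) powr p j) * K"
        unfolding K_def by (rule torus_mean_kernel_le[OF p[OF j] v r Fv[OF j]])
      then show "torus_mean (p j) (\<lambda>x. f j (vec_lambda x)) r \<le> ennreal (norm (c j) powr p j * k)"
        using k by (simp add: F_def[abs_def] ennreal_mult)
    qed (use k in auto)
    \<comment> \<open>The product of the norm bounds is the polydisc integral itself; the opposite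
      inequality is \<open>leI\<close>.\<close>
    have "ennreal (\<Prod>j\<in>J. h j) \<le> ennreal (\<Prod>j\<in>J. norm (c j) powr p j * k)"
      using hle h0 by (intro ennreal_leI prod_mono) auto
    also have "\<dots> = (\<Prod>j\<in>J. ennreal (norm (c j) powr p j) * K)"
      using k by (simp add: prod_ennreal[symmetric] ennreal_mult)
    also have "\<dots> = polydisc_integral J p F"
      unfolding K_def by (rule polydisc_integral_kernel[OF J(1,2) p v Fv, symmetric])
    finally have "(\<Prod>j\<in>J. h j) \<le> integral\<^sup>L (bergman_polydisc m) u"
      using I0 unfolding polydisc_integral_val by simp
    then show ?thesis using leI by simp
  qed
  have eq_case: "\<exists>w\<in>polydisc. \<exists>c :: nat \<Rightarrow> complex. \<forall>j\<in>J. c j \<noteq> 0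
      \<and> (\<forall>z\<in>polydisc. f j z = c j * szego_kernel_powr (2 / p j) z w)"
    if eq: "integral\<^sup>L (bergman_polydisc m) u = (\<Prod>j\<in>J. h j)" and nz: "\<not> (\<forall>z\<in>polydisc. (\<Prod>j\<in>J. f j z) = 0)"
  proof -
    obtain z where z: "z \<in> polydisc" "(\<Prod>j\<in>J. f j z) \<noteq> 0" using nz by auto
    interpret polydisc_equality J p F "\<lambda>j. ennreal (h j)"
    proof
      show "(\<Prod>j\<in>J. ennreal (h j)) \<le> polydisc_integral J p F" unfolding hp polydisc_integral_val eq by simp
      show "\<exists>x\<in>polydisc_fun. F j x \<noteq> 0" if "j \<in> J" for j
      proof (rule bexI)
        show "F j (vec_nth z) \<noteq> 0" using z(2) that J(1) by (auto simp: F_def vec_nth_inverse)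
        show "vec_nth z \<in> polydisc_fun" using z(1) by (simp add: polydisc_fun_def polydisc_def)
      qed
    qed (use J p F N in auto)
    obtain v where v: "\<And>l. norm (v l) < 1"
      "\<And>j y. j \<in> J \<Longrightarrow> y \<in> polydisc_fun \<Longrightarrow> F j y = F j (\<lambda>_. 0) * (\<Prod>l\<in>UNIV. (1 - v l * y l) powr (- of_real (2 / p j)))"
      "\<And>j. j \<in> J \<Longrightarrow> F j (\<lambda>_. 0) \<noteq> 0"
    proof (rule polydisc_equality_kernel)
      fix w assume "\<And>l. norm (w l) < 1"
        "\<And>j y. j \<in> J \<Longrightarrow> y \<in> polydisc_fun \<Longrightarrow> F j y = F j (\<lambda>_. 0) * (\<Prod>l\<in>UNIV. (1 - w l * y l) powr (- of_real (2 / p j)))"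
        "\<And>j. j \<in> J \<Longrightarrow> F j (\<lambda>_. 0) \<noteq> 0"
      then show thesis by (rule that)
    qed
    \<comment> \<open>The ratios found on slices are the conjugates of the coordinates of the kernel
      point.\<close>
    define w where "w = (\<chi> l. cnj (v l))"
    have w: "w \<in> polydisc" using v(1) by (simp add: w_def polydisc_def)
    have "f j z = F j (\<lambda>_. 0) * szego_kernel_powr (2 / p j) z w" if "j \<in> J" "z \<in> polydisc" for j z
    proof -
      have "vec_nth z \<in> polydisc_fun" using that by (simp add: polydisc_fun_def polydisc_def)
      from v(2)[OF that(1) this] show ?thesis
        by (simp add: F_def vec_nth_inverse szego_kernel_powr_def w_def mult.commute)
    qed
    then show ?thesis using w v(3) by (intro bexI[of _ w] exI[of _ "\<lambda>j. F j (\<lambda>_. 0)"]) auto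
  qed
  have iff: "integral\<^sup>L (bergman_polydisc m) u = (\<Prod>j\<in>J. h j) \<longleftrightarrow>
      (\<forall>z\<in>polydisc. (\<Prod>j\<in>J. f j z) = 0)
        \<or> (\<exists>w\<in>polydisc. \<exists>c :: nat \<Rightarrow> complex. \<forall>j\<in>J. c j \<noteq> 0
            \<and> (\<forall>z\<in>polydisc. f j z = c j * szego_kernel_powr (2 / p j) z w))"
    (is "?E \<longleftrightarrow> ?Z \<or> ?K")
  proof
    assume ?E
    show "?Z \<or> ?K"
    proof (cases ?Z)
      case False
      from eq_case[OF \<open>?E\<close> this] show ?thesis by (rule disjI2)
    qed (rule disjI1)
  next
    assume "?Z \<or> ?K"
    then show ?E
    proof
      assume ?Z
      then show ?E by (rule zero_case)
    next
      assume ?K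
      then obtain w c where "w \<in> polydisc"
        "\<forall>j\<in>J. c j \<noteq> 0 \<and> (\<forall>z\<in>polydisc. f j z = c j * szego_kernel_powr (2 / p j) z w)"
        by (elim bexE exE)
      then show ?E by (rule kernel_case)
    qed
  qed
  show ?thesis
    unfolding set_integrable_def set_lebesgue_integral_def J_def[symmetric]
    using int leI iff unfolding u_def[abs_def] h_def by (intro conjI)
qed

end
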